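(* Assume the Triangle Detection Conjecture. Let $H$ be a graph which is not $\alpha$-acyclic. Then $\textsc{hom-cnt}_{H}$ is hard.
   Context: All graphs are finite and simple. For graphs $H,G$, a homomorphism from $H$ to $G$ is a map $\varphi:V(H)\to V(G)$ with $\{\varphi(u),\varphi(v)\}\in E(G)$ for every $\{u,v\}\in E(H)$; $\hom(H,G)$ denotes the number of homomorphisms from $H$ to $G$. A graph $G$ is $\kappa$-degenerate if there is an ordering $v_1,\dots,v_n$ of its vertices such that each $v_i$ has at most $\kappa$ neighbours in $\{v_{i+1},\dots,v_n\}$. $\textsc{hom-cnt}_{H}$ is the problem of computing $\hom(H,G)$ for an input graph $G$. It is called easy if there is a (randomized) algorithm in the word RAM model with $O(\log n)$-bit words solving it in expected time $f(\kappa,H)\cdot n$ on every $n$-vertex input graph of degeneracy $\kappa$, for some function $f$; otherwise it is called hard. Triangle Detection Conjecture: there exists $\gamma>0$ such that in the word RAM model of $O(\log n)$ bits, any algorithm deciding whether an input graph with $n$ vertices and $m$ edges is triangle-free requires $\Omega(m^{1+\gamma})$ expected time. A hypergraph $F$ is $\alpha$-acyclic if there is a tree $T$ whose vertex set is the set of hyperedges of $F$ such that for all hyperedges $e_1,e_2,e$, if $e$ lies on the path in $T$ between $e_1$ and $e_2$, then $e_1\cap e_2\subseteq e$. For a directed acyclic graph $\vec H$ and a vertex $u$, let $R(u)$ be the set of vertices reachable from $u$ by a directed path (including $u$). If $u_1,\dots,u_r$ are the sources (in-degree $0$ vertices) of $\vec H$, the hypergraph associated with $\vec H$ has vertex set $V(\vec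 H)$ and hyperedges $R(u_1),\dots,R(u_r)$; $\vec H$ is $\alpha$-acyclic if this hypergraph is $\alpha$-acyclic. An undirected graph $H$ is $\alpha$-acyclic if every acyclic orientation of $H$ is $\alpha$-acyclic. *)

theory Defs
  imports "HOL-Probability.Probability_Mass_Function"
begin

section \<open>Finite simple graphs\<close>

record 'a graph =
  verts :: "'a set"
  edges :: "'a set set"

definition simple_graph :: "'a graph \<Rightarrow> bool" where
  "simple_graph G \<longleftrightarrow>
     finite (verts G) \<and> (\<forall>e \<in> edges G. e \<subseteq> verts G \<and> card e = 2)"

text \<open>Maps are taken to be extensional, so that each homomorphism is counted once.\<close>

definition homs :: "'a graph \<Rightarrow> 'b graph \<Rightarrow> ('a \<Rightarrow> 'b) set" where
  "homs H G = {\<phi> \<in> verts H \<rightarrow>\<^sub>E verts G.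
     \<forall>u v. {u, v} \<in> edges H \<longrightarrow> {\<phi> u, \<phi> v} \<in> edges G}"

definition hom_count :: "'a graph \<Rightarrow> 'b graph \<Rightarrow> nat" where
  "hom_count H G = card (homs H G)"

definition triangle_free :: "'a graph \<Rightarrow> bool" where
  "triangle_free G \<longleftrightarrow>
     \<not> (\<exists>u v w. {u, v} \<in> edges G \<and> {v, w} \<in> edges G \<and> {u, w} \<in> edges G)"

definition degenerate :: "nat \<Rightarrow> 'a graph \<Rightarrow> bool" where
  "degenerate \<kappa> G \<longleftrightarrow>
     (\<exists>vs. distinct vs \<and> set vs = verts G \<and>
        (\<forall>i < length vs.
           card {j. i < j \<and> j < length vs \<and> {vs ! i, vs ! j} \<in> edges G} \<le> \<kappa>))"

definition degeneracy :: "'a graph \<Rightarrow> nat" where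
  "degeneracy G = (LEAST \<kappa>. degenerate \<kappa> G)"


section \<open>Trees and \<open>\<alpha>\<close>-acyclicity\<close>

definition path_in :: "'a graph \<Rightarrow> 'a list \<Rightarrow> bool" where
  "path_in G xs \<longleftrightarrow>
     xs \<noteq> [] \<and> distinct xs \<and> set xs \<subseteq> verts G \<and>
     (\<forall>i. Suc i < length xs \<longrightarrow> {xs ! i, xs ! Suc i} \<in> edges G)"

definition path_between :: "'a graph \<Rightarrow> 'a \<Rightarrow> 'a list \<Rightarrow> 'a \<Rightarrow> bool" where
  "path_between G u xs v \<longleftrightarrow> path_in G xs \<and> hd xs = u \<and> last xs = v"

definition has_cycle :: "'a graph \<Rightarrow> bool" where
  "has_cycle G \<longleftrightarrow>
     (\<exists>xs. path_in G xs \<and> 3 \<le> length xs \<and> {last xs, hd xs} \<in> edges G)"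

text \<open>The graph without vertices counts as a tree. It only matters for the hypergraph
  without hyperedges, which is thereby \<open>\<alpha>\<close>-acyclic.\<close>

definition tree :: "'a graph \<Rightarrow> bool" where
  "tree T \<longleftrightarrow>
     simple_graph T \<and>
     (\<forall>u \<in> verts T. \<forall>v \<in> verts T. \<exists>xs. path_between T u xs v) \<and>
     \<not> has_cycle T"

text \<open>A hypergraph is given by its set of hyperedges.\<close>

definition alpha_acyclic_hypergraph :: "'a set set \<Rightarrow> bool" where
  "alpha_acyclic_hypergraph F \<longleftrightarrow>
     (\<exists>T. tree T \<and> verts T = F \<and>
        (\<forall>e1 \<in> F. \<forall>e2 \<in> F. \<forall>e \<in> F. \<forall>xs.
           path_between T e1 xs e2 \<and> e \<in> set xs \<longrightarrow> e1 \<inter> e2 \<subseteq> e))"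

text \<open>Directed graphs on the vertex set of \<open>H\<close> are given by their arc relation.\<close>

definition acyclic_orientation :: "'a graph \<Rightarrow> ('a \<times> 'a) set \<Rightarrow> bool" where
  "acyclic_orientation H D \<longleftrightarrow>
     (\<forall>(u, v) \<in> D. {u, v} \<in> edges H) \<and>
     (\<forall>u v. {u, v} \<in> edges H \<longrightarrow> ((u, v) \<in> D) \<noteq> ((v, u) \<in> D)) \<and>
     acyclic D"

definition reach :: "('a \<times> 'a) set \<Rightarrow> 'a \<Rightarrow> 'a set" where
  "reach D u = {v. (u, v) \<in> D\<^sup>*}"

definition sources :: "'a set \<Rightarrow> ('a \<times> 'a) set \<Rightarrow> 'a set" where
  "sources V D = {u \<in> V. \<forall>v. (v, u) \<notin> D}"

definition alpha_acyclic_dag :: "'a set \<Rightarrow> ('a \<times> 'a) set \<Rightarrow> bool" where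
  "alpha_acyclic_dag V D \<longleftrightarrow> alpha_acyclic_hypergraph (reach D ` sources V D)"

definition alpha_acyclic :: "'a graph \<Rightarrow> bool" where
  "alpha_acyclic H \<longleftrightarrow>
     (\<forall>D. acyclic_orientation H D \<longrightarrow> alpha_acyclic_dag (verts H) D)"


section \<open>The randomized word RAM\<close>

text \<open>A program is a fixed list of instructions over registers and a random access memory,
  all of whose cells hold \<open>w\<close>-bit words. Jump targets are absolute, and the machine halts when
  the program counter leaves the program.\<close>

datatype binop = Add | Sub | Mul | Div | Mod | And | Or | Xor | ShiftL | ShiftR

datatype instr =
    SetConst nat nat         \<comment> \<open>\<open>SetConst r k\<close>: \<open>R\<^sub>r := k\<close>\<close>
  | Op binop nat nat nat     \<comment> \<open>\<open>Op b r p q\<close>: \<open>R\<^sub>r := b R\<^sub>p R\<^sub>q\<close>\<close>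
  | Load nat nat             \<comment> \<open>\<open>Load r p\<close>: \<open>R\<^sub>r := M[R\<^sub>p]\<close>\<close>
  | Store nat nat            \<comment> \<open>\<open>Store p q\<close>: \<open>M[R\<^sub>p] := R\<^sub>q\<close>\<close>
  | RandBelow nat nat        \<comment> \<open>\<open>RandBelow r p\<close>: \<open>R\<^sub>r :=\<close> uniformly random in \<open>{0..<R\<^sub>p}\<close>\<close>
  | JumpIfZero nat nat       \<comment> \<open>\<open>JumpIfZero r l\<close>: continue at \<open>l\<close> if \<open>R\<^sub>r = 0\<close>\<close>

type_synonym program = "instr list"

record state =
  pc :: nat
  reg :: "nat \<Rightarrow> nat"
  mem :: "nat \<Rightarrow> nat"

text \<open>\<open>Sub\<close> is truncated at \<open>0\<close>; division by \<open>0\<close> follows the HOL conventions.\<close>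

fun eval_op :: "binop \<Rightarrow> nat \<Rightarrow> nat \<Rightarrow> nat" where
  "eval_op Add x y = x + y"
| "eval_op Sub x y = x - y"
| "eval_op Mul x y = x * y"
| "eval_op Div x y = x div y"
| "eval_op Mod x y = x mod y"
| "eval_op And x y = Bit_Operations.and x y"
| "eval_op Or x y = Bit_Operations.or x y"
| "eval_op Xor x y = Bit_Operations.xor x y"
| "eval_op ShiftL x y = push_bit y x"
| "eval_op ShiftR x y = drop_bit y x"

text \<open>Arithmetic does not wrap around: an instruction whose result is not a \<open>w\<close>-bit word leaves
  the state unchanged, so that the machine hangs forever. An algorithm thus has to keep all its
  values within the word length. Word lengths are only ever fixed up to a constant factor, and up
  to that factor this is equivalent to computing modulo \<open>2 ^ w\<close>.\<close>

definition write_reg :: "nat \<Rightarrow> nat \<Rightarrow> nat \<Rightarrow> state \<Rightarrow> state" where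
  "write_reg w r x s =
     (if x < 2 ^ w then s\<lparr>pc := Suc (pc s), reg := (reg s)(r := x)\<rparr> else s)"

fun exec :: "nat \<Rightarrow> instr \<Rightarrow> state \<Rightarrow> state pmf" where
  "exec w (SetConst r k) s = return_pmf (write_reg w r k s)"
| "exec w (Op b r p q) s = return_pmf (write_reg w r (eval_op b (reg s p) (reg s q)) s)"
| "exec w (Load r p) s = return_pmf (write_reg w r (mem s (reg s p)) s)"
| "exec w (Store p q) s =
     return_pmf (s\<lparr>pc := Suc (pc s), mem := (mem s)(reg s p := reg s q)\<rparr>)"
| "exec w (RandBelow r p) s =
     (if reg s p = 0 then return_pmf s
      else map_pmf (\<lambda>x. write_reg w r x s) (pmf_of_set {0..<reg s p}))"
| "exec w (JumpIfZero r l) s =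
     return_pmf (s\<lparr>pc := (if reg s r = 0 then l else Suc (pc s))\<rparr>)"

definition halted :: "program \<Rightarrow> state \<Rightarrow> bool" where
  "halted P s \<longleftrightarrow> length P \<le> pc s"

definition step :: "nat \<Rightarrow> program \<Rightarrow> state \<Rightarrow> state pmf" where
  "step w P s = (if halted P s then return_pmf s else exec w (P ! pc s) s)"

primrec run :: "nat \<Rightarrow> program \<Rightarrow> nat \<Rightarrow> state \<Rightarrow> state pmf" where
  "run w P 0 s = return_pmf s"
| "run w P (Suc t) s = bind_pmf (step w P s) (run w P t)"

text \<open>With probability 1, the program halts with the value \<open>x\<close> in register 0.\<close>

definition outputs :: "nat \<Rightarrow> program \<Rightarrow> state \<Rightarrow> nat \<Rightarrow> bool" where
  "outputs w P s x \<longleftrightarrow>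
     (\<lambda>t. measure_pmf.prob (run w P t s) {s'. halted P s' \<and> reg s' 0 = x}) \<longlonglongrightarrow> 1"

text \<open>The running time \<open>T\<close> is the number of steps executed before halting. Its expectation is the
  sum over \<open>t\<close> of the probability that step number \<open>t\<close> is executed, that is, of \<open>P(T > t)\<close>; it is
  infinite if the program fails to halt with positive probability.\<close>

definition expected_time :: "nat \<Rightarrow> program \<Rightarrow> state \<Rightarrow> ennreal" where
  "expected_time w P s = (\<Sum>t. emeasure (measure_pmf (run w P t s)) {s'. \<not> halted P s'})"


section \<open>Graph problems on the word RAM\<close>

text \<open>Input graphs have the vertices \<open>0, \<dots>, n - 1\<close> and are presented as a list of their edges, in
  any order and with the endpoints of each edge in any order. Initially, register 0 holds \<open>n\<close>,
  register 1 holds the number \<open>m\<close> of edges, memory cells \<open>0, \<dots>, 2m - 1\<close> hold the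
  endpoints, and everything else is \<open>0\<close>.\<close>

definition presents :: "(nat \<times> nat) list \<Rightarrow> nat \<Rightarrow> nat graph \<Rightarrow> bool" where
  "presents es n G \<longleftrightarrow>
     1 \<le> n \<and> simple_graph G \<and> verts G = {0..<n} \<and>
     distinct (map (\<lambda>(u, v). {u, v}) es) \<and> set (map (\<lambda>(u, v). {u, v}) es) = edges G"

definition init_state :: "nat \<Rightarrow> (nat \<times> nat) list \<Rightarrow> state" where
  "init_state n es =
     \<lparr>pc = 0,
      reg = (\<lambda>_. 0)(0 := n, 1 := length es),
      mem = (\<lambda>a. if a < 2 * length es
                 then (if even a then fst (es ! (a div 2)) else snd (es ! (a div 2)))
                 else 0)\<rparr>"

text \<open>Words of \<open>O(log n)\<close> bits are words of \<open>word_length c n\<close> bits for some constant \<open>c\<close>, which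
  belongs to the algorithm. Below, \<open>c\<close> is at least 2, so that the words and addresses of the input
  fit.\<close>

definition word_length :: "nat \<Rightarrow> nat \<Rightarrow> nat" where
  "word_length c n = c * nat \<lceil>log 2 (real n + 2)\<rceil>"

definition solves :: "program \<Rightarrow> nat \<Rightarrow> (nat graph \<Rightarrow> nat) \<Rightarrow> bool" where
  "solves P c p \<longleftrightarrow>
     (\<forall>n G es. presents es n G \<longrightarrow>
        outputs (word_length c n) P (init_state n es) (p G))"

definition hom_cnt_easy :: "'a graph \<Rightarrow> bool" where
  "hom_cnt_easy H \<longleftrightarrow>
     (\<exists>P c (f :: nat \<Rightarrow> real).
        2 \<le> c \<and> solves P c (\<lambda>G. hom_count H G) \<and>
        (\<forall>n G es. presents es n G \<longrightarrow>
           expected_time (word_length c n) P (init_state n es)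
             \<le> ennreal (f (degeneracy G) * real n)))"

definition hom_cnt_hard :: "'a graph \<Rightarrow> bool" where
  "hom_cnt_hard H \<longleftrightarrow> \<not> hom_cnt_easy H"

text \<open>The bound \<open>\<Omega>(m\<^sup>1\<^sup>+\<^sup>\<gamma>)\<close> is read for the worst case over all graphs with exactly \<open>m\<close>
  edges (and any number of vertices), for all sufficiently large \<open>m\<close>. It is written out because
  the worst-case time may be infinite.\<close>

definition worst_time :: "program \<Rightarrow> nat \<Rightarrow> nat \<Rightarrow> ennreal" where
  "worst_time P c m =
     (SUP (n, G, es) \<in> {(n, G, es). presents es n G \<and> card (edges G) = m}.
        expected_time (word_length c n) P (init_state n es))"

definition triangle_detection_conjecture :: bool where
  "triangle_detection_conjecture \<longleftrightarrow>
     (\<exists>\<gamma> > (0 :: real). \<forall>P c. 2 \<le> c \<and> solves P c (\<lambda>G. if triangle_free G then 1 else 0) \<longrightarrow>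
        (\<exists>C > (0 :: real). \<forall>\<^sub>F m in sequentially.
           ennreal (C * real m powr (1 + \<gamma>)) \<le> worst_time P c m))"

end

theory Submission imports Defs begin

text \<open>
  Suppose that no induced cycle of \<open>H\<close> has length at least 6, and fix an acyclic orientation.
  Consider a vertex \<open>r\<close> and a connected set \<open>K\<close> of vertices that \<open>r\<close> does not reach. If \<open>r\<close> and
  some vertices of \<open>K\<close> reach \<open>x\<close> and \<open>y\<close>, but no single vertex of \<open>K\<close> reaches both, then the vertices
  can be placed around a hexagon so that some closed walk winds around it; a shortest walk winding
  around the hexagon is an induced cycle, of length at least 6. This exclusion yields, as in
  Dirac's theorem on chordal graphs, an ear of the hypergraph of reachability sets, which is therefore
  \<open>\<alpha>\<close>-acyclic by induction.

  So \<open>H\<close> has an induced cycle of length at least 6. Given a graph \<open>G\<close> with \<open>m\<close> edges, replace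
  three vertices of this cycle by copies of the vertices of \<open>G\<close>, the others by copies of its directed
  edges (so that each directed edge is adjacent to its two ends only), and each remaining vertex of
  \<open>H\<close> by an apex vertex. This graph has bounded degeneracy and \<open>O(m)\<close> vertices, and it has a
  homomorphism from \<open>H\<close> that respects the colours iff \<open>G\<close> has a triangle. Such homomorphisms
  are detected by inclusion-exclusion over the sets of edges of \<open>H\<close>, which requires a
  constant number of homomorphism counts. Running a linear-time program for these
  counts on the word RAM decides triangle-freeness in expected time \<open>O(m)\<close>, which contradicts the
  conjecture.
\<close>

section \<open>Join trees\<close>

text \<open>The conjecture measures time by the number \<open>m\<close> of edges, whereas
  \<open>G\<close> may have far more vertices. The reduction must not visit all of them, so a vertex
  is named by the least position of the input list at which it occurs, and isolated vertices get no
  copies. Length 6 is what a triangle asks for: three places for vertices alternate with three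
  places for directed edges, and a longer cycle repeats the third directed edge. Joining two vertex
  classes directly would copy the density of \<open>G\<close>; the detour through directed edges
  bounds the degeneracy, so that the unknown function of it contributes only a constant.
  Homomorphisms that ignore the colours cannot be forbidden, as \<open>hom_count\<close> knows no
  colours. It suffices that all edges of \<open>H\<close> are used: the induced map on the
  non-isolated vertices is then a bijection and can be undone. The given program may leave its
  memory in any state, and clearing a whole region takes more than linear time. So every count gets
  fresh registers and a fresh memory region, and the word length grows by a constant factor to
  address them all.\<close>

lemma path_in_successively:
  "path_in G xs \<longleftrightarrow> xs \<noteq> [] \<and> distinct xs \<and> set xs \<subseteq> verts G \<and>
     successively (\<lambda>u v. {u, v} \<in> edges G) xs"
  by (auto simp: path_in_def successively_conv_nth)

text \<open>Hang \<open>e\<close> as a leaf on \<open>t\<close> in a join tree of \<open>F\<close>.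
  A path from \<open>e\<close> to \<open>e2\<close> continues from \<open>t\<close> inside the old
  tree, and \<open>e \<inter> e2 \<subseteq> t \<inter> e2\<close>, so the old tree supplies the
  inclusion.\<close>

lemma alpha_acyclic_hypergraph_leaf:
  assumes F: "alpha_acyclic_hypergraph F" and e: "e \<notin> F" and t: "t \<in> F"
    and ear: "\<And>e'. e' \<in> F \<Longrightarrow> e \<inter> e' \<subseteq> t"
  shows "alpha_acyclic_hypergraph (insert e F)"
proof -
  obtain T where T: "tree T" "verts T = F"
    and conn': "\<forall>e1 \<in> F. \<forall>e2 \<in> F. \<forall>e \<in> F. \<forall>xs.
      path_between T e1 xs e2 \<and> e \<in> set xs \<longrightarrow> e1 \<inter> e2 \<subseteq> e"
    using F unfolding alpha_acyclic_hypergraph_def by (elim exE conjE)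
  have conn: "e1 \<inter> e2 \<subseteq> e'" if "e1 \<in> F" "e2 \<in> F" "e' \<in> F" "path_between T e1 xs e2" "e' \<in> set xs"
    for e1 e2 e' xs
    by (rule conn'[rule_format, OF that(1-3) conjI[OF that(4,5)]])
  have sT: "simple_graph T" and pT: "\<And>u v. u \<in> F \<Longrightarrow> v \<in> F \<Longrightarrow> \<exists>xs. path_between T u xs v"
    and cT: "\<not> has_cycle T"
    using T unfolding tree_def by auto
  have edgeT: "u \<in> F" "v \<in> F" if "{u, v} \<in> edges T" for u v
    using sT that T(2) unfolding simple_graph_def by auto
  define T' where "T' = \<lparr>verts = insert e F, edges = insert {e, t} (edges T)\<rparr>"
  let ?adj = "\<lambda>u v. {u, v} \<in> edges T" and ?adj' = "\<lambda>u v. {u, v} \<in> edges T'"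
  have et: "e \<noteq> t" using e t by blast
  have nbr: "v = t" if "{e, v} \<in> edges T' \<or> {v, e} \<in> edges T'" for v
    using that edgeT[of e v] edgeT[of v e] e by (auto simp: T'_def doubleton_eq_iff)
  have sub: "path_in T' xs" if "path_in T xs" for xs
    using that by (auto simp: path_in_def T'_def T(2))
  have old: "path_in T xs" if "path_in T' xs" "e \<notin> set xs" for xs
  proof -
    have "{xs ! i, xs ! Suc i} \<noteq> {e, t}" if "Suc i < length xs" for i
    proof -
      have "xs ! i \<in> set xs" "xs ! Suc i \<in> set xs" using that by simp_all
      with \<open>e \<notin> set xs\<close> show ?thesis by (auto simp: doubleton_eq_iff)
    qed
    hence "{xs ! i, xs ! Suc i} \<in> edges T" if "Suc i < length xs" for i
      using \<open>path_in T' xs\<close> that unfolding path_in_def T'_def by simp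
    with \<open>path_in T' xs\<close> \<open>e \<notin> set xs\<close> show ?thesis
      unfolding path_in_def T(2) by (auto simp: T'_def)
  qed
  \<comment> \<open>The only neighbour of \<open>e\<close> is \<open>t\<close>, so an
    \<open>e\<close> in the interior of a path would have \<open>t\<close> on both sides.\<close>
  have split: "(\<exists>zs. xs = e # zs \<and> (zs \<noteq> [] \<longrightarrow> hd zs = t \<and> path_in T zs)) \<or>
      (\<exists>ys. xs = ys @ [e] \<and> (ys \<noteq> [] \<longrightarrow> last ys = t \<and> path_in T ys))"
    if pin: "path_in T' xs" and ein: "e \<in> set xs" for xs
  proof -
    obtain ys zs where xs: "xs = ys @ e # zs" using split_list[OF ein] by blast
    have d: "distinct xs" and V: "set xs \<subseteq> insert e F" and s: "successively ?adj' xs"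
      using pin by (auto simp: path_in_successively T'_def)
    have 1: "last ys = t" if "ys \<noteq> []"
      using s that nbr[of "last ys"] by (simp add: xs successively_append_iff)
    have 2: "hd zs = t" if "zs \<noteq> []"
      using s that nbr[of "hd zs"] by (cases zs) (simp_all add: xs successively_append_iff)
    have "ys = [] \<or> zs = []"
    proof (rule ccontr)
      assume n: "\<not> (ys = [] \<or> zs = [])"
      hence "t \<in> set ys" "t \<in> set zs" using 1 2 last_in_set[of ys] hd_in_set[of zs] by auto
      with d show False by (auto simp: xs)
    qed
    moreover have "path_in T zs" if "zs \<noteq> []"
      using d V s that
      by (intro old) (auto simp: xs path_in_successively successively_append_iff successively_Cons T'_def)
    moreover have "path_in T ys" if "ys \<noteq> []"
      using d V s that
      by (intro old) (auto simp: xs path_in_successively successively_append_iff T'_def)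
    ultimately show ?thesis using 1 2 xs by auto
  qed
  have "tree T'"
    unfolding tree_def
  proof (intro conjI ballI)
    show "simple_graph T'"
      using sT t et T(2) by (auto simp: simple_graph_def T'_def)
  next
    fix u v assume "u \<in> verts T'" "v \<in> verts T'"
    hence uv: "u = e \<or> u \<in> F" "v = e \<or> v \<in> F" by (auto simp: T'_def)
    have from_e: "\<exists>xs. path_between T' e xs v" if "v \<in> F" for v
    proof -
      obtain xs where xs: "path_between T t xs v" using pT[OF t \<open>v \<in> F\<close>] by blast
      hence "e \<notin> set xs" "xs \<noteq> []" using e T(2) by (auto simp: path_between_def path_in_def)
      with xs have "path_between T' e (e # xs) v"
        using sub[of xs] by (auto simp: path_between_def path_in_successively successively_Cons T'_def)
      thus ?thesis by blast
    qed
    have to_e: "\<exists>xs. path_between T' u xs e" if "u \<in> F" for u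
    proof -
      obtain xs where xs: "path_between T u xs t" using pT[OF \<open>u \<in> F\<close> t] by blast
      hence "e \<notin> set xs" "xs \<noteq> []" using e T(2) by (auto simp: path_between_def path_in_def)
      with xs have "path_between T' u (xs @ [e]) e"
        using sub[of xs] by (auto simp: path_between_def path_in_successively successively_append_iff T'_def)
      thus ?thesis by blast
    qed
    have "path_between T' e [e] e" by (simp add: path_between_def path_in_def T'_def)
    moreover have "\<exists>xs. path_between T' u xs v" if "u \<in> F" "v \<in> F"
      using pT[OF that] sub unfolding path_between_def by blast
    ultimately show "\<exists>xs. path_between T' u xs v"
      using uv from_e to_e by metis
  next
    show "\<not> has_cycle T'"
    proof
      assume "has_cycle T'"
      then obtain xs where xs: "path_in T' xs" "3 \<le> length xs" "{last xs, hd xs} \<in> edges T'"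
        unfolding has_cycle_def by blast
      show False
      proof (cases "e \<in> set xs")
        case False
        from xs(2) have "xs \<noteq> []" by auto
        hence "{last xs, hd xs} \<noteq> {e, t}"
          using False hd_in_set[of xs] last_in_set[of xs] by (auto simp: doubleton_eq_iff)
        with xs old[OF xs(1) False] cT show False unfolding has_cycle_def T'_def by auto
      next
        case True
        from split[OF xs(1) this] show False
        proof (elim disjE exE conjE)
          fix zs assume zs: "xs = e # zs" "zs \<noteq> [] \<longrightarrow> hd zs = t \<and> path_in T zs"
          with xs have "zs \<noteq> []" by auto
          with zs xs have "last zs = t" "hd zs = t" using nbr by auto
          \<comment> \<open>At least two vertices follow \<open>e\<close>, and both the first and
            the last of them are \<open>t\<close>, against distinctness.\<close>
          with xs(1,2) zs(1) \<open>zs \<noteq> []\<close> show False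
            by (cases zs) (auto simp: path_in_def split: if_splits)
        next
          fix ys assume ys: "xs = ys @ [e]" "ys \<noteq> [] \<longrightarrow> last ys = t \<and> path_in T ys"
          with xs have "ys \<noteq> []" by auto
          with ys xs have "last ys = t" "hd ys = t" using nbr by auto
          with xs(1,2) ys(1) \<open>ys \<noteq> []\<close> show False
            by (cases ys) (auto simp: path_in_def split: if_splits)
        qed
      qed
    qed
  qed
  moreover have conn_T': "e1 \<inter> e2 \<subseteq> e'"
    if p: "path_between T' e1 xs e2" and e': "e' \<in> set xs" for e1 e2 e' xs
  proof (cases "e \<in> set xs")
    case False
    have q: "path_in T xs" using old p False by (simp add: path_between_def)
    hence "xs \<noteq> []" "set xs \<subseteq> F" using T(2) by (auto simp: path_in_def)
    with p q e' show ?thesis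
      by (intro conn[of e1 e2 e' xs]) (auto simp: path_between_def)
  next
    case True
    have q: "path_in T' xs" "hd xs = e1" "last xs = e2" using p by (auto simp: path_between_def)
    from split[OF q(1) True] show ?thesis
    proof (elim disjE exE conjE)
      fix zs assume zs: "xs = e # zs" "zs \<noteq> [] \<longrightarrow> hd zs = t \<and> path_in T zs"
      show ?thesis
      proof (cases "zs = []")
        case True with zs q e' show ?thesis by auto
      next
        case False
        with zs have z: "hd zs = t" "path_in T zs" by auto
        hence sz: "set zs \<subseteq> F" using T(2) by (auto simp: path_in_def)
        have e12: "e1 = e" "e2 = last zs" "e2 \<in> F" using q zs(1) False sz by auto
        show ?thesis
        proof (cases "e' = e")
          case False
          with e' zs(1) have "e' \<in> set zs" by auto
          hence "t \<inter> e2 \<subseteq> e'"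
            using z e12 sz t by (intro conn[of t e2 e' zs]) (auto simp: path_between_def)
          with ear[OF e12(3)] e12(1) show ?thesis by blast
        qed (use e12 in auto)
      qed
    next
      fix ys assume ys: "xs = ys @ [e]" "ys \<noteq> [] \<longrightarrow> last ys = t \<and> path_in T ys"
      show ?thesis
      proof (cases "ys = []")
        case True with ys q e' show ?thesis by auto
      next
        case False
        with ys have z: "last ys = t" "path_in T ys" by auto
        hence sz: "set ys \<subseteq> F" using T(2) by (auto simp: path_in_def)
        have e12: "e2 = e" "e1 = hd ys" "e1 \<in> F" using q ys(1) False sz by auto
        show ?thesis
        proof (cases "e' = e")
          case False
          with e' ys(1) have "e' \<in> set ys" by auto
          hence "e1 \<inter> t \<subseteq> e'"
            using z e12 sz t by (intro conn[of e1 t e' ys]) (auto simp: path_between_def)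
          with ear[OF e12(3)] e12(1) show ?thesis by blast
        qed (use e12 in auto)
      qed
    qed
  qed
  ultimately show ?thesis
    unfolding alpha_acyclic_hypergraph_def
  proof (intro exI[of _ T'] conjI ballI allI impI)
    show "verts T' = insert e F" by (simp add: T'_def)
  qed (use conn_T' in blast)+
qed

lemma alpha_acyclic_hypergraph_empty: "alpha_acyclic_hypergraph {}"
  unfolding alpha_acyclic_hypergraph_def
  by (intro exI[of _ "\<lparr>verts = {}, edges = {}\<rparr>"])
    (auto simp: tree_def simple_graph_def has_cycle_def)

lemma alpha_acyclic_hypergraph_single: "alpha_acyclic_hypergraph {e}"
proof -
  let ?T = "\<lparr>verts = {e}, edges = {}\<rparr>"
  have "path_between ?T e [e] e" by (simp add: path_between_def path_in_def)
  hence "tree ?T" by (auto simp: tree_def simple_graph_def has_cycle_def)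
  thus ?thesis unfolding alpha_acyclic_hypergraph_def by (intro exI[of _ ?T]) auto
qed

section \<open>Induced cycles from winding walks\<close>

text \<open>Only the length and the total weight are recorded, since a shortest winding walk is
  selected by these two numbers; \<open>walk_list\<close> recovers its vertices.\<close>

inductive walk :: "('a \<Rightarrow> 'a \<Rightarrow> bool) \<Rightarrow> ('a \<Rightarrow> 'a \<Rightarrow> int) \<Rightarrow> nat \<Rightarrow> int \<Rightarrow> 'a \<Rightarrow> 'a \<Rightarrow> bool"
  for A w where
  nil: "walk A w 0 0 u u"
| step: "walk A w n k u v \<Longrightarrow> A v z \<Longrightarrow> walk A w (Suc n) (k + w v z) u z"

lemma walk_trans:
  assumes "walk A w n k u v" "walk A w m l v z"
  shows "walk A w (n + m) (k + l) u z"
  using assms(2,1)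
proof induction
  case (step m l v x y)
  thus ?case using walk.step[of A w "n + m" "k + l" u x y] by (simp add: add_ac)
qed simp

lemma walk_single: "A u v \<Longrightarrow> walk A w 1 (w u v) u v"
  using walk.step[OF walk.nil, of A u v w] by simp

lemma walk_sym:
  assumes "walk A w n k u v" "\<And>u v. A u v \<Longrightarrow> A v u" "\<And>u v. w v u = - w u v"
  shows "walk A w n (- k) v u"
  using assms(1)
proof induction
  case (step n k u v z)
  have "walk A w (1 + n) (w z v + - k) z u"
    by (rule walk_trans[OF walk_single step.IH]) (use step.hyps assms(2) in blast)
  moreover have "w z v + - k = - (k + w v z)" using assms(3)[of z v] by simp
  ultimately have "walk A w (1 + n) (- (k + w v z)) z u" by (simp only:)
  thus ?case by simp
qed (simp add: walk.nil)

lemma walk_segment: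
  assumes "a \<le> b" "\<And>i. a \<le> i \<Longrightarrow> i < b \<Longrightarrow> A (g i) (g (Suc i))"
  shows "walk A w (b - a) (\<Sum>i = a..<b. w (g i) (g (Suc i))) (g a) (g b)"
  using assms
proof (induction b)
  case (Suc b)
  show ?case
  proof (cases "a = Suc b")
    case False
    with Suc.prems have "a \<le> b" by simp
    with walk.step[OF Suc.IH, of "g (Suc b)"] Suc.prems show ?thesis by (simp add: Suc_diff_le)
  qed (simp add: walk.nil)
qed (simp add: walk.nil)

lemma walk_list:
  assumes "walk A w n k u v"
  shows "\<exists>g. g 0 = u \<and> g n = v \<and> (\<forall>i<n. A (g i) (g (Suc i))) \<and>
    k = (\<Sum>i = 0..<n. w (g i) (g (Suc i)))"
  using assms
proof induction
  case (nil u)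
  show ?case by (rule exI[of _ "\<lambda>_. u"]) simp
next
  case (step n k u v z)
  then obtain g where g: "g 0 = u" "g n = v" "\<forall>i<n. A (g i) (g (Suc i))"
    "k = (\<Sum>i = 0..<n. w (g i) (g (Suc i)))" by blast
  let ?g = "g(Suc n := z)"
  have "(\<Sum>i = 0..<n. w (?g i) (?g (Suc i))) = k"
    unfolding g(4) by (intro sum.cong) auto
  with g step.hyps(2) show ?case
    by (intro exI[of _ ?g]) (auto simp: less_Suc_eq)
qed

text \<open>A closed walk of nonzero winding number around a hexagon, where \<open>p\<close> gives the position on
  the hexagon and \<open>w\<close> counts the crossings of the side between 5 and 0. A chord of a shortest
  such walk would split it into two shorter closed walks, one of which still winds around.\<close>

lemma induced_cycle_of_winding_walk:
  fixes p :: "'a \<Rightarrow> int"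
  assumes sym: "\<And>u v. A u v \<Longrightarrow> A v u" and irr: "\<And>u. \<not> A u u"
    and anti: "\<And>u v. w v u = - w u v"
    and pos: "\<And>u v. A u v \<Longrightarrow> \<bar>p v - p u + 6 * w u v\<bar> \<le> 1"
    and walk: "walk A w n0 k0 u0 u0" "k0 \<noteq> 0"
  shows "\<exists>k f. 6 \<le> k \<and> inj_on f {..<k} \<and>
    (\<forall>i<k. \<forall>j<k. A (f i) (f j) \<longleftrightarrow> j = Suc i mod k \<or> i = Suc j mod k)"
proof -
  define n where "n = (LEAST n. \<exists>k u. k \<noteq> 0 \<and> walk A w n k u u)"
  have "\<exists>k u. k \<noteq> 0 \<and> walk A w n k u u"
    unfolding n_def by (rule LeastI[of _ n0]) (use walk in blast)
  then obtain k u where ku: "k \<noteq> 0" "walk A w n k u u" by blast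
  have min: "k' = 0" if "walk A w n' k' u' u'" "n' < n" for n' k' u'
    using not_less_Least[of n' "\<lambda>n. \<exists>k u. k \<noteq> 0 \<and> walk A w n k u u"] that unfolding n_def by blast
  \<comment> \<open>\<open>p v + 6 * k\<close> is the position on the line that unrolls the hexagon.
    It moves by at most 1 per step, while a closed walk with \<open>k \<noteq> 0\<close> has to move
    by at least 6.\<close>
  have len: "\<bar>p v - p u + 6 * k\<bar> \<le> int n" if "walk A w n k u v" for n k u v
    using that
  proof induction
    case (step n k u v z)
    thus ?case using pos[of v z] by (simp add: algebra_simps abs_if split: if_splits)
  qed simp
  have n6: "6 \<le> n" using len[OF ku(2)] ku(1) by auto
  from walk_list[OF ku(2)] obtain g where g: "g 0 = u" "g n = u"
    "\<And>i. i < n \<Longrightarrow> A (g i) (g (Suc i))" "k = (\<Sum>i = 0..<n. w (g i) (g (Suc i)))" by blast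
  define S where "S a b = (\<Sum>i = a..<b. w (g i) (g (Suc i)))" for a b
  have seg: "walk A w (b - a) (S a b) (g a) (g b)" if "a \<le> b" "b \<le> n" for a b
    unfolding S_def by (rule walk_segment) (use that g(3) in auto)
  have S: "S 0 i + S i j + S j n = k" if "i \<le> j" "j \<le> n" for i j
    unfolding S_def g(4) using that by (simp add: sum.atLeastLessThan_concat)
  \<comment> \<open>A repeated vertex cuts the walk into two shorter closed walks whose weights add
    up to \<open>k\<close>, but by minimality both weights vanish.\<close>
  have dist: "g i \<noteq> g j" if "i < j" "j < n" for i j
  proof
    assume eq: "g i = g j"
    have "S i j = 0" using min[of "j - i" "S i j" "g i"] seg[of i j] that eq by simp
    moreover have "walk A w (i + (n - j)) (S 0 i + S j n) (g 0) (g n)"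
      by (rule walk_trans[of _ _ _ _ _ "g i"]) (use seg[of 0 i] seg[of j n] eq that in simp_all)
    hence "S 0 i + S j n = 0" by (intro min[of "i + (n - j)" _ u]) (use g that in auto)
    ultimately show False using S[of i j] that ku(1) by simp
  qed
  have chord: "j = Suc i \<or> i = 0 \<and> Suc j = n" if "i < j" "j < n" "A (g i) (g j)" for i j
  proof (rule ccontr)
    assume *: "\<not> (j = Suc i \<or> i = 0 \<and> Suc j = n)"
    have "walk A w ((j - i) + 1) (S i j + w (g j) (g i)) (g i) (g i)"
      by (rule walk_trans[OF seg walk_single]) (use that sym in auto)
    moreover have "(j - i) + 1 < n" using * that by auto
    ultimately have "S i j + w (g j) (g i) = 0" by (rule min)
    moreover have "walk A w (i + 1 + (n - j)) (S 0 i + w (g i) (g j) + S j n) (g 0) (g n)"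
      by (rule walk_trans[OF walk_trans[OF _ walk_single]]) (use seg[of 0 i] seg[of j n] that in auto)
    hence "S 0 i + w (g i) (g j) + S j n = 0"
      by (intro min[of "i + 1 + (n - j)" _ u]) (use g that * in auto)
    \<comment> \<open>The two pieces pass the chord in opposite directions, so its weights
      cancel.\<close>
    ultimately show False using S[of i j] that ku(1) anti[of "g i" "g j"] by simp
  qed
  have "inj_on g {..<n}"
    by (rule linorder_inj_onI') (use dist in auto)
  moreover have "A (g i) (g j) \<longleftrightarrow> j = Suc i mod n \<or> i = Suc j mod n" if "i < n" "j < n" for i j
  proof -
    have next_mod: "A (g i) (g (Suc i mod n))" if "i < n" for i
      using g(3)[OF that] g(1,2) that by (cases "Suc i = n") auto
    have *: "j = Suc i mod n \<or> i = Suc j mod n" if "i < j" "j < n" "A (g i) (g j)" for i j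
      using chord[OF that] that by auto
    show ?thesis
      using next_mod[OF that(1)] next_mod[OF that(2)] sym[of "g i" "g j"] sym[of "g j" "g i"]
        *[of i j] *[of j i] that irr[of "g i"]
      by (metis linorder_neqE_nat)
  qed
  ultimately show ?thesis using n6 by blast
qed

section \<open>Reachability in an orientation without long induced cycles\<close>

definition induced_cycle :: "'a graph \<Rightarrow> nat \<Rightarrow> (nat \<Rightarrow> 'a) \<Rightarrow> bool" where
  "induced_cycle H k f \<longleftrightarrow> inj_on f {..<k} \<and>
     (\<forall>i<k. \<forall>j<k. {f i, f j} \<in> edges H \<longleftrightarrow> j = Suc i mod k \<or> i = Suc j mod k)"

text \<open>The flags say that a vertex lies in \<open>R r\<close>, reaches \<open>x\<close>,
  reaches \<open>y\<close>. Around the hexagon: inside \<open>R r\<close> with both targets ahead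
  (0) or only \<open>x\<close> (1), outside with \<open>x\<close> (2), neither (3) or
  \<open>y\<close> (4), and inside again with only \<open>y\<close> (5). Two combinations do not
  occur among the vertices considered, neither target inside and both targets outside; their values
  are arbitrary.\<close>

definition hexagon :: "bool \<Rightarrow> bool \<Rightarrow> bool \<Rightarrow> int" where
  "hexagon a b c =
     (if a then (if b then (if c then 0 else 1) else 5) else if b then 2 else if c then 4 else 3)"

text \<open>Along an arc, membership in \<open>R r\<close> is never lost and a target is never
  gained. So an arc either keeps its position or leads from an even position to one of the two odd
  positions beside it; the correction term makes 5 and 0 neighbours.\<close>

lemma hexagon_step:
  assumes "a \<longrightarrow> a'" "b' \<longrightarrow> b" "c' \<longrightarrow> c" "a \<longrightarrow> b \<or> c" "a' \<longrightarrow> b' \<or> c'"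
    "\<not> a \<longrightarrow> \<not> (b \<and> c)" "\<not> a' \<longrightarrow> \<not> (b' \<and> c')"
  shows "\<bar>hexagon a' b' c' - hexagon a b c +
    6 * (if hexagon a b c = 5 \<and> hexagon a' b' c' = 0 then 1
         else if hexagon a b c = 0 \<and> hexagon a' b' c' = 5 then -1 else 0)\<bar> \<le> 1"
  using assms unfolding hexagon_def
  by (cases a) (simp_all split: if_splits, blast+)

locale orientation =
  fixes H :: "'a graph" and D :: "('a \<times> 'a) set"
  assumes H: "simple_graph H" and D: "acyclic_orientation H D"
    and no_long: "\<And>k f. 6 \<le> k \<Longrightarrow> \<not> induced_cycle H k f"
begin

abbreviation R where "R \<equiv> reach D"

lemma arc_edge: "(u, v) \<in> D \<Longrightarrow> {u, v} \<in> edges H"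
  using D unfolding acyclic_orientation_def by blast

lemma edge_arc: "{u, v} \<in> edges H \<longleftrightarrow> (u, v) \<in> D \<or> (v, u) \<in> D"
  using D unfolding acyclic_orientation_def by (metis arc_edge insert_commute)

lemma no_loop: "(u, u) \<notin> D"
  using D unfolding acyclic_orientation_def acyclic_def by blast

lemma reach_self [simp]: "u \<in> R u"
  by (simp add: reach_def)

lemma reach_step: "v \<in> R u \<Longrightarrow> (v, z) \<in> D \<Longrightarrow> z \<in> R u"
  by (auto simp: reach_def)

lemma reach_trans: "v \<in> R u \<Longrightarrow> z \<in> R v \<Longrightarrow> z \<in> R u"
  by (auto simp: reach_def)

lemma reach_arc: "(u, v) \<in> D \<Longrightarrow> z \<in> R v \<Longrightarrow> z \<in> R u"
  by (auto simp: reach_def)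

text \<open>If the conclusion fails, then the vertices of \<open>K\<close> and the ancestors of \<open>x\<close> or \<open>y\<close> in
  \<open>R r\<close> are placed on a hexagon so that the closed walk from \<open>r\<close> via
  \<open>x\<close>, \<open>t\<close>, \<open>t'\<close> and \<open>y\<close> back to \<open>r\<close> winds around it once.\<close>

lemma common_ancestor:
  fixes K
  defines "A\<^sub>K \<equiv> {(u, v). u \<in> K \<and> v \<in> K \<and> {u, v} \<in> edges H}"
  assumes K: "K \<inter> R r = {}" and closed: "\<And>u v. u \<in> K \<Longrightarrow> (u, v) \<in> D \<Longrightarrow> v \<in> K \<union> R r"
    and x: "x \<in> R r" "y \<in> R r"
    and t: "t \<in> K" "x \<in> R t" and t': "t' \<in> K" "y \<in> R t'" and tt': "(t, t') \<in> A\<^sub>K\<^sup>*"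
  shows "\<exists>v \<in> K. x \<in> R v \<and> y \<in> R v"
proof (rule ccontr)
  assume "\<not> ?thesis"
  hence nob: "\<not> (x \<in> R v \<and> y \<in> R v)" if "v \<in> K" for v using that by blast
  define U where "U = K \<union> {v \<in> R r. x \<in> R v \<or> y \<in> R v}"
  define A where "A u v \<longleftrightarrow> u \<in> U \<and> v \<in> U \<and> {u, v} \<in> edges H" for u v
  define p where "p v = hexagon (v \<in> R r) (x \<in> R v) (y \<in> R v)" for v
  define w :: "'a \<Rightarrow> 'a \<Rightarrow> int" where
    "w u v = (if p u = 5 \<and> p v = 0 then 1 else if p u = 0 \<and> p v = 5 then -1 else 0)" for u v
  have sym: "A v u" if "A u v" for u v using that by (auto simp: A_def insert_commute)
  have anti: "w v u = - w u v" for u v by (auto simp: w_def)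
  have irr: "\<not> A u u" for u using no_loop edge_arc[of u u] by (auto simp: A_def)
  have inU: "v \<in> R r \<Longrightarrow> x \<in> R v \<or> y \<in> R v" "v \<notin> R r \<Longrightarrow> v \<in> K" if "v \<in> U" for v
    using that K by (auto simp: U_def)
  have pos': "\<bar>p v - p u + 6 * w u v\<bar> \<le> 1" if "u \<in> U" "v \<in> U" "(u, v) \<in> D" for u v
  proof -
    have 1: "x \<in> R v \<Longrightarrow> x \<in> R u" "y \<in> R v \<Longrightarrow> y \<in> R u" "u \<in> R r \<Longrightarrow> v \<in> R r"
      using reach_arc[OF that(3)] reach_step[OF _ that(3)] by blast+
    show ?thesis
      unfolding w_def p_def
      by (rule hexagon_step)
        (use 1 inU[OF that(1)] inU[OF that(2)] nob[of u] nob[of v] in blast)+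
  qed
  have pos: "\<bar>p v - p u + 6 * w u v\<bar> \<le> 1" if "A u v" for u v
    using that pos'[of u v] pos'[of v u] anti[of v u]
    by (auto simp: A_def edge_arc abs_if split: if_splits)
  have flat: "\<exists>n. walk A w n 0 u v" if "(u, v) \<in> {(u, v). A u v \<and> w u v = 0}\<^sup>*" for u v
    using that
  proof induction
    case base
    show ?case by (rule exI, rule walk.nil)
  next
    case (step v z)
    thus ?case using walk.step[of A w _ 0 u v z] by auto
  qed
  \<comment> \<open>Ancestors of \<open>x\<close> have the positions 0, 1, 2, so the way down to
    \<open>x\<close> does not cross the side between 5 and 0.\<close>
  have path_x: "\<exists>n. walk A w n 0 s x" if s: "x \<in> R s" "s \<in> K \<or> s = r" for s
  proof -
    have "(s, v) \<in> {(u, v). A u v \<and> w u v = 0}\<^sup>* \<and> v \<in> K \<union> R r"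
      if "(s, v) \<in> D\<^sup>*" "x \<in> R v" for v
      using that
    proof induction
      case base
      thus ?case using s(2) by auto
    next
      case (step v z)
      have xv: "x \<in> R v" using reach_arc[OF step.hyps(2) step.prems] .
      hence *: "(s, v) \<in> {(u, v). A u v \<and> w u v = 0}\<^sup>*" "v \<in> K \<union> R r" using step.IH by auto
      have z: "z \<in> K \<union> R r" using *(2) closed[OF _ step.hyps(2)] reach_step[OF _ step.hyps(2)] by blast
      have "p v \<noteq> 5" "p z \<noteq> 5" using xv step.prems by (auto simp: p_def hexagon_def)
      hence "w v z = 0" by (auto simp: w_def)
      moreover have "A v z"
        using arc_edge[OF step.hyps(2)] xv step.prems *(2) z by (auto simp: A_def U_def)
      ultimately show ?case using * z by (auto intro: rtrancl_into_rtrancl)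
    qed
    moreover have "(s, x) \<in> D\<^sup>*" using s(1) by (simp add: reach_def)
    ultimately show ?thesis using flat reach_self by blast
  qed
  have path_K: "\<exists>n. walk A w n 0 t t'"
  proof -
    have "p u \<noteq> 0" if "u \<in> K" for u
      using K that by (auto simp: p_def hexagon_def)
    hence "A\<^sub>K \<subseteq> {(u, v). A u v \<and> w u v = 0}"
      by (auto simp: A\<^sub>K_def A_def U_def w_def)
    from subsetD[OF rtrancl_mono[OF this] tt'] show ?thesis by (rule flat)
  qed
  \<comment> \<open>As \<open>t'\<close> does not reach \<open>x\<close>, nor does any vertex below
    it. So position 0 does not occur on the way to \<open>y\<close>.\<close>
  have path_y: "\<exists>n. walk A w n 0 t' y"
  proof -
    have nx: "x \<notin> R t'" using nob[OF t'(1)] t'(2) by blast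
    have "(t', v) \<in> {(u, v). A u v \<and> w u v = 0}\<^sup>* \<and> v \<in> K \<union> R r"
      if "(t', v) \<in> D\<^sup>*" "y \<in> R v" for v
      using that
    proof induction
      case base
      thus ?case using t'(1) by auto
    next
      case (step v z)
      have yv: "y \<in> R v" using reach_arc[OF step.hyps(2) step.prems] .
      hence *: "(t', v) \<in> {(u, v). A u v \<and> w u v = 0}\<^sup>*" "v \<in> K \<union> R r" using step.IH by auto
      have z: "z \<in> K \<union> R r" using *(2) closed[OF _ step.hyps(2)] reach_step[OF _ step.hyps(2)] by blast
      have v: "x \<notin> R v" using nx reach_trans[of v t' x] step.hyps(1) by (auto simp: reach_def)
      hence "x \<notin> R z" using reach_arc[OF step.hyps(2)] by blast
      hence "w v z = 0" using v by (auto simp: w_def p_def hexagon_def)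
      moreover have "A v z"
        using arc_edge[OF step.hyps(2)] yv step.prems *(2) z by (auto simp: A_def U_def)
      ultimately show ?case using * z by (auto intro: rtrancl_into_rtrancl)
    qed
    moreover have "(t', y) \<in> D\<^sup>*" using t'(2) by (simp add: reach_def)
    ultimately show ?thesis using flat reach_self by blast
  qed
  \<comment> \<open>Ancestors of \<open>y\<close> inside \<open>R r\<close> have position 0 or 5.
    The way down from \<open>r\<close> passes from 0 to 5 once and never returns.\<close>
  have path_r: "\<exists>n. walk A w n (if p v = 5 then -1 else 0) r v" if "(r, v) \<in> D\<^sup>*" "y \<in> R v" for v
    using that
  proof induction
    case base
    have "p r = 0" using x by (simp add: p_def hexagon_def)
    thus ?case by (intro exI[of _ 0]) (simp add: walk.nil)
  next
    case (step v z)
    have yv: "y \<in> R v" using reach_arc[OF step.hyps(2) step.prems] .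
    then obtain n where n: "walk A w n (if p v = 5 then -1 else 0) r v" using step.IH by blast
    have rv: "v \<in> R r" "z \<in> R r" using step.hyps by (auto simp: reach_def)
    have "A v z" using arc_edge[OF step.hyps(2)] yv step.prems rv by (auto simp: A_def U_def)
    from walk.step[OF n this] have "walk A w (Suc n) ((if p v = 5 then -1 else 0) + w v z) r z" .
    moreover have "(if p v = 5 then -1 else 0) + w v z = (if p z = 5 then -1 else 0)"
      using yv step.prems rv reach_arc[OF step.hyps(2), of x] by (auto simp: w_def p_def hexagon_def)
    ultimately show ?case by auto
  qed
  have "p y = 5"
  proof -
    have "y \<in> R t'" by (rule t')
    have "x \<notin> R y" using nob[OF t'(1)] t'(2) reach_trans by blast
    thus ?thesis using x by (simp add: p_def hexagon_def)
  qed
  then obtain n1 where w1: "walk A w n1 (-1) r y" using path_r[of y] x by (auto simp: reach_def)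
  obtain n2 where w2: "walk A w n2 0 r x" using path_x[of r] x by blast
  obtain n3 where w3: "walk A w n3 0 t x" using path_x[of t] t by blast
  obtain n4 where w4: "walk A w n4 0 t t'" using path_K by blast
  obtain n5 where w5: "walk A w n5 0 t' y" using path_y by blast
  have rev: "walk A w n (- k) v u" if "walk A w n k u v" for n k u v
    by (rule walk_sym[OF that sym anti])
  \<comment> \<open>Only the last part, the reverse of a walk of weight -1 from \<open>r\<close> to
    \<open>y\<close>, contributes to the winding number.\<close>
  obtain n where "walk A w n (0 + - 0 + 0 + 0 + - (-1)) r r"
    using walk_trans[OF walk_trans[OF walk_trans[OF walk_trans[OF w2 rev[OF w3]] w4] w5] rev[OF w1]]
    by blast
  from induced_cycle_of_winding_walk[of A w p, OF sym irr anti pos this]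
  obtain k f where kf: "6 \<le> k" "inj_on f {..<k}"
    "\<And>i j. i < k \<Longrightarrow> j < k \<Longrightarrow> A (f i) (f j) \<longleftrightarrow> j = Suc i mod k \<or> i = Suc j mod k"
    by auto
  \<comment> \<open>\<open>A\<close> is the adjacency of \<open>H\<close> restricted to
    \<open>U\<close>. Each \<open>f i\<close> has a neighbour on the cycle and so lies in
    \<open>U\<close>; hence the cycle is induced in \<open>H\<close> as well.\<close>
  have "f i \<in> U" if "i < k" for i
    using kf(3)[of i "Suc i mod k"] that by (auto simp: A_def)
  hence "induced_cycle H k f" using kf by (auto simp: induced_cycle_def A_def)
  with no_long kf(1) show False by blast
qed

end

section \<open>Ears of the hypergraph of reachability sets\<close>

context orientation begin

lemma ex_maximizer:
  fixes f :: "'b \<Rightarrow> nat"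
  assumes "finite C" "C \<noteq> {}"
  shows "\<exists>t \<in> C. \<forall>s \<in> C. f s \<le> f t"
proof -
  have "Max (f ` C) \<in> f ` C" using assms by (intro Max_in) auto
  then obtain t where t: "t \<in> C" "Max (f ` C) = f t" by auto
  moreover have "f s \<le> Max (f ` C)" if "s \<in> C" for s using assms that by (intro Max_ge) auto
  ultimately show ?thesis by auto
qed

lemma finite_reach: "u \<in> verts H \<Longrightarrow> finite (R u)"
proof (rule finite_subset)
  assume u: "u \<in> verts H"
  show "R u \<subseteq> verts H"
  proof
    fix v assume "v \<in> R u"
    hence "(u, v) \<in> D\<^sup>*" by (simp add: reach_def)
    thus "v \<in> verts H"
    proof induction
      case (step v z)
      thus ?case using arc_edge[of v z] H by (auto simp: simple_graph_def)
    qed (rule u)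
  qed
  show "finite (verts H)" using H by (simp add: simple_graph_def)
qed

text \<open>A directed path that ends outside of the closed set \<open>X\<close> cannot have entered
  it earlier.\<close>

lemma reach_connected:
  assumes K: "K \<inter> X = {}" "R s \<subseteq> K \<union> X" and X: "\<And>u v. u \<in> X \<Longrightarrow> (u, v) \<in> D \<Longrightarrow> v \<in> X"
    and v: "v \<in> R s" "v \<notin> X"
  shows "(s, v) \<in> {(u, v). u \<in> K \<and> v \<in> K \<and> {u, v} \<in> edges H}\<^sup>*"
proof -
  have "(s, v) \<in> D\<^sup>*" using v by (simp add: reach_def)
  thus ?thesis using v(2)
  proof induction
    case (step v z)
    have "v \<notin> X" using X[of v z] step.hyps(2) step.prems by blast
    moreover have "v \<in> R s" "z \<in> R s" using step.hyps by (auto simp: reach_def)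
    ultimately have "v \<in> K" "z \<in> K" using K step.prems by auto
    with arc_edge[OF step.hyps(2)] step.IH[OF \<open>v \<notin> X\<close>] show ?case
      by (auto intro: rtrancl_into_rtrancl)
  qed simp
qed

lemma sym_adj_rtrancl:
  assumes "(u, v) \<in> {(u, v). u \<in> K \<and> v \<in> K \<and> {u, v} \<in> edges H}\<^sup>*"
  shows "(v, u) \<in> {(u, v). u \<in> K \<and> v \<in> K \<and> {u, v} \<in> edges H}\<^sup>*"
proof (rule symD[OF sym_rtrancl assms])
  show "sym {(u, v). u \<in> K \<and> v \<in> K \<and> {u, v} \<in> edges H}"
    by (rule symI) (auto simp: insert_commute)
qed

text \<open>\<open>common_ancestor\<close> handles only two vertices of \<open>R r\<close> at a
  time. To get one member of \<open>C\<close> above a whole trace, it is used twice, with root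
  \<open>r\<close> and with a root taken from \<open>C\<close>, under two nested choices of maximal
  intersections.\<close>

lemma greatest_trace:
  assumes C: "C \<subseteq> verts H" "finite C" "C \<noteq> {}"
    and anti: "\<And>s s'. s \<in> C \<Longrightarrow> s' \<in> C \<Longrightarrow> s \<noteq> s' \<Longrightarrow> s \<notin> R s'"
    and r: "\<And>s. s \<in> C \<Longrightarrow> s \<notin> R r"
    and conn: "\<And>s s'. s \<in> C \<Longrightarrow> s' \<in> C \<Longrightarrow>
      (s, s') \<in> {(a, b). a \<in> C \<and> b \<in> C \<and> \<not> R a \<inter> R b \<subseteq> R r}\<^sup>*"
  shows "\<exists>t \<in> C. \<forall>t' \<in> C. R t' \<inter> R r \<subseteq> R t"
proof -
  define X where "X = R r"
  define K where "K = (\<Union>s\<in>C. R s) - X"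
  let ?K = "\<lambda>K. {(u, v). u \<in> K \<and> v \<in> K \<and> {u, v} \<in> edges H}"
  have fin: "finite (R s)" if "s \<in> C" for s using that C finite_reach by blast
  have inK: "s \<in> K" if "s \<in> C" for s
    using that r[OF that] by (auto simp: K_def X_def intro!: bexI[of _ s])
  have closedX: "v \<in> X" if "u \<in> X" "(u, v) \<in> D" for u v
    using that reach_step unfolding X_def by blast
  have toK: "(s, v) \<in> (?K K)\<^sup>*" if "s \<in> C" "v \<in> R s" "v \<notin> X" for s v
    by (rule reach_connected[where X = X]) (use that closedX in \<open>auto simp: K_def\<close>)
  have connK: "(s, s') \<in> (?K K)\<^sup>*" if "s \<in> C" "s' \<in> C" for s s'
    using conn[OF that]
  proof induction
    case (step a b)
    then obtain v where ab: "a \<in> C" "b \<in> C" and v: "v \<in> R a" "v \<in> R b" "v \<notin> X"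
      by (auto simp: X_def)
    have "(a, v) \<in> (?K K)\<^sup>*" "(v, b) \<in> (?K K)\<^sup>*"
      using toK[OF ab(1) v(1,3)] sym_adj_rtrancl[OF toK[OF ab(2) v(2,3)]] by auto
    with step.IH show ?case by (meson rtrancl_trans)
  qed simp
  have pair: "\<exists>s \<in> C. x \<in> R s \<and> y \<in> R s"
    if "x \<in> X" "y \<in> X" "t \<in> C" "x \<in> R t" "t' \<in> C" "y \<in> R t'" for x y t t'
  proof -
    have "\<exists>v \<in> K. x \<in> R v \<and> y \<in> R v"
    proof (rule common_ancestor[of K r x y t t'])
      show "v \<in> K \<union> R r" if "u \<in> K" "(u, v) \<in> D" for u v
        using that reach_step by (auto simp: K_def X_def)
      show "K \<inter> R r = {}" by (auto simp: K_def X_def)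
    qed (use that inK connK in \<open>auto simp: X_def\<close>)
    then obtain v s where "s \<in> C" "v \<in> R s" "x \<in> R v" "y \<in> R v" by (auto simp: K_def)
    thus ?thesis using reach_trans by blast
  qed
  obtain t where t: "t \<in> C" and tmax: "\<And>s. s \<in> C \<Longrightarrow> card (R s \<inter> X) \<le> card (R t \<inter> X)"
    using ex_maximizer[OF C(2,3), of "\<lambda>s. card (R s \<inter> X)"] by blast
  show ?thesis
  proof (rule bexI[OF _ t], rule ccontr)
    assume "\<not> (\<forall>t' \<in> C. R t' \<inter> R r \<subseteq> R t)"
    then obtain t1 y where t1: "t1 \<in> C" "y \<in> R t1" "y \<in> X" "y \<notin> R t" unfolding X_def by blast
    \<comment> \<open>Among the members that reach \<open>y\<close>, \<open>t'\<close> will have the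
      largest overlap with \<open>t\<close>. A member \<open>t2\<close> that reaches
      \<open>y\<close> and also some \<open>x\<close> missed by \<open>t'\<close> must then miss
      some \<open>z\<close> common to \<open>t\<close> and \<open>t'\<close>.\<close>
    define C' where "C' = {s \<in> C. y \<in> R s}"
    have C': "finite C'" "C' \<noteq> {}" using C t1 by (auto simp: C'_def)
    obtain t' where "t' \<in> C'"
      and tmax': "\<And>s. s \<in> C' \<Longrightarrow> card (R t \<inter> R s \<inter> X) \<le> card (R t \<inter> R t' \<inter> X)"
      using ex_maximizer[OF C', of "\<lambda>s. card (R t \<inter> R s \<inter> X)"] by blast
    hence t': "t' \<in> C" "y \<in> R t'" by (auto simp: C'_def)
    have "\<not> R t \<inter> X \<subseteq> R t'"
    proof
      assume "R t \<inter> X \<subseteq> R t'"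
      hence "R t \<inter> X \<subset> R t' \<inter> X" using t1 t' by blast
      hence "card (R t \<inter> X) < card (R t' \<inter> X)" using fin[OF t'(1)] by (intro psubset_card_mono) auto
      with tmax[OF t'(1)] show False by simp
    qed
    then obtain x where x: "x \<in> R t" "x \<in> X" "x \<notin> R t'" by blast
    from pair[OF x(2) t1(3) t x(1) t'] obtain t2 where t2: "t2 \<in> C" "x \<in> R t2" "y \<in> R t2" by blast
    have "\<not> R t \<inter> R t' \<inter> X \<subseteq> R t2"
    proof
      assume "R t \<inter> R t' \<inter> X \<subseteq> R t2"
      hence "R t \<inter> R t' \<inter> X \<subset> R t \<inter> R t2 \<inter> X" using x t2 by blast
      hence "card (R t \<inter> R t' \<inter> X) < card (R t \<inter> R t2 \<inter> X)"
        using fin[OF t] by (intro psubset_card_mono) auto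
      with tmax'[of t2] t2 show False by (simp add: C'_def)
    qed
    then obtain z where z: "z \<in> R t" "z \<in> R t'" "z \<notin> R t2" by blast
    \<comment> \<open>Outside of \<open>R t2\<close>, \<open>t\<close> and \<open>t'\<close> are
      linked through \<open>z\<close>. A joint ancestor of \<open>x\<close> and \<open>y\<close> in
      \<open>L\<close> would lie below \<open>t\<close>, which does not reach \<open>y\<close>, or
      below \<open>t'\<close>, which does not reach \<open>x\<close>.\<close>
    define L where "L = (R t \<union> R t') - R t2"
    have "t \<notin> R t2" "t' \<notin> R t2" using anti[of t t2] anti[of t' t2] t t' t1 t2 x by auto
    hence L: "t \<in> L" "t' \<in> L" by (auto simp: L_def)
    have 1: "(s, z) \<in> (?K L)\<^sup>*" if "s = t \<or> s = t'" for s
      by (rule reach_connected[where X = "R t2"])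
        (use that z reach_step in \<open>auto simp: L_def\<close>)
    have "\<exists>v \<in> L. x \<in> R v \<and> y \<in> R v"
    proof (rule common_ancestor[of L t2 x y t t'])
      show "v \<in> L \<union> R t2" if "u \<in> L" "(u, v) \<in> D" for u v
        using that reach_step by (auto simp: L_def)
      show "L \<inter> R t2 = {}" by (auto simp: L_def)
      show "(t, t') \<in> (?K L)\<^sup>*"
        using 1[of t] sym_adj_rtrancl[OF 1[of t']] by (meson rtrancl_trans)
    qed (use t2 x L t' in auto)
    thus False using x t1 reach_trans[of _ t y] reach_trans[of _ t' x] by (auto simp: L_def)
  qed
qed

text \<open>That an ear can be found away from a prescribed member \<open>r\<close> is what the
  induction lives on: in a smaller family, the member linked to the rest must not be the ear.
  Simplicial vertices of chordal graphs are found in the same way.\<close>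

lemma ear:
  assumes "finite S" "S \<subseteq> verts H" "r \<in> S" "S \<noteq> {r}"
    and "\<And>s s'. s \<in> S \<Longrightarrow> s' \<in> S \<Longrightarrow> s \<noteq> s' \<Longrightarrow> s \<notin> R s'"
  shows "\<exists>s \<in> S - {r}. \<exists>t \<in> S - {s}. \<forall>s' \<in> S - {s}. R s \<inter> R s' \<subseteq> R t"
  using assms
proof (induction "card S" arbitrary: S r rule: less_induct)
  case less
  note anti = less.prems(5)
  define rel where "rel = {(a, b). a \<in> S - {r} \<and> b \<in> S - {r} \<and> \<not> R a \<inter> R b \<subseteq> R r}"
  obtain s0 where s0: "s0 \<in> S" "s0 \<noteq> r" using less.prems(3,4) by blast
  define C where "C = {s. (s0, s) \<in> rel\<^sup>*}"
  have CS: "s \<in> S - {r}" if "s \<in> C" for s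
    using that unfolding C_def mem_Collect_eq by (cases rule: rtranclE) (use s0 in \<open>auto simp: rel_def\<close>)
  have s0C: "s0 \<in> C" by (simp add: C_def)
  have finC: "finite C" using CS less.prems(1) by (meson finite_Diff finite_subset subsetI)
  have symrel: "sym rel" by (auto simp: rel_def sym_def)
  show ?case
  proof (cases "C = S - {r}")
    case False
    then obtain s1 where s1: "s1 \<in> S - {r}" "s1 \<notin> C" using CS by blast
    have "insert r C \<subset> S" using CS s1 less.prems(3) by blast
    hence "card (insert r C) < card S" using less.prems(1) by (rule psubset_card_mono[rotated])
    moreover have "\<exists>s \<in> insert r C - {r}. \<exists>t \<in> insert r C - {s}. \<forall>s' \<in> insert r C - {s}. R s \<inter> R s' \<subseteq> R t"
    proof (rule less.hyps)
      show "insert r C \<noteq> {r}" using s0C s0(2) by blast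
      show "insert r C \<subseteq> verts H" using CS less.prems(2,3) by blast
      show "s \<notin> R s'" if "s \<in> insert r C" "s' \<in> insert r C" "s \<noteq> s'" for s s'
        using anti[of s s'] that CS less.prems(3) by blast
    qed (use finC calculation in auto)
    ultimately obtain s t where s: "s \<in> C" "s \<noteq> r" and t: "t \<in> insert r C" "t \<noteq> s"
      and st: "\<And>s'. s' \<in> insert r C - {s} \<Longrightarrow> R s \<inter> R s' \<subseteq> R t" by blast
    \<comment> \<open>A member outside of the component \<open>C\<close> meets \<open>R s\<close>
      only within \<open>R r\<close>, and \<open>r\<close> belongs to the smaller family.\<close>
    have "R s \<inter> R s' \<subseteq> R t" if s': "s' \<in> S - {s}" for s'
    proof (cases "s' \<in> insert r C")
      case False
      have "R s \<inter> R s' \<subseteq> R r"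
      proof (rule ccontr)
        assume "\<not> R s \<inter> R s' \<subseteq> R r"
        hence "(s, s') \<in> rel" using False s' CS[OF s(1)] by (auto simp: rel_def)
        with s(1) have "s' \<in> C" unfolding C_def by (auto intro: rtrancl_into_rtrancl)
        with False show False by simp
      qed
      with st[of r] s(2) show ?thesis by blast
    qed (use st s' in blast)
    with s t CS less.prems(3) show ?thesis by blast
  next
    case True
    have "(s, s') \<in> {(a, b). a \<in> C \<and> b \<in> C \<and> \<not> R a \<inter> R b \<subseteq> R r}\<^sup>*" if "s \<in> C" "s' \<in> C" for s s'
    proof -
      have "(s0, s) \<in> rel\<^sup>*" "(s0, s') \<in> rel\<^sup>*" using that by (auto simp: C_def)
      hence "(s, s') \<in> rel\<^sup>*"
        using rtrancl_trans[OF symD[OF sym_rtrancl[OF symrel]], of s0 s s'] by simp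
      thus ?thesis using True by (simp add: rel_def)
    qed
    moreover have "C \<subseteq> verts H" "C \<noteq> {}" using CS less.prems(2) s0C by blast+
    moreover have "s \<notin> R s'" if "s \<in> C" "s' \<in> C" "s \<noteq> s'" for s s'
      using anti[of s s'] that CS by blast
    moreover have "s \<notin> R r" if "s \<in> C" for s
      using anti[of s r] CS[OF that] less.prems(3) by blast
    ultimately have "\<exists>t \<in> C. \<forall>t' \<in> C. R t' \<inter> R r \<subseteq> R t"
      using finC by (intro greatest_trace)
    then obtain t where t: "t \<in> C" and tr: "\<And>t'. t' \<in> C \<Longrightarrow> R t' \<inter> R r \<subseteq> R t" by blast
    show ?thesis
    proof (cases "C = {t}")
      case C: True
      have "t \<in> S - {r}" using CS[OF t] .
      moreover have "R t \<inter> R s' \<subseteq> R r" if "s' \<in> S - {t}" for s'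
        using that True C by blast
      ultimately show ?thesis using less.prems(3) by blast
    next
      case False
      \<comment> \<open>Now \<open>t\<close> is the prescribed member. Its trace on
        \<open>R r\<close> contains all the others, so it can stand in for \<open>r\<close>, which
        is left out of the family.\<close>
      have "\<exists>s \<in> C - {t}. \<exists>u \<in> C - {s}. \<forall>s' \<in> C - {s}. R s \<inter> R s' \<subseteq> R u"
      proof (rule less.hyps)
        have "C \<subset> S" using True less.prems(3) by blast
        thus "card C < card S" using less.prems(1) by (rule psubset_card_mono[rotated])
        show "C \<subseteq> verts H" using CS less.prems(2) by blast
        show "s \<notin> R s'" if "s \<in> C" "s' \<in> C" "s \<noteq> s'" for s s'
          using anti[of s s'] that CS by blast
      qed (use finC t False in auto)
      then obtain s u where s: "s \<in> C" "s \<noteq> t" and u: "u \<in> C" "u \<noteq> s"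
        and su: "\<And>s'. s' \<in> C - {s} \<Longrightarrow> R s \<inter> R s' \<subseteq> R u" by blast
      have "R s \<inter> R s' \<subseteq> R u" if s': "s' \<in> S - {s}" for s'
      proof (cases "s' = r")
        case True
        have "R s \<inter> R r \<subseteq> R s \<inter> R t" using tr[OF s(1)] by blast
        also have "\<dots> \<subseteq> R u" using su[of t] t s by blast
        finally show ?thesis using True by simp
      qed (use su True s' in blast)
      with s u CS show ?thesis by blast
    qed
  qed
qed

lemma alpha_acyclic_reach:
  assumes "finite S" "S \<subseteq> verts H"
    and "\<And>s s'. s \<in> S \<Longrightarrow> s' \<in> S \<Longrightarrow> s \<noteq> s' \<Longrightarrow> s \<notin> R s'"
  shows "alpha_acyclic_hypergraph (R ` S)"
  using assms
proof (induction "card S" arbitrary: S rule: less_induct)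
  case less
  show ?case
  proof (cases "\<exists>r. r \<in> S")
    case False
    thus ?thesis using alpha_acyclic_hypergraph_empty by auto
  next
    case True
    then obtain r where r: "r \<in> S" by blast
    show ?thesis
    proof (cases "S = {r}")
      case True
      thus ?thesis using alpha_acyclic_hypergraph_single by simp
    next
      case False
      from ear[OF less.prems(1,2) r False less.prems(3)]
      obtain s t where s: "s \<in> S" and t: "t \<in> S - {s}"
        and st: "\<And>s'. s' \<in> S - {s} \<Longrightarrow> R s \<inter> R s' \<subseteq> R t" by blast
      have "alpha_acyclic_hypergraph (R ` (S - {s}))"
        using less.prems s by (intro less.hyps card_Diff1_less) auto
      hence "alpha_acyclic_hypergraph (insert (R s) (R ` (S - {s})))"
      proof (rule alpha_acyclic_hypergraph_leaf[where t = "R t"])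
        show "R s \<notin> R ` (S - {s})"
        proof
          assume "R s \<in> R ` (S - {s})"
          then obtain s' where "s' \<in> S" "s' \<noteq> s" "R s = R s'" by blast
          with less.prems(3)[OF s] reach_self[of s] show False by metis
        qed
      qed (use st t in auto)
      moreover have "insert (R s) (R ` (S - {s})) = R ` S" using s by blast
      ultimately show ?thesis by simp
    qed
  qed
qed

lemma alpha_acyclic_sources: "alpha_acyclic_dag (verts H) D"
  unfolding alpha_acyclic_dag_def
proof (rule alpha_acyclic_reach)
  show "finite (sources (verts H) D)" using H by (simp add: sources_def simple_graph_def)
  show "s \<notin> R s'" if "s \<in> sources (verts H) D" "s \<noteq> s'" for s s'
  proof
    assume "s \<in> R s'"
    hence "(s', s) \<in> D\<^sup>*" by (simp add: reach_def)
    with that(2) obtain v where "(v, s) \<in> D" by (metis rtranclE)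
    with that(1) show False by (simp add: sources_def)
  qed
qed (auto simp: sources_def)

end

theorem induced_cycle_if_not_alpha_acyclic:
  assumes "simple_graph H" "\<not> alpha_acyclic H"
  shows "\<exists>k f. 6 \<le> k \<and> induced_cycle H k f"
proof (rule ccontr)
  assume no: "\<not> ?thesis"
  obtain E where E: "acyclic_orientation H E" "\<not> alpha_acyclic_dag (verts H) E"
    using assms(2) unfolding alpha_acyclic_def by blast
  interpret orientation H E by unfold_locales (use assms(1) E(1) no in auto)
  show False using alpha_acyclic_sources E(2) by contradiction
qed

section \<open>The gadget graph\<close>

text \<open>How the index of the second end of a gadget edge depends on the index \<open>p\<close>
  of the first: constant, equal, label of the tail of the directed edge \<open>p\<close>, label of
  its head.\<close>

datatype code = Zero | Pos | Lab | Mate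

text \<open>A long induced cycle \<open>f\<close> of \<open>H\<close> is turned into a gadget: the vertices
  \<open>f 0\<close>, \<open>f 2\<close>, \<open>f 4\<close> stand for vertices of the input graph (labelled by \<open>lab\<close> and \<open>lab'\<close>), the
  other vertices of the cycle for its \<open>N\<close> directed edges, and a vertex outside of the cycle is
  simulated by the single vertex \<open>enc u 0\<close>.\<close>

locale gadget =
  fixes H :: "'a graph" and k :: nat and f :: "nat \<Rightarrow> 'a" and num :: "'a \<Rightarrow> nat"
    and N :: nat and lab lab' :: "nat \<Rightarrow> nat"
  assumes H: "simple_graph H" and k: "6 \<le> k" and cycle: "induced_cycle H k f"
    and num: "inj_on num (verts H)" "\<And>u. u \<in> verts H \<Longrightarrow> num u < card (verts H)"
    and lab: "\<And>p. p < N \<Longrightarrow> lab p < N" "\<And>p. p < N \<Longrightarrow> lab' p < N"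
begin

definition "Z = f ` {..<k}"

text \<open>On the cycle, \<open>f 1\<close> is a directed edge from \<open>f 0\<close> to
  \<open>f 2\<close>, \<open>f 3\<close> one from \<open>f 2\<close> to \<open>f 4\<close>, and the
  path from \<open>f 5\<close> to \<open>f (k - 1)\<close> repeats one from \<open>f 4\<close> to
  \<open>f 0\<close>. The first component is the end whose index is \<open>p\<close> itself. Edges
  off the cycle are repeated for all \<open>p\<close> too, so that each edge of \<open>H\<close>
  yields \<open>N\<close> gadget edges.\<close>

definition tr :: "'a set \<Rightarrow> 'a \<times> 'a \<times> code" where
  "tr e =
    (if e = {f 1, f 0} then (f 1, f 0, Lab)
     else if e = {f 1, f 2} then (f 1, f 2, Mate)
     else if e = {f 3, f 2} then (f 3, f 2, Lab)
     else if e = {f 3, f 4} then (f 3, f 4, Mate)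
     else if e = {f 5, f 4} then (f 5, f 4, Lab)
     else if e = {f (k - 1), f 0} then (f (k - 1), f 0, Mate)
     else (let (a, b) = (SOME (a, b). e = {a, b} \<and> (a \<in> Z \<or> b \<notin> Z))
           in (a, b, if a \<in> Z \<and> b \<notin> Z then Zero else Pos)))"

lemma f_eq: "i < k \<Longrightarrow> j < k \<Longrightarrow> f i = f j \<longleftrightarrow> i = j"
  using cycle unfolding induced_cycle_def inj_on_def by auto

lemma f_edge: "i < k \<Longrightarrow> j < k \<Longrightarrow> {f i, f j} \<in> edges H \<longleftrightarrow> j = Suc i mod k \<or> i = Suc j mod k"
  using cycle unfolding induced_cycle_def by auto

lemma edge_verts: "{u, v} \<in> edges H \<Longrightarrow> u \<in> verts H \<and> v \<in> verts H \<and> u \<noteq> v"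
  using H unfolding simple_graph_def by force

lemma edge_obtain:
  assumes "e \<in> edges H"
  obtains u v where "e = {u, v}" "u \<noteq> v" "u \<in> verts H" "v \<in> verts H"
proof -
  have e: "e \<subseteq> verts H" "card e = 2" using assms H unfolding simple_graph_def by auto
  then obtain u v where "e = {u, v}" "u \<noteq> v" by (auto simp: card_2_iff)
  with e show ?thesis by (intro that[of u v]) auto
qed

lemma finite_edges: "finite (edges H)"
proof (rule finite_subset)
  show "edges H \<subseteq> Pow (verts H)" "finite (Pow (verts H))" using H by (auto simp: simple_graph_def)
qed

lemma tr_cases:
  assumes e: "e \<in> edges H" and t: "tr e = (a, b, \<beta>)"
  shows "e = {a, b} \<and>
    (a = f 1 \<and> b = f 0 \<and> \<beta> = Lab \<or> a = f 1 \<and> b = f 2 \<and> \<beta> = Mate \<or>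
     a = f 3 \<and> b = f 2 \<and> \<beta> = Lab \<or> a = f 3 \<and> b = f 4 \<and> \<beta> = Mate \<or>
     a = f 5 \<and> b = f 4 \<and> \<beta> = Lab \<or> a = f (k - 1) \<and> b = f 0 \<and> \<beta> = Mate \<or>
     a \<in> f ` {5..<k} \<and> b \<in> f ` {5..<k} \<and> \<beta> = Pos \<or>
     a \<in> Z \<and> b \<notin> Z \<and> \<beta> = Zero \<or> a \<notin> Z \<and> b \<notin> Z \<and> \<beta> = Pos)"
proof (cases "e \<in> {{f 1, f 0}, {f 1, f 2}, {f 3, f 2}, {f 3, f 4}, {f 5, f 4}, {f (k - 1), f 0}}")
  case True
  thus ?thesis using t unfolding tr_def by (auto split: if_splits)
next
  case False
  obtain u v where uv: "e = {u, v}" by (rule edge_obtain[OF e])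
  define ab where "ab = (SOME (a, b). e = {a, b} \<and> (a \<in> Z \<or> b \<notin> Z))"
  have "\<exists>ab. case ab of (a, b) \<Rightarrow> e = {a, b} \<and> (a \<in> Z \<or> b \<notin> Z)"
    using uv by (cases "u \<in> Z") (auto intro: exI[of _ "(u, v)"] exI[of _ "(v, u)"])
  hence "case ab of (a, b) \<Rightarrow> e = {a, b} \<and> (a \<in> Z \<or> b \<notin> Z)" unfolding ab_def by (rule someI_ex)
  moreover have "tr e = (fst ab, snd ab, if fst ab \<in> Z \<and> snd ab \<notin> Z then Zero else Pos)"
    using False unfolding tr_def ab_def by (auto simp: Let_def split: prod.splits)
  ultimately have ab: "e = {a, b}" "a \<in> Z \<or> b \<notin> Z" "\<beta> = (if a \<in> Z \<and> b \<notin> Z then Zero else Pos)"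
    using t by (auto split: prod.splits)
  have "a \<in> f ` {5..<k} \<and> b \<in> f ` {5..<k}" if Z: "a \<in> Z" "b \<in> Z"
  proof -
    have next_edge: "f i \<in> f ` {5..<k} \<and> f j \<in> f ` {5..<k}"
      if ij: "i < k" "j < k" "j = Suc i mod k" "e = {f i, f j}" for i j
    proof (cases "Suc i = k")
      case True
      hence "i = k - 1" "j = 0" using ij by auto
      with ij(4) False show ?thesis by simp
    next
      case l: False
      hence j: "j = Suc i" using ij by simp
      have "i \<noteq> 0 \<and> i \<noteq> 1 \<and> i \<noteq> 2 \<and> i \<noteq> 3 \<and> i \<noteq> 4"
        using False ij(1,2,4) k unfolding j by (auto simp: doubleton_eq_iff f_eq)
      hence "5 \<le> i" by presburger
      thus ?thesis using ij j by auto
    qed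
    obtain i j where ij: "i < k" "j < k" "a = f i" "b = f j" using Z by (auto simp: Z_def)
    hence "j = Suc i mod k \<or> i = Suc j mod k" using f_edge[of i j] e ab(1) by simp
    thus ?thesis
    proof
      assume "j = Suc i mod k"
      from next_edge[OF ij(1,2) this] ab(1) ij show ?thesis by simp
    next
      assume "i = Suc j mod k"
      from next_edge[OF ij(2,1) this] ab(1) ij show ?thesis by (simp add: insert_commute)
    qed
  qed
  thus ?thesis using ab by auto
qed

lemma tr_edge: "e \<in> edges H \<Longrightarrow> tr e = (a, b, \<beta>) \<Longrightarrow> e = {a, b}"
  using tr_cases by blast

lemma tr_cycle:
  "tr {f 1, f 0} = (f 1, f 0, Lab)" "tr {f 1, f 2} = (f 1, f 2, Mate)"
  "tr {f 3, f 2} = (f 3, f 2, Lab)" "tr {f 3, f 4} = (f 3, f 4, Mate)"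
  "tr {f 5, f 4} = (f 5, f 4, Lab)" "tr {f (k - 1), f 0} = (f (k - 1), f 0, Mate)"
  using k by (simp_all add: tr_def doubleton_eq_iff f_eq)

lemma tr_middle:
  assumes "5 \<le> i" "Suc i < k"
  shows "\<exists>a b. tr {f i, f (Suc i)} = (a, b, Pos)"
proof -
  have e: "{f i, f (Suc i)} \<in> edges H" using f_edge[of i "Suc i"] assms by simp
  obtain a b \<beta> where t: "tr {f i, f (Suc i)} = (a, b, \<beta>)" by (metis prod_cases3)
  have "a \<in> Z" "b \<in> Z" using tr_edge[OF e t] assms by (auto simp: Z_def doubleton_eq_iff)
  hence "\<beta> = Pos" using tr_cases[OF e t] assms k by (auto simp: doubleton_eq_iff f_eq)
  with t show ?thesis by blast
qed

primrec idx :: "code \<Rightarrow> nat \<Rightarrow> nat" where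
  "idx Zero p = 0"
| "idx Pos p = p"
| "idx Lab p = lab p"
| "idx Mate p = lab' p"

lemma idx_less: "p < N \<Longrightarrow> idx \<beta> p < N"
  using lab by (cases \<beta>) auto

text \<open>Classes have \<open>Suc N\<close> slots for \<open>N\<close> indices: the gadget then
  has vertices even if \<open>G\<close> has no edges, as \<open>presents\<close> demands.\<close>

definition enc :: "'a \<Rightarrow> nat \<Rightarrow> nat" where
  "enc u i = num u * Suc N + i"

definition col :: "nat \<Rightarrow> 'a" where
  "col x = the_inv_into (verts H) num (x div Suc N)"

lemma col_enc [simp]: "u \<in> verts H \<Longrightarrow> i \<le> N \<Longrightarrow> col (enc u i) = u"
  by (simp add: col_def enc_def the_inv_into_f_f num del: mult_Suc_right)

lemma enc_mod [simp]: "i \<le> N \<Longrightarrow> enc u i mod Suc N = i"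
  by (simp add: enc_def del: mult_Suc_right)

lemma enc_eq: "u \<in> verts H \<Longrightarrow> v \<in> verts H \<Longrightarrow> i \<le> N \<Longrightarrow> j \<le> N \<Longrightarrow> enc u i = enc v j \<longleftrightarrow> u = v \<and> i = j"
  by (metis col_enc enc_mod)

lemma enc_less: "u \<in> verts H \<Longrightarrow> i \<le> N \<Longrightarrow> enc u i < card (verts H) * Suc N"
proof -
  assume u: "u \<in> verts H" and i: "i \<le> N"
  have "enc u i < Suc (num u) * Suc N" using i by (simp add: enc_def)
  also have "\<dots> \<le> card (verts H) * Suc N" using num(2)[OF u] by (intro mult_right_mono) auto
  finally show ?thesis .
qed

definition gedge :: "'a set \<Rightarrow> nat \<Rightarrow> nat \<times> nat" where
  "gedge e p = (case tr e of (a, b, \<beta>) \<Rightarrow> (enc a p, enc b (idx \<beta> p)))"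

definition pair_set :: "nat \<times> nat \<Rightarrow> nat set" where
  "pair_set = (\<lambda>(u, v). {u, v})"

definition gadget_graph :: "'a set set \<Rightarrow> nat graph" where
  "gadget_graph F = \<lparr>verts = {0..<card (verts H) * Suc N},
     edges = {pair_set (gedge e p) | e p. e \<in> F \<and> p < N}\<rparr>"

lemma gedge_obtain:
  assumes "e \<in> edges H" "p < N"
  obtains a b \<beta> where "tr e = (a, b, \<beta>)" "e = {a, b}" "a \<in> verts H" "b \<in> verts H" "a \<noteq> b"
    "idx \<beta> p < N" "pair_set (gedge e p) = {enc a p, enc b (idx \<beta> p)}"
    "gedge e p = (enc a p, enc b (idx \<beta> p))"
proof -
  obtain a b \<beta> where t: "tr e = (a, b, \<beta>)" by (metis prod_cases3)
  from tr_edge[OF assms(1) t] have e: "e = {a, b}" .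
  with assms(1) edge_verts[of a b] have "a \<in> verts H" "b \<in> verts H" "a \<noteq> b" by auto
  from that[OF t e this idx_less[OF assms(2)]] show ?thesis
    using t by (simp add: gedge_def pair_set_def)
qed

lemma gedge_col:
  assumes "e \<in> edges H" "p < N" "pair_set (gedge e p) = {x, y}"
  shows "{col x, col y} = e"
proof -
  obtain a b \<beta> where t: "e = {a, b}" "a \<in> verts H" "b \<in> verts H" "idx \<beta> p < N"
    "pair_set (gedge e p) = {enc a p, enc b (idx \<beta> p)}" by (rule gedge_obtain[OF assms(1,2)]) blast
  have "col ` pair_set (gedge e p) = e" using t assms(2) by simp
  thus ?thesis by (simp add: assms(3))
qed

lemma gedge_inj:
  assumes "e \<in> edges H" "e' \<in> edges H" "p < N" "p' < N" "pair_set (gedge e p) = pair_set (gedge e' p')"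
  shows "e = e' \<and> p = p'"
proof -
  obtain a b \<beta> where t: "tr e = (a, b, \<beta>)" "e = {a, b}" "a \<in> verts H" "b \<in> verts H" "a \<noteq> b" "idx \<beta> p < N"
    "pair_set (gedge e p) = {enc a p, enc b (idx \<beta> p)}" by (rule gedge_obtain[OF assms(1,3)]) blast
  obtain a' b' \<beta>' where t': "tr e' = (a', b', \<beta>')" "idx \<beta>' p' < N"
    "pair_set (gedge e' p') = {enc a' p', enc b' (idx \<beta>' p')}" by (rule gedge_obtain[OF assms(2,4)]) blast
  have "e = e'"
    using gedge_col[OF assms(1,3) t(7)] gedge_col[OF assms(2,4), of "enc a p" "enc b (idx \<beta> p)"] t(7) assms(5)
    by simp
  with t t' have *: "a' = a" "b' = b" "\<beta>' = \<beta>" by auto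
  have "enc a p \<in> {enc a p', enc b (idx \<beta> p')}" using assms(5) t(7) t'(3) * by auto
  hence "p = p'" using t t' * assms(3,4) by (auto simp: enc_eq)
  with \<open>e = e'\<close> show ?thesis by simp
qed

lemma presents_gadget:
  assumes F: "set Fs \<subseteq> edges H" "distinct Fs" and P: "set ps = {..<N}" "distinct ps"
    and ne: "verts H \<noteq> {}"
  shows "presents (concat (map (\<lambda>p. map (\<lambda>e. gedge e p) Fs) ps)) (card (verts H) * Suc N) (gadget_graph (set Fs))"
    (is "presents ?es _ _")
  unfolding presents_def
proof (intro conjI)
  have "finite (verts H)" using H by (simp add: simple_graph_def)
  hence "card (verts H) \<noteq> 0" using ne by simp
  thus "1 \<le> card (verts H) * Suc N" by (cases "card (verts H)") auto
  show "verts (gadget_graph (set Fs)) = {0..<card (verts H) * Suc N}" by (simp add: gadget_graph_def)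
  show "simple_graph (gadget_graph (set Fs))"
    unfolding simple_graph_def
  proof (intro conjI ballI)
    fix e' assume "e' \<in> edges (gadget_graph (set Fs))"
    then obtain e p where e': "e' = pair_set (gedge e p)" and e: "e \<in> edges H" and p: "p < N"
      using F by (auto simp: gadget_graph_def)
    obtain a b \<beta> where t: "a \<in> verts H" "b \<in> verts H" "a \<noteq> b" "idx \<beta> p < N"
      "e' = {enc a p, enc b (idx \<beta> p)}" unfolding e' by (rule gedge_obtain[OF e p]) blast
    show "e' \<subseteq> verts (gadget_graph (set Fs))"
      using t p enc_less[of a p] enc_less[of b "idx \<beta> p"] by (simp add: gadget_graph_def)
    have "enc a p \<noteq> enc b (idx \<beta> p)" using t p by (simp add: enc_eq)
    thus "card e' = 2" using t by simp
  qed (simp add: gadget_graph_def)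
  have img: "pair_set ` set ?es = edges (gadget_graph (set Fs))"
    using P(1) by (auto simp: gadget_graph_def)
  thus "set (map (\<lambda>(u, v). {u, v}) ?es) = edges (gadget_graph (set Fs))"
    by (simp add: pair_set_def)
  have inj: "inj_on (\<lambda>(e, p). pair_set (gedge e p)) (edges H \<times> {..<N})"
  proof (rule inj_onI)
    fix x y assume "x \<in> edges H \<times> {..<N}" "y \<in> edges H \<times> {..<N}"
      "(\<lambda>(e, p). pair_set (gedge e p)) x = (\<lambda>(e, p). pair_set (gedge e p)) y"
    thus "x = y"
      using gedge_inj[of "fst x" "fst y" "snd x" "snd y"] by (simp add: split_beta prod_eq_iff mem_Times_iff)
  qed
  have "distinct (map (\<lambda>(e, p). pair_set (gedge e p)) (concat (map (\<lambda>p. map (\<lambda>e. (e, p)) Fs) ps)))"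
    unfolding distinct_map
  proof
    have "distinct (concat (map (\<lambda>p. map (\<lambda>e. (e, p)) Fs) ps))"
      using F(2) P(2) by (induction ps) (auto simp: distinct_map inj_on_def)
    thus "distinct (concat (map (\<lambda>p. map (\<lambda>e. (e, p)) Fs) ps))" .
    show "inj_on (\<lambda>(e, p). pair_set (gedge e p)) (set (concat (map (\<lambda>p. map (\<lambda>e. (e, p)) Fs) ps)))"
      by (rule inj_on_subset[OF inj]) (use F P in auto)
  qed
  also have "map (\<lambda>(e, p). pair_set (gedge e p)) (concat (map (\<lambda>p. map (\<lambda>e. (e, p)) Fs) ps)) =
      map pair_set ?es"
    by (simp add: map_concat comp_def)
  finally show "distinct (map (\<lambda>(u, v). {u, v}) ?es)" by (simp add: pair_set_def)
qed

section \<open>Bounded degeneracy of the gadget\<close>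

definition rank :: "'a \<Rightarrow> nat" where
  "rank u = (if u \<in> {f 0, f 2, f 4} then 1 else if u \<in> Z then 0 else 2)"

lemma rank_tr:
  assumes "e \<in> edges H" "tr e = (a, b, \<beta>)"
  shows "rank a \<le> rank b" "rank a = rank b \<Longrightarrow> \<beta> = Pos"
proof -
  have Z: "f i \<in> Z" if "i < k" for i using that by (auto simp: Z_def)
  have r0: "rank (f i) = 0" if "i < k" "i \<noteq> 0" "i \<noteq> 2" "i \<noteq> 4" for i
    using that k Z by (auto simp: rank_def f_eq)
  have r1: "rank (f 0) = 1" "rank (f 2) = 1" "rank (f 4) = 1" by (auto simp: rank_def)
  have r2: "rank u = 2 \<longleftrightarrow> u \<notin> Z" for u using Z k by (auto simp: rank_def)
  have le: "rank u \<le> 2" for u by (simp add: rank_def)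
  have "rank a \<le> rank b \<and> (rank a = rank b \<longrightarrow> \<beta> = Pos)"
    using conjunct2[OF tr_cases[OF assms]]
    by (elim disjE conjE) (use k le[of a] r2[of a] r2[of b] in \<open>auto simp: r0 r1\<close>)
  thus "rank a \<le> rank b" "rank a = rank b \<Longrightarrow> \<beta> = Pos" by auto
qed

text \<open>Vertices of large degree come last: directed edges, then vertex copies, then the rest.
  Each edge of \<open>H\<close> gives a vertex at most two later neighbours, since the index
  \<open>p\<close> of the gadget edge can be read off the earlier end: it is the first end, or both
  ranks agree and the code is \<open>Pos\<close>.\<close>

lemma degeneracy_gadget:
  assumes F: "F \<subseteq> edges H"
  shows "degeneracy (gadget_graph F) \<le> 2 * card (edges H)"
  unfolding degeneracy_def
proof (rule Least_le)
  let ?V = "card (verts H) * Suc N"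
  let ?key = "\<lambda>x. rank (col x)"
  define vs where "vs = sort_key ?key [0..<?V]"
  have vs: "distinct vs" "set vs = {0..<?V}" "sorted (map ?key vs)" by (simp_all add: vs_def)
  have finF: "finite F" using F finite_edges finite_subset by blast
  have "card {j. i < j \<and> j < length vs \<and> {vs ! i, vs ! j} \<in> edges (gadget_graph F)} \<le> 2 * card (edges H)"
    if i: "i < length vs" for i
  proof -
    let ?J = "{j. i < j \<and> j < length vs \<and> {vs ! i, vs ! j} \<in> edges (gadget_graph F)}"
    let ?x = "vs ! i"
    let ?p = "?x mod Suc N"
    let ?nb = "(\<lambda>e. snd (gedge e ?p)) ` F \<union> (\<lambda>e. fst (gedge e ?p)) ` F"
    have "(!) vs ` ?J \<subseteq> ?nb"
    proof
      fix y assume "y \<in> (!) vs ` ?J"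
      then obtain j where j: "i < j" "j < length vs" "{?x, y} \<in> edges (gadget_graph F)" "y = vs ! j" by auto
      have "map ?key vs ! i \<le> map ?key vs ! j"
        using j i by (intro sorted_nth_mono[OF vs(3)]) auto
      hence key: "?key ?x \<le> ?key y" using i j by simp
      obtain e p where ep: "pair_set (gedge e p) = {?x, y}" "e \<in> F" "p < N"
        using j(3) by (auto simp: gadget_graph_def)
      have e: "e \<in> edges H" using ep(2) F by blast
      obtain a b \<beta> where t: "tr e = (a, b, \<beta>)" "a \<in> verts H" "b \<in> verts H" "idx \<beta> p < N"
        "pair_set (gedge e p) = {enc a p, enc b (idx \<beta> p)}" "gedge e p = (enc a p, enc b (idx \<beta> p))"
        by (rule gedge_obtain[OF e ep(3)]) blast
      have "?x = enc a p \<and> y = enc b (idx \<beta> p) \<or> ?x = enc b (idx \<beta> p) \<and> y = enc a p"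
        using ep(1) unfolding t(5) doubleton_eq_iff by metis
      thus "y \<in> ?nb"
      proof
        assume *: "?x = enc a p \<and> y = enc b (idx \<beta> p)"
        hence "?p = p" using ep(3) by simp
        with * t(6) ep(2) show ?thesis by (intro UnI1 image_eqI[of _ _ e]) auto
      next
        assume *: "?x = enc b (idx \<beta> p) \<and> y = enc a p"
        hence "rank b \<le> rank a" using key t ep(3) by simp
        hence "\<beta> = Pos" using rank_tr[OF e t(1)] by simp
        hence "?p = p" using * ep(3) by simp
        with * t(6) ep(2) show ?thesis by (intro UnI2 image_eqI[of _ _ e]) auto
      qed
    qed
    hence "card ((!) vs ` ?J) \<le> card ?nb" using finF by (intro card_mono) auto
    also have "\<dots> \<le> card F + card F"
      using finF by (intro order_trans[OF card_Un_le] add_mono card_image_le)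
    also have "\<dots> \<le> 2 * card (edges H)" using card_mono[OF finite_edges F] by simp
    also have "card ((!) vs ` ?J) = card ?J"
      by (intro card_image inj_on_subset[OF inj_on_nth[OF vs(1), of "{..<length vs}"]]) auto
    finally show ?thesis .
  qed
  with vs show "degenerate (2 * card (edges H)) (gadget_graph F)"
    unfolding degenerate_def by (intro exI[of _ vs]) (auto simp: gadget_graph_def)
qed

end

section \<open>Inclusion-exclusion for colour-respecting homomorphisms\<close>

context gadget begin

definition used :: "('a \<Rightarrow> nat) \<Rightarrow> 'a set set" where
  "used \<phi> = {e \<in> edges H. \<exists>u v. {u, v} \<in> edges H \<and> {col (\<phi> u), col (\<phi> v)} = e}"

text \<open>Colours identify the edge of \<open>H\<close> from which a gadget edge stems, so
  deleting gadget edges amounts to a condition on \<open>used\<close>.\<close>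

lemma homs_gadget_iff:
  assumes F: "F \<subseteq> edges H"
  shows "\<phi> \<in> homs H (gadget_graph F) \<longleftrightarrow> \<phi> \<in> homs H (gadget_graph (edges H)) \<and> used \<phi> \<subseteq> F"
proof -
  have "{\<phi> u, \<phi> v} \<in> edges (gadget_graph F) \<longleftrightarrow>
      {\<phi> u, \<phi> v} \<in> edges (gadget_graph (edges H)) \<and> {col (\<phi> u), col (\<phi> v)} \<in> F" for u v
  proof
    assume "{\<phi> u, \<phi> v} \<in> edges (gadget_graph F)"
    then obtain e p where e: "e \<in> F" "p < N" "pair_set (gedge e p) = {\<phi> u, \<phi> v}"
      by (auto simp: gadget_graph_def)
    hence "{col (\<phi> u), col (\<phi> v)} = e" using F by (intro gedge_col[of e p]) auto
    with e F show "{\<phi> u, \<phi> v} \<in> edges (gadget_graph (edges H)) \<and> {col (\<phi> u), col (\<phi> v)} \<in> F"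
      by (auto simp: gadget_graph_def intro!: exI[of _ e] exI[of _ p])
  next
    assume *: "{\<phi> u, \<phi> v} \<in> edges (gadget_graph (edges H)) \<and> {col (\<phi> u), col (\<phi> v)} \<in> F"
    then obtain e p where e: "e \<in> edges H" "p < N" "pair_set (gedge e p) = {\<phi> u, \<phi> v}"
      by (auto simp: gadget_graph_def)
    hence "{col (\<phi> u), col (\<phi> v)} = e" by (intro gedge_col[of e p]) auto
    with e * show "{\<phi> u, \<phi> v} \<in> edges (gadget_graph F)"
      by (auto simp: gadget_graph_def intro!: exI[of _ e] exI[of _ p])
  qed
  note 1 = this
  have 2: "used \<phi> \<subseteq> F \<longleftrightarrow> (\<forall>u v. {u, v} \<in> edges H \<longrightarrow> {col (\<phi> u), col (\<phi> v)} \<in> F)"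
    if hom: "\<forall>u v. {u, v} \<in> edges H \<longrightarrow> {\<phi> u, \<phi> v} \<in> edges (gadget_graph (edges H))"
  proof -
    have "{col (\<phi> u), col (\<phi> v)} \<in> edges H" if "{u, v} \<in> edges H" for u v
    proof -
      from hom[rule_format, OF that]
      obtain e p where e: "e \<in> edges H" "p < N" "pair_set (gedge e p) = {\<phi> u, \<phi> v}"
        unfolding gadget_graph_def by auto
      hence "{col (\<phi> u), col (\<phi> v)} = e" by (intro gedge_col[of e p]) auto
      with e show ?thesis by simp
    qed
    thus ?thesis unfolding used_def by blast
  qed
  have "verts (gadget_graph F) = verts (gadget_graph (edges H))" by (simp add: gadget_graph_def)
  with 1 2 show ?thesis unfolding homs_def by auto
qed

lemma finite_homs: "finite (homs H (gadget_graph F))"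
proof (rule finite_subset)
  show "homs H (gadget_graph F) \<subseteq> verts H \<rightarrow>\<^sub>E verts (gadget_graph F)" by (auto simp: homs_def)
  show "finite (verts H \<rightarrow>\<^sub>E verts (gadget_graph F))"
    using H by (intro finite_PiE) (auto simp: simple_graph_def gadget_graph_def)
qed

text \<open>Moebius inversion over sets of edges gives the number of homomorphisms with
  \<open>used \<phi> = edges H\<close>, up to sign, as the difference of the two sums. Comparing the
  sums tests whether it vanishes without leaving the natural numbers.\<close>

lemma inclusion_exclusion_homs:
  "(\<Sum>F | F \<subseteq> edges H \<and> even (card F). hom_count H (gadget_graph F)) =
   (\<Sum>F | F \<subseteq> edges H \<and> odd (card F). hom_count H (gadget_graph F)) \<longleftrightarrow>
   \<not> (\<exists>\<phi> \<in> homs H (gadget_graph (edges H)). used \<phi> = edges H)"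
proof -
  let ?E = "edges H" and ?Hom = "homs H (gadget_graph (edges H))"
  define g where "g S = int (card {\<phi> \<in> ?Hom. used \<phi> \<subseteq> S})" for S
  define c where "c S = int (card {\<phi> \<in> ?Hom. used \<phi> = S})" for S
  have "g S = sum c (Pow S)" if "finite S" for S
  proof -
    have "{\<phi> \<in> ?Hom. used \<phi> \<subseteq> S} = (\<Union>T\<in>Pow S. {\<phi> \<in> ?Hom. used \<phi> = T})" by auto
    hence "g S = int (\<Sum>T\<in>Pow S. card {\<phi> \<in> ?Hom. used \<phi> = T})"
      unfolding g_def using that finite_homs by (subst card_UN_disjoint[symmetric]) auto
    thus ?thesis by (simp add: c_def)
  qed
  hence "c ?E = (\<Sum>T\<in>Pow ?E. (-1) ^ (card ?E - card T) * g T)"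
    using finite_edges by (intro inclusion_exclusion_mobius)
  also have "\<dots> = (\<Sum>T\<in>Pow ?E. (-1) ^ card ?E * ((-1) ^ card T * int (hom_count H (gadget_graph T))))"
  proof (rule sum.cong[OF refl])
    fix T assume T: "T \<in> Pow ?E"
    have "(-1 :: int) ^ (card ?E - card T) = (-1) ^ card ?E * (-1) ^ card T"
      using card_mono[OF finite_edges, of T] T
      by (metis PowD add_diff_inverse_nat linorder_not_less minus_one_power_iff power_add even_add)
    moreover have "g T = int (hom_count H (gadget_graph T))"
      unfolding g_def hom_count_def using homs_gadget_iff[of T] T
      by (intro arg_cong[where f = "\<lambda>A. int (card A)"]) auto
    ultimately show "(-1) ^ (card ?E - card T) * g T =
        (-1) ^ card ?E * ((-1) ^ card T * int (hom_count H (gadget_graph T)))" by simp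
  qed
  also have "\<dots> = (-1) ^ card ?E * (\<Sum>T\<in>Pow ?E. (-1) ^ card T * int (hom_count H (gadget_graph T)))"
    by (simp add: sum_distrib_left)
  also have "(\<Sum>T\<in>Pow ?E. (-1) ^ card T * int (hom_count H (gadget_graph T))) =
      (\<Sum>T | T \<subseteq> ?E \<and> even (card T). (-1) ^ card T * int (hom_count H (gadget_graph T))) +
      (\<Sum>T | T \<subseteq> ?E \<and> odd (card T). (-1) ^ card T * int (hom_count H (gadget_graph T)))"
    using finite_edges by (subst sum.union_disjoint[symmetric]) (auto intro!: sum.cong)
  also have "\<dots> = int (\<Sum>F | F \<subseteq> edges H \<and> even (card F). hom_count H (gadget_graph F)) -
      int (\<Sum>F | F \<subseteq> edges H \<and> odd (card F). hom_count H (gadget_graph F))"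
    by (simp add: sum_negf)
  finally have "(\<Sum>F | F \<subseteq> edges H \<and> even (card F). hom_count H (gadget_graph F)) =
    (\<Sum>F | F \<subseteq> edges H \<and> odd (card F). hom_count H (gadget_graph F)) \<longleftrightarrow> c ?E = 0"
    by (simp add: minus_one_power_iff del: of_nat_sum)
  also have "\<dots> \<longleftrightarrow> \<not> (\<exists>\<phi> \<in> ?Hom. used \<phi> = edges H)"
    unfolding c_def using finite_homs by auto
  finally show ?thesis .
qed

text \<open>A homomorphism that uses all edges induces a permutation of the non-isolated vertices of
  \<open>H\<close>. Composing with its inverse makes the homomorphism respect the colours.\<close>

lemma positions_if_used:
  assumes \<phi>: "\<phi> \<in> homs H (gadget_graph (edges H))" and u: "used \<phi> = edges H"
  shows "\<exists>pos. \<forall>e \<in> edges H. \<forall>a b \<beta>. tr e = (a, b, \<beta>) \<longrightarrow> pos a < N \<and> pos b = idx \<beta> (pos a)"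
proof -
  define \<tau> where "\<tau> u = col (\<phi> u)" for u
  have hom: "{\<phi> u, \<phi> v} \<in> edges (gadget_graph (edges H))" if "{u, v} \<in> edges H" for u v
    using \<phi> that by (auto simp: homs_def)
  have \<tau>_edge: "\<tau> ` e \<in> edges H" if e: "e \<in> edges H" for e
  proof -
    obtain u v where uv: "e = {u, v}" by (rule edge_obtain[OF e])
    then obtain e' p where e': "e' \<in> edges H" "p < N" "pair_set (gedge e' p) = {\<phi> u, \<phi> v}"
      using hom[of u v] e by (auto simp: gadget_graph_def)
    from gedge_col[OF this] e' uv show ?thesis by (simp add: \<tau>_def)
  qed
  have surj: "(`) \<tau> ` edges H = edges H"
  proof
    show "edges H \<subseteq> (`) \<tau> ` edges H"
    proof
      fix e assume "e \<in> edges H"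
      hence "e \<in> used \<phi>" using u by simp
      then obtain x y where "{x, y} \<in> edges H" "{\<tau> x, \<tau> y} = e" unfolding used_def \<tau>_def by blast
      thus "e \<in> (`) \<tau> ` edges H" by (intro image_eqI[of _ _ "{x, y}"]) auto
    qed
  qed (use \<tau>_edge in blast)
  \<comment> \<open>As \<open>\<tau>\<close> maps the edges onto the edges, it maps their union
    \<open>W\<close> onto itself, and a surjection of a finite set onto itself is injective.\<close>
  define W where "W = \<Union> (edges H)"
  have finW: "finite W" using finite_edges H by (auto simp: W_def simple_graph_def intro: finite_subset)
  have "\<tau> ` W = \<Union> ((`) \<tau> ` edges H)" by (auto simp: W_def)
  hence surjW: "\<tau> ` W = W" unfolding surj by (simp add: W_def)
  hence injW: "inj_on \<tau> W" using finW by (simp add: eq_card_imp_inj_on)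
  define \<sigma> where "\<sigma> = the_inv_into W \<tau>"
  have \<sigma>: "\<sigma> (\<tau> x) = x" if "x \<in> W" for x
    unfolding \<sigma>_def by (rule the_inv_into_f_f[OF injW that])
  define pos where "pos u = \<phi> (\<sigma> u) mod Suc N" for u
  have "pos a < N \<and> pos b = idx \<beta> (pos a)"
    if e: "e \<in> edges H" and t: "tr e = (a, b, \<beta>)" for e a b \<beta>
  proof -
    have ab: "e = {a, b}" by (rule tr_edge[OF e t])
    have "e \<in> (`) \<tau> ` edges H" using surj e by simp
    then obtain e1 where e1: "e1 \<in> edges H" "e = \<tau> ` e1" by blast
    obtain x' y' where "e1 = {x', y'}" by (rule edge_obtain[OF e1(1)])
    with e1(2) ab have "\<exists>x y. e1 = {x, y} \<and> a = \<tau> x \<and> b = \<tau> y"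
      by (auto simp: doubleton_eq_iff insert_commute)
    then obtain x y where xy: "e1 = {x, y}" "a = \<tau> x" "b = \<tau> y" by blast
    with e1(1) have W: "x \<in> W" "y \<in> W" by (auto simp: W_def)
    obtain e' p where e': "e' \<in> edges H" "p < N" "pair_set (gedge e' p) = {\<phi> x, \<phi> y}"
      using hom[of x y] e1(1) xy(1) by (auto simp: gadget_graph_def)
    have "e' = e" using gedge_col[OF e'] ab xy by (simp add: \<tau>_def)
    obtain V: "a \<in> verts H" "b \<in> verts H" "a \<noteq> b" using edge_verts[of a b] e ab by auto
    have i: "idx \<beta> p < N" by (rule idx_less[OF e'(2)])
    have "{\<phi> x, \<phi> y} = {enc a p, enc b (idx \<beta> p)}"
      using e'(3) t \<open>e' = e\<close> by (simp add: gedge_def pair_set_def)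
    \<comment> \<open>The colour of \<open>\<phi> x\<close> is \<open>a\<close>, which excludes that
      the two ends are swapped.\<close>
    moreover have "\<phi> x \<noteq> enc b (idx \<beta> p)"
      using xy(2) V i by (auto simp: \<tau>_def)
    ultimately have "\<phi> x = enc a p" "\<phi> y = enc b (idx \<beta> p)" by (auto simp: doubleton_eq_iff)
    hence "pos a = p" "pos b = idx \<beta> p"
      using xy \<sigma>[OF W(1)] \<sigma>[OF W(2)] e'(2) i by (simp_all add: pos_def)
    with e'(2) show ?thesis by simp
  qed
  thus ?thesis by blast
qed

theorem homs_iff_triangle:
  "(\<exists>\<phi> \<in> homs H (gadget_graph (edges H)). used \<phi> = edges H) \<longleftrightarrow>
   (\<exists>p < N. \<exists>q < N. \<exists>r < N. lab' p = lab q \<and> lab' q = lab r \<and> lab' r = lab p)"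
proof
  assume "\<exists>\<phi> \<in> homs H (gadget_graph (edges H)). used \<phi> = edges H"
  then obtain \<phi> where "\<phi> \<in> homs H (gadget_graph (edges H))" "used \<phi> = edges H" by blast
  from positions_if_used[OF this] obtain pos where
    pos: "\<And>e a b \<beta>. e \<in> edges H \<Longrightarrow> tr e = (a, b, \<beta>) \<Longrightarrow> pos a < N \<and> pos b = idx \<beta> (pos a)"
    by (elim exE) fast
  have E: "{f 1, f 0} \<in> edges H" "{f 1, f 2} \<in> edges H" "{f 3, f 2} \<in> edges H" "{f 3, f 4} \<in> edges H"
    "{f 5, f 4} \<in> edges H" "{f (k - 1), f 0} \<in> edges H"
    using k by (simp_all add: f_edge)
  note P = pos[OF E(1) tr_cycle(1)] pos[OF E(2) tr_cycle(2)] pos[OF E(3) tr_cycle(3)]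
    pos[OF E(4) tr_cycle(4)] pos[OF E(5) tr_cycle(5)] pos[OF E(6) tr_cycle(6)]
  \<comment> \<open>The edges from \<open>f 5\<close> to \<open>f (k - 1)\<close> all have code
    \<open>Pos\<close>, so this path carries a single directed edge.\<close>
  have "pos (f (5 + i)) = pos (f 5)" if "5 + i < k" for i
    using that
  proof (induction i)
    case (Suc i)
    have e: "{f (5 + i), f (Suc (5 + i))} \<in> edges H" using Suc.prems by (simp add: f_edge)
    obtain a b where t: "tr {f (5 + i), f (Suc (5 + i))} = (a, b, Pos)"
      using tr_middle[of "5 + i"] Suc.prems by auto
    have "pos a = pos b" using pos[OF e t] by simp
    hence "pos (f (Suc (5 + i))) = pos (f (5 + i))"
      using tr_edge[OF e t] by (auto simp: doubleton_eq_iff)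
    thus ?case using Suc by simp
  qed simp
  from this[of "k - 6"] have "pos (f (k - 1)) = pos (f 5)" using k by simp
  with P have "pos (f 1) < N" "pos (f 3) < N" "pos (f 5) < N" "lab' (pos (f 1)) = lab (pos (f 3))"
    "lab' (pos (f 3)) = lab (pos (f 5))" "lab' (pos (f 5)) = lab (pos (f 1))" by simp_all
  thus "\<exists>p < N. \<exists>q < N. \<exists>r < N. lab' p = lab q \<and> lab' q = lab r \<and> lab' r = lab p"
    by blast
next
  assume "\<exists>p < N. \<exists>q < N. \<exists>r < N. lab' p = lab q \<and> lab' q = lab r \<and> lab' r = lab p"
  then obtain p q r where pqr: "p < N" "q < N" "r < N" "lab' p = lab q" "lab' q = lab r" "lab' r = lab p"
    by blast
  \<comment> \<open>The labels of the three tails go to \<open>f 0\<close>, \<open>f 2\<close>,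
    \<open>f 4\<close> and the directed edges to the rest of the cycle; off the cycle, index 0 is
    the apex that the code \<open>Zero\<close> refers to.\<close>
  define pos where "pos u =
    (if u = f 0 then lab p else if u = f 1 then p else if u = f 2 then lab q else if u = f 3 then q
     else if u = f 4 then lab r else if u \<in> f ` {5..<k} then r else 0)" for u
  have pos_N: "pos u < N" for u using pqr lab by (auto simp: pos_def)
  have pos_f: "pos (f 0) = lab p" "pos (f 1) = p" "pos (f 2) = lab q" "pos (f 3) = q" "pos (f 4) = lab r"
    using k by (simp_all add: pos_def f_eq)
  have pos_mid: "pos u = r" if "u \<in> f ` {5..<k}" for u
    using that k by (auto simp: pos_def f_eq)
  have pos_out: "pos u = 0" if "u \<notin> Z" for u
    using that k by (auto simp: pos_def Z_def)
  have pos: "pos b = idx \<beta> (pos a)" if e: "e \<in> edges H" and t: "tr e = (a, b, \<beta>)" for e a b \<beta>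
  proof -
    have m: "pos (f 5) = r" "pos (f (k - 1)) = r" using k by (auto intro!: pos_mid)
    show ?thesis
      using conjunct2[OF tr_cases[OF e t]]
      by (elim disjE conjE) (simp_all add: pos_f[unfolded One_nat_def] m[unfolded One_nat_def] pqr pos_mid pos_out)
  qed
  define \<phi> where "\<phi> = (\<lambda>u \<in> verts H. enc u (pos u))"
  have edge: "{\<phi> u, \<phi> v} = pair_set (gedge {u, v} (pos (fst (tr {u, v}))))" "col (\<phi> u) = u" "col (\<phi> v) = v"
    if uv: "{u, v} \<in> edges H" for u v
  proof -
    obtain a b \<beta> where t: "tr {u, v} = (a, b, \<beta>)" by (metis prod_cases3)
    have V: "u \<in> verts H" "v \<in> verts H" using edge_verts[OF uv] by auto
    have "{a, b} = {u, v}" using tr_edge[OF uv t] by simp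
    thus "{\<phi> u, \<phi> v} = pair_set (gedge {u, v} (pos (fst (tr {u, v}))))"
      using pos[OF uv t] V t by (auto simp: gedge_def pair_set_def \<phi>_def doubleton_eq_iff)
    show "col (\<phi> u) = u" "col (\<phi> v) = v" using V pos_N[of u] pos_N[of v] by (simp_all add: \<phi>_def)
  qed
  have "\<phi> \<in> homs H (gadget_graph (edges H))"
    unfolding homs_def
  proof (intro CollectI conjI allI impI)
    show "\<phi> \<in> verts H \<rightarrow>\<^sub>E verts (gadget_graph (edges H))"
      using enc_less pos_N by (auto simp: \<phi>_def gadget_graph_def less_imp_le simp del: mult_Suc_right)
    show "{\<phi> u, \<phi> v} \<in> edges (gadget_graph (edges H))" if "{u, v} \<in> edges H" for u v
      unfolding edge(1)[OF that] using that pos_N by (auto simp: gadget_graph_def)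
  qed
  moreover have "used \<phi> = edges H"
  proof
    show "edges H \<subseteq> used \<phi>"
    proof
      fix e assume e: "e \<in> edges H"
      obtain u v where uv: "e = {u, v}" by (rule edge_obtain[OF e])
      hence "{u, v} \<in> edges H" "{col (\<phi> u), col (\<phi> v)} = e" using edge[of u v] e by auto
      with e show "e \<in> used \<phi>" unfolding used_def by blast
    qed
  qed (auto simp: used_def)
  ultimately show "\<exists>\<phi> \<in> homs H (gadget_graph (edges H)). used \<phi> = edges H" by blast
qed

end

section \<open>Runs of randomized programs\<close>

lemma run_add: "run w P (a + b) s = bind_pmf (run w P a s) (run w P b)"
proof (induction a arbitrary: s)
  case (Suc a)
  hence "run w P (a + b) = (\<lambda>s. bind_pmf (run w P a s) (run w P b))" by blast
  thus ?case by (simp add: bind_assoc_pmf)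
qed (simp add: bind_return_pmf)

lemma run_1: "run w P (Suc 0) s = step w P s"
proof -
  have "run w P 0 = return_pmf" by (rule ext) simp
  thus ?thesis by (simp add: bind_return_pmf')
qed

lemma run_fixed: "step w P s = return_pmf s \<Longrightarrow> run w P t s = return_pmf s"
  by (induction t) (simp_all add: bind_return_pmf)

lemma step_halted: "halted P s \<Longrightarrow> step w P s = return_pmf s"
  by (simp add: step_def)

text \<open>Truncated expected times, whose supremum is \<open>expected_time\<close>. They allow
  inductions over the number of steps, also when the expected time is infinite.\<close>

definition time_upto :: "nat \<Rightarrow> program \<Rightarrow> nat \<Rightarrow> state \<Rightarrow> ennreal" where
  "time_upto w P N s = (\<Sum>t<N. emeasure (measure_pmf (run w P t s)) {s'. \<not> halted P s'})"

lemma time_upto_mono: "N \<le> N' \<Longrightarrow> time_upto w P N s \<le> time_upto w P N' s"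
  unfolding time_upto_def by (intro sum_mono2) auto

lemma expected_time_SUP: "expected_time w P s = (SUP N. time_upto w P N s)"
  unfolding expected_time_def time_upto_def by (rule suminf_eq_SUP)

lemma time_upto_le: "time_upto w P N s \<le> expected_time w P s"
  unfolding expected_time_SUP by (rule SUP_upper) simp

lemma time_upto_split:
  "time_upto w P (a + N) s \<le> of_nat a + (\<integral>\<^sup>+ s'. time_upto w P N s' \<partial>measure_pmf (run w P a s))"
proof -
  have "time_upto w P (a + N) s =
      time_upto w P a s + (\<Sum>t<N. emeasure (measure_pmf (run w P (a + t) s)) {s'. \<not> halted P s'})"
    unfolding time_upto_def by (induction N) (simp_all add: add_ac)
  also have "(\<Sum>t<N. emeasure (measure_pmf (run w P (a + t) s)) {s'. \<not> halted P s'})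
      = (\<integral>\<^sup>+ s'. time_upto w P N s' \<partial>measure_pmf (run w P a s))"
    unfolding time_upto_def run_add emeasure_bind_pmf by (subst nn_integral_sum) auto
  also have "time_upto w P a s \<le> (\<Sum>t<a. 1)"
    unfolding time_upto_def by (intro sum_mono) (simp add: measure_pmf.emeasure_le_1)
  finally show ?thesis by simp
qed

lemma time_upto_halted: "halted P s \<Longrightarrow> time_upto w P N s = 0"
  unfolding time_upto_def by (simp add: run_fixed step_halted indicator_def)

lemma time_upto_Suc:
  assumes "\<not> halted P s"
  shows "time_upto w P (Suc N) s = 1 + (\<integral>\<^sup>+ s'. time_upto w P N s' \<partial>measure_pmf (step w P s))"
proof -
  have "time_upto w P (Suc N) s =
      emeasure (measure_pmf (run w P 0 s)) {s'. \<not> halted P s'} +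
      (\<Sum>t<N. emeasure (measure_pmf (run w P (Suc t) s)) {s'. \<not> halted P s'})"
    unfolding time_upto_def by (rule sum.lessThan_Suc_shift)
  also have "(\<Sum>t<N. emeasure (measure_pmf (run w P (Suc t) s)) {s'. \<not> halted P s'})
      = (\<integral>\<^sup>+ s'. time_upto w P N s' \<partial>measure_pmf (step w P s))"
    unfolding time_upto_def run.simps emeasure_bind_pmf by (subst nn_integral_sum) auto
  finally show ?thesis using assms by (simp add: indicator_def)
qed

text \<open>The value is demanded of reachable halted states only. Together with a finite time bound
  this yields \<open>outputs\<close>, and unlike \<open>outputs\<close> it is easily carried
  backwards over single steps.\<close>

definition runs_to :: "nat \<Rightarrow> program \<Rightarrow> state \<Rightarrow> ennreal \<Rightarrow> nat \<Rightarrow> bool" where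
  "runs_to w P s t x \<longleftrightarrow> expected_time w P s \<le> t \<and>
     (\<forall>n. \<forall>s' \<in> set_pmf (run w P n s). halted P s' \<longrightarrow> reg s' 0 = x)"

lemma runs_to_halted: "halted P s \<Longrightarrow> reg s 0 = x \<Longrightarrow> runs_to w P s 0 x"
  unfolding runs_to_def expected_time_SUP
  by (auto simp: time_upto_halted run_fixed step_halted)

lemma runs_to_mono: "runs_to w P s t x \<Longrightarrow> t \<le> t' \<Longrightarrow> runs_to w P s t' x"
  unfolding runs_to_def by auto

lemma runs_to_step:
  assumes "step w P s = return_pmf s'" "runs_to w P s' t x"
  shows "runs_to w P s (t + 1) x"
proof -
  have "expected_time w P s \<le> t + 1"
    unfolding expected_time_SUP
  proof (rule SUP_least)
    fix N
    have "time_upto w P N s \<le> time_upto w P (1 + N) s" by (rule time_upto_mono) simp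
    also have "\<dots> \<le> of_nat 1 + (\<integral>\<^sup>+ s'. time_upto w P N s' \<partial>measure_pmf (run w P 1 s))"
      by (rule time_upto_split)
    also have "\<dots> = 1 + time_upto w P N s'" by (simp add: run_1 assms(1))
    also have "\<dots> \<le> 1 + t"
      using assms(2) time_upto_le[of w P N s'] unfolding runs_to_def
      by (intro add_left_mono) (auto intro: order_trans)
    finally show "time_upto w P N s \<le> t + 1" by (simp add: add.commute)
  qed
  moreover have "reg s'' 0 = x" if "s'' \<in> set_pmf (run w P n s)" "halted P s''" for n s''
  proof (cases n)
    case 0
    with that assms have "s'' = s'" by (auto simp: step_halted)
    with that(2) assms(2) show ?thesis unfolding runs_to_def by (auto dest: spec[of _ 0])
  next
    case (Suc n')
    with that assms show ?thesis unfolding runs_to_def by (auto simp: bind_return_pmf)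
  qed
  ultimately show ?thesis unfolding runs_to_def by blast
qed

lemma set_pmf_run_halted:
  assumes "s' \<in> set_pmf (run w P n s)" "step w P s' = return_pmf s'"
  shows "s' \<in> set_pmf (run w P (n + k) s)"
  using assms by (auto simp: run_add run_fixed intro!: bexI[of _ s'])

lemma pmf_run_mono:
  assumes "step w P s' = return_pmf s'"
  shows "pmf (run w P n s) s' \<le> pmf (run w P (n + k) s) s'"
proof -
  have "ennreal (pmf (run w P n s) s') = (\<integral>\<^sup>+ u. indicator {s'} u \<partial>measure_pmf (run w P n s))"
    by (simp add: emeasure_pmf_single)
  also have "\<dots> \<le> (\<integral>\<^sup>+ u. ennreal (pmf (run w P k u) s') \<partial>measure_pmf (run w P n s))"
    by (intro nn_integral_mono) (auto simp: indicator_def run_fixed[OF assms])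
  also have "\<dots> = ennreal (pmf (run w P (n + k) s) s')"
    by (simp add: run_add ennreal_pmf_bind)
  finally show ?thesis by simp
qed

text \<open>The probability of a fixed state never decreases, so a wrong one would keep the limit
  below 1. In particular, a program with an output never reaches a state in which it hangs.\<close>

lemma outputs_fixed:
  assumes "outputs w P s x" "s' \<in> set_pmf (run w P n s)" "step w P s' = return_pmf s'"
  shows "halted P s' \<and> reg s' 0 = x"
proof (rule ccontr)
  assume *: "\<not> (halted P s' \<and> reg s' 0 = x)"
  let ?A = "{s'. halted P s' \<and> reg s' 0 = x}"
  let ?d = "pmf (run w P n s) s'"
  have d: "?d > 0" using assms(2) by (simp add: pmf_positive)
  have "\<forall>\<^sub>F t in sequentially. measure_pmf.prob (run w P t s) ?A > 1 - ?d"
    using assms(1) d unfolding outputs_def by (intro order_tendstoD) auto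
  then obtain N where N: "\<And>t. t \<ge> N \<Longrightarrow> measure_pmf.prob (run w P t s) ?A > 1 - ?d"
    by (auto simp: eventually_sequentially)
  let ?t = "n + N"
  have "measure_pmf.prob (run w P ?t s) ?A + measure_pmf.prob (run w P ?t s) {s'} =
      measure_pmf.prob (run w P ?t s) (?A \<union> {s'})"
    using * by (subst measure_pmf.finite_measure_Union) auto
  also have "\<dots> \<le> 1" by simp
  finally have "measure_pmf.prob (run w P ?t s) ?A \<le> 1 - pmf (run w P ?t s) s'"
    by (simp add: measure_pmf_single)
  also have "\<dots> \<le> 1 - ?d" using pmf_run_mono[OF assms(3), of n s N] by simp
  finally show False using N[of ?t] by simp
qed

text \<open>With finite expected time, the probabilities of not having halted are summable and hence
  tend to 0.\<close>

lemma runs_to_outputs: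
  assumes "runs_to w P s t x" "t < \<infinity>"
  shows "outputs w P s x"
proof -
  have "(\<Sum>t. emeasure (measure_pmf (run w P t s)) {s'. \<not> halted P s'}) < \<infinity>"
    using assms unfolding runs_to_def expected_time_def by auto
  hence "(\<Sum>t. ennreal (measure_pmf.prob (run w P t s) {s'. \<not> halted P s'})) < \<infinity>"
    by (simp add: measure_pmf.emeasure_eq_measure)
  hence "summable (\<lambda>t. measure_pmf.prob (run w P t s) {s'. \<not> halted P s'})"
    by (intro summable_suminf_not_top) auto
  hence "(\<lambda>t. measure_pmf.prob (run w P t s) {s'. \<not> halted P s'}) \<longlonglongrightarrow> 0"
    by (rule summable_LIMSEQ_zero)
  hence "(\<lambda>t. 1 - measure_pmf.prob (run w P t s) {s'. \<not> halted P s'}) \<longlonglongrightarrow> 1 - 0"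
    by (intro tendsto_intros)
  moreover have "1 - measure_pmf.prob (run w P t s) {s'. \<not> halted P s'} =
      measure_pmf.prob (run w P t s) {s'. halted P s' \<and> reg s' 0 = x}" for t
  proof -
    have "1 - measure_pmf.prob (run w P t s) {s'. \<not> halted P s'} =
        measure_pmf.prob (run w P t s) (UNIV - {s'. \<not> halted P s'})"
      using measure_pmf.prob_compl[of "{s'. \<not> halted P s'}" "run w P t s"] by simp
    also have "\<dots> = measure_pmf.prob (run w P t s) {s'. halted P s' \<and> reg s' 0 = x}"
      using assms(1) unfolding runs_to_def
      by (intro measure_pmf.finite_measure_eq_AE) (auto simp: AE_measure_pmf_iff)
    finally show ?thesis .
  qed
  ultimately show ?thesis unfolding outputs_def by simp
qed

section \<open>Blocks of code\<close>

type_synonym asrt = "(nat \<Rightarrow> nat) \<Rightarrow> (nat \<Rightarrow> nat) \<Rightarrow> bool"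

definition code_at :: "program \<Rightarrow> nat \<Rightarrow> program \<Rightarrow> bool" where
  "code_at Q b is \<longleftrightarrow> (\<forall>i < length is. b + i < length Q \<and> Q ! (b + i) = is ! i)"

lemma code_at_Nil [simp]: "code_at Q b []"
  by (simp add: code_at_def)

lemma code_at_append:
  "code_at Q b (is @ js) \<longleftrightarrow> code_at Q b is \<and> code_at Q (b + length is) js"
proof
  assume *: "code_at Q b (is @ js)"
  show "code_at Q b is \<and> code_at Q (b + length is) js"
    unfolding code_at_def
  proof (intro conjI allI impI)
    fix i assume "i < length is"
    with * show "b + i < length Q" "Q ! (b + i) = is ! i"
      unfolding code_at_def by (auto simp: nth_append dest: spec[of _ i])
  next
    fix i assume "i < length js"
    with * show "b + length is + i < length Q" "Q ! (b + length is + i) = js ! i"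
      unfolding code_at_def by (auto simp: nth_append add.assoc dest: spec[of _ "length is + i"])
  qed
next
  assume *: "code_at Q b is \<and> code_at Q (b + length is) js"
  show "code_at Q b (is @ js)"
    unfolding code_at_def
  proof (intro allI impI)
    fix i assume i: "i < length (is @ js)"
    show "b + i < length Q \<and> Q ! (b + i) = (is @ js) ! i"
    proof (cases "i < length is")
      case True with * show ?thesis unfolding code_at_def by (simp add: nth_append)
    next
      case False
      with i have "i - length is < length js" by simp
      with * have "b + length is + (i - length is) < length Q \<and>
          Q ! (b + length is + (i - length is)) = js ! (i - length is)"
        unfolding code_at_def by blast
      with False show ?thesis by (simp add: nth_append)
    qed
  qed
qed

lemma code_at_Cons:
  "code_at Q b (i # is) \<longleftrightarrow> b < length Q \<and> Q ! b = i \<and> code_at Q (Suc b) is"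
  using code_at_append[of Q b "[i]" "is"] by (auto simp: code_at_def)

text \<open>A block of code is a function of the address at which it is placed. The triple is in
  continuation style, so that it composes without reference to the final state of a run.\<close>

definition triple :: "nat \<Rightarrow> asrt \<Rightarrow> (nat \<Rightarrow> program) \<Rightarrow> ennreal \<Rightarrow> asrt \<Rightarrow> bool" where
  "triple W Pre B k Post \<longleftrightarrow> (\<forall>Q b R M t x. code_at Q b (B b) \<longrightarrow> Pre R M \<longrightarrow>
     (\<forall>R' M'. Post R' M' \<longrightarrow> runs_to W Q \<lparr>pc = b + length (B b), reg = R', mem = M'\<rparr> t x) \<longrightarrow>
     runs_to W Q \<lparr>pc = b, reg = R, mem = M\<rparr> (t + k) x)"

definition seq :: "(nat \<Rightarrow> program) \<Rightarrow> (nat \<Rightarrow> program) \<Rightarrow> nat \<Rightarrow> program"  (infixr \<open>;;\<close> 60) where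
  "(B1 ;; B2) = (\<lambda>b. B1 b @ B2 (b + length (B1 b)))"

lemma triple_seq:
  assumes "triple W P1 B1 k1 P2" "triple W P2 B2 k2 P3"
  shows "triple W P1 (B1 ;; B2) (k1 + k2) P3"
  unfolding triple_def
proof (intro allI impI)
  fix Q b R M t x
  assume code: "code_at Q b ((B1 ;; B2) b)" and pre: "P1 R M"
    and post: "\<forall>R' M'. P3 R' M' \<longrightarrow>
      runs_to W Q \<lparr>pc = b + length ((B1 ;; B2) b), reg = R', mem = M'\<rparr> t x"
  let ?b = "b + length (B1 b)"
  have c1: "code_at Q b (B1 b)" and c2: "code_at Q ?b (B2 ?b)"
    using code by (auto simp: seq_def code_at_append)
  have "runs_to W Q \<lparr>pc = ?b, reg = R', mem = M'\<rparr> (t + k2) x" if "P2 R' M'" for R' M'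
    using assms(2)[unfolded triple_def, rule_format, OF c2 that] post by (simp add: seq_def add.assoc)
  hence "runs_to W Q \<lparr>pc = b, reg = R, mem = M\<rparr> (t + k2 + k1) x"
    using assms(1)[unfolded triple_def, rule_format, OF c1 pre] by blast
  thus "runs_to W Q \<lparr>pc = b, reg = R, mem = M\<rparr> (t + (k1 + k2)) x" by (simp add: add_ac)
qed

lemma triple_conseq:
  assumes "triple W P B k Q" "\<And>R M. P' R M \<Longrightarrow> P R M" "\<And>R M. Q R M \<Longrightarrow> Q' R M" "k \<le> k'"
  shows "triple W P' B k' Q'"
  unfolding triple_def
proof (intro allI impI)
  fix Qa b R M t x
  assume *: "code_at Qa b (B b)" "P' R M"
    "\<forall>R' M'. Q' R' M' \<longrightarrow> runs_to W Qa \<lparr>pc = b + length (B b), reg = R', mem = M'\<rparr> t x"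
  hence "runs_to W Qa \<lparr>pc = b, reg = R, mem = M\<rparr> (t + k) x"
    using assms(1)[unfolded triple_def, rule_format, OF *(1) assms(2)[OF *(2)]] assms(3) by blast
  thus "runs_to W Qa \<lparr>pc = b, reg = R, mem = M\<rparr> (t + k') x"
    using assms(4) by (auto elim!: runs_to_mono intro: add_left_mono)
qed

text \<open>Fixes the initial registers and memory, so that intermediate assertions may refer to
  them.\<close>

lemma triple_fix:
  assumes "\<And>R0 M0. P R0 M0 \<Longrightarrow> triple W (\<lambda>R M. R = R0 \<and> M = M0) B k Q"
  shows "triple W P B k Q"
  using assms unfolding triple_def by blast

lemma triple_skip: "triple W P (\<lambda>_. []) 0 P"
  by (simp add: triple_def)

text \<open>Straight-line code only: jumps are treated by the rule for loops, random choices by the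
  simulation.\<close>

primrec wp_instr :: "nat \<Rightarrow> instr \<Rightarrow> asrt \<Rightarrow> asrt" where
  "wp_instr W (SetConst r k) Post = (\<lambda>R M. k < 2 ^ W \<and> Post (R(r := k)) M)"
| "wp_instr W (Op b r p q) Post =
     (\<lambda>R M. eval_op b (R p) (R q) < 2 ^ W \<and> Post (R(r := eval_op b (R p) (R q))) M)"
| "wp_instr W (Load r p) Post = (\<lambda>R M. M (R p) < 2 ^ W \<and> Post (R(r := M (R p))) M)"
| "wp_instr W (Store p q) Post = (\<lambda>R M. Post R (M(R p := R q)))"
| "wp_instr W (RandBelow r p) Post = (\<lambda>R M. False)"
| "wp_instr W (JumpIfZero r l) Post = (\<lambda>R M. False)"

primrec wp :: "nat \<Rightarrow> program \<Rightarrow> asrt \<Rightarrow> asrt" where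
  "wp W [] Post = Post"
| "wp W (i # is) Post = wp_instr W i (wp W is Post)"

lemma wp_append: "wp W (is @ js) Post = wp W is (wp W js Post)"
  by (induction "is") simp_all

lemma triple_instr: "triple W (wp_instr W i Post) (\<lambda>_. [i]) 1 Post"
  unfolding triple_def
proof (intro allI impI)
  fix Q b R M t x
  assume code: "code_at Q b [i]" and pre: "wp_instr W i Post R M"
    and post: "\<forall>R' M'. Post R' M' \<longrightarrow> runs_to W Q \<lparr>pc = b + length [i], reg = R', mem = M'\<rparr> t x"
  let ?s = "\<lparr>pc = b, reg = R, mem = M\<rparr>"
  have st: "step W Q ?s = exec W i ?s"
    using code by (simp add: step_def halted_def code_at_Cons)
  show "runs_to W Q ?s (t + 1) x"
    using pre post by (cases i) (auto intro!: runs_to_step simp: st write_reg_def)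
qed

lemma triple_wp: "triple W (wp W is Post) (\<lambda>_. is) (of_nat (length is)) Post"
proof (induction "is")
  case Nil
  show ?case by (simp add: triple_skip)
next
  case (Cons i "is")
  have "triple W (wp_instr W i (wp W is Post)) ((\<lambda>_. [i]) ;; (\<lambda>_. is)) (1 + of_nat (length is)) Post"
    by (rule triple_seq[OF triple_instr Cons.IH])
  thus ?case by (simp add: seq_def)
qed

lemma triple_straight:
  assumes "\<And>R M. Pre R M \<Longrightarrow> wp W is Post R M"
  shows "triple W Pre (\<lambda>_. is) (of_nat (length is)) Post"
  by (rule triple_conseq[OF triple_wp assms]) auto

text \<open>Register \<open>z\<close> is meant to hold 0, which makes the closing jump
  unconditional.\<close>

definition while :: "nat \<Rightarrow> nat \<Rightarrow> (nat \<Rightarrow> program) \<Rightarrow> nat \<Rightarrow> program" where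
  "while z r B = (\<lambda>b. JumpIfZero r (b + length (B (Suc b)) + 2) # B (Suc b) @ [JumpIfZero z b])"

text \<open>The invariant is indexed by the number of rounds left. The two jumps per round account
  for \<open>k + 2\<close>, the last test for the final 1.\<close>

lemma triple_while:
  assumes body: "\<And>i. i < n \<Longrightarrow> triple W (Inv (Suc i)) B k (Inv i)"
    and z: "\<And>i R M. Inv i R M \<Longrightarrow> R z = 0" and r: "\<And>i R M. Inv i R M \<Longrightarrow> R r = 0 \<longleftrightarrow> i = 0"
  shows "triple W (Inv n) (while z r B) (of_nat n * (k + 2) + 1) (Inv 0)"
  using body
proof (induction n)
  case 0
  show ?case unfolding triple_def
  proof (intro allI impI)
    fix Q b R M t x
    assume code: "code_at Q b (while z r B b)" and pre: "Inv 0 R M"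
      and post: "\<forall>R' M'. Inv 0 R' M' \<longrightarrow>
        runs_to W Q \<lparr>pc = b + length (while z r B b), reg = R', mem = M'\<rparr> t x"
    let ?s = "\<lparr>pc = b, reg = R, mem = M\<rparr>"
    have "R r = 0" using r[OF pre] by simp
    hence "step W Q ?s = return_pmf \<lparr>pc = b + length (while z r B b), reg = R, mem = M\<rparr>"
      using code by (simp add: step_def halted_def code_at_Cons while_def)
    hence "runs_to W Q ?s (t + 1) x" by (rule runs_to_step) (use post pre in blast)
    thus "runs_to W Q ?s (t + (of_nat 0 * (k + 2) + 1)) x" by simp
  qed
next
  case (Suc n)
  show ?case unfolding triple_def
  proof (intro allI impI)
    fix Q b R M t x
    assume code: "code_at Q b (while z r B b)" and pre: "Inv (Suc n) R M"
      and post: "\<forall>R' M'. Inv 0 R' M' \<longrightarrow>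
        runs_to W Q \<lparr>pc = b + length (while z r B b), reg = R', mem = M'\<rparr> t x"
    let ?s = "\<lparr>pc = b, reg = R, mem = M\<rparr>"
    let ?t = "t + (of_nat n * (k + 2) + 1)"
    let ?e = "Suc b + length (B (Suc b))"
    have cb: "code_at Q (Suc b) (B (Suc b))"
      and ce: "Q ! ?e = JumpIfZero z b" "?e < length Q"
      and c0: "b < length Q" "Q ! b = JumpIfZero r (b + length (B (Suc b)) + 2)"
      using code by (auto simp: while_def code_at_Cons code_at_append)
    have jmp: "runs_to W Q \<lparr>pc = ?e, reg = R', mem = M'\<rparr> (?t + 1) x" if "Inv n R' M'" for R' M'
    proof (rule runs_to_step)
      show "step W Q \<lparr>pc = ?e, reg = R', mem = M'\<rparr> = return_pmf \<lparr>pc = b, reg = R', mem = M'\<rparr>"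
        using ce z[OF that] by (simp add: step_def halted_def)
      have "triple W (Inv n) (while z r B) (of_nat n * (k + 2) + 1) (Inv 0)"
        using Suc by simp
      thus "runs_to W Q \<lparr>pc = b, reg = R', mem = M'\<rparr> ?t x"
        unfolding triple_def using code that post by blast
    qed
    have "runs_to W Q \<lparr>pc = Suc b, reg = R, mem = M\<rparr> (?t + 1 + k) x"
      using Suc.prems[of n] cb pre jmp unfolding triple_def by blast
    moreover have "step W Q ?s = return_pmf \<lparr>pc = Suc b, reg = R, mem = M\<rparr>"
      using c0 r[OF pre] by (simp add: step_def halted_def)
    ultimately have "runs_to W Q ?s (?t + 1 + k + 1) x" by (rule runs_to_step[rotated])
    moreover have "?t + 1 + k + 1 = t + (of_nat (Suc n) * (k + 2) + 1)"
    proof -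
      have "of_nat (Suc n) * (k + 2) = of_nat n * (k + 2) + (k + (1 + 1))"
        by (simp add: distrib_right)
      thus ?thesis by (simp add: add_ac)
    qed
    ultimately show "runs_to W Q ?s (t + (of_nat (Suc n) * (k + 2) + 1)) x" by simp
  qed
qed

primrec seqs :: "(nat \<Rightarrow> program) list \<Rightarrow> nat \<Rightarrow> program" where
  "seqs [] = (\<lambda>_. [])"
| "seqs (B # Bs) = (B ;; seqs Bs)"

lemma triple_seqs:
  assumes "\<And>j. j < length Bs \<Longrightarrow> triple W (Inv j) (Bs ! j) (k j) (Inv (Suc j))"
  shows "triple W (Inv 0) (seqs Bs) (\<Sum>j<length Bs. k j) (Inv (length Bs))"
  using assms
proof (induction Bs arbitrary: Inv k)
  case Nil
  show ?case by (simp add: triple_skip)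
next
  case (Cons B Bs)
  have "triple W (Inv (Suc 0)) (seqs Bs) (\<Sum>j<length Bs. k (Suc j)) (Inv (Suc (length Bs)))"
    by (rule Cons.IH[of "\<lambda>j. Inv (Suc j)" "\<lambda>j. k (Suc j)"]) (use Cons.prems in fastforce)
  moreover have "triple W (Inv 0) B (k 0) (Inv (Suc 0))" using Cons.prems[of 0] by simp
  ultimately have "triple W (Inv 0) (B ;; seqs Bs) (k 0 + (\<Sum>j<length Bs. k (Suc j)))
      (Inv (Suc (length Bs)))"
    by (rule triple_seq[rotated])
  thus ?case by (simp add: sum.lessThan_Suc_shift del: sum.lessThan_Suc)
qed

lemma triple_runs_to:
  assumes "triple W Pre B k Post" "Pre R M" "\<And>R M. Post R M \<Longrightarrow> R 0 = x"
  shows "runs_to W (B 0) \<lparr>pc = 0, reg = R, mem = M\<rparr> k x"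
proof -
  have "runs_to W (B 0) \<lparr>pc = 0, reg = R, mem = M\<rparr> (0 + k) x"
  proof (rule assms(1)[unfolded triple_def, rule_format])
    fix R' M' assume "Post R' M'"
    thus "runs_to W (B 0) \<lparr>pc = 0 + length (B 0), reg = R', mem = M'\<rparr> 0 x"
      by (intro runs_to_halted) (simp_all add: halted_def assms(3))
  qed (simp_all add: code_at_def assms(2))
  thus ?thesis by simp
qed

section \<open>Simulating a program inside another one\<close>

abbreviation nop :: instr where "nop \<equiv> SetConst 6 0"

text \<open>Register 7 holds the offset of the simulated memory; register 6 is scratch space and is 0
  between simulated instructions. Every instruction becomes three, so that jump targets scale.\<close>

fun sim_instr :: "(nat \<Rightarrow> nat) \<Rightarrow> nat \<Rightarrow> nat \<Rightarrow> instr \<Rightarrow> program" where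
  "sim_instr \<rho> b l (SetConst r k) = [SetConst (\<rho> r) k, nop, nop]"
| "sim_instr \<rho> b l (Op f r p q) = [Op f (\<rho> r) (\<rho> p) (\<rho> q), nop, nop]"
| "sim_instr \<rho> b l (Load r p) = [Op Add 6 (\<rho> p) 7, Load (\<rho> r) 6, nop]"
| "sim_instr \<rho> b l (Store p q) = [Op Add 6 (\<rho> p) 7, Store 6 (\<rho> q), nop]"
| "sim_instr \<rho> b l (RandBelow r p) = [RandBelow (\<rho> r) (\<rho> p), nop, nop]"
| "sim_instr \<rho> b l (JumpIfZero r k) = [nop, nop, JumpIfZero (\<rho> r) (b + 3 * min k l)]"

lemma length_sim_instr [simp]: "length (sim_instr \<rho> b l i) = 3"
  by (cases i) simp_all

definition sim :: "(nat \<Rightarrow> nat) \<Rightarrow> program \<Rightarrow> nat \<Rightarrow> program" where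
  "sim \<rho> P b = concat (map (sim_instr \<rho> b (length P)) P)"

lemma length_concat_const: "(\<And>x. x \<in> set xs \<Longrightarrow> length x = k) \<Longrightarrow> length (concat xs) = k * length xs"
  by (induction xs) auto

lemma length_sim [simp]: "length (sim \<rho> P b) = 3 * length P"
  unfolding sim_def by (subst length_concat_const[of _ 3]) auto

lemma code_at_concat:
  assumes "code_at Q b (concat (map f xs))" "k < length xs" "\<And>x. length (f x) = n"
  shows "code_at Q (b + n * k) (f (xs ! k))"
  using assms(1,2)
proof (induction xs arbitrary: b k)
  case (Cons x xs)
  show ?case
  proof (cases k)
    case 0
    with Cons.prems show ?thesis by (simp add: code_at_append)
  next
    case (Suc k')
    with Cons.prems have "code_at Q (b + n + n * k') (f (xs ! k'))"
      by (intro Cons.IH) (simp_all add: code_at_append assms(3))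
    with Suc show ?thesis by (simp add: add_ac)
  qed
qed simp

locale simulation =
  fixes w W :: nat and P Q :: program and \<rho> :: "nat \<Rightarrow> nat" and b off :: nat
    and R0 M0 :: "nat \<Rightarrow> nat"
  assumes code: "code_at Q b (sim \<rho> P b)"
    and inj: "inj \<rho>" and avoid: "6 \<notin> range \<rho>" "7 \<notin> range \<rho>"
    and R0: "R0 6 = 0" "R0 7 = off"
    and fit: "off + 2 ^ w \<le> 2 ^ W" "w \<le> W"
begin

text \<open>All halted states go to the end of the block, wherever the program counter has left the
  program; the clipped jumps of \<open>sim_instr\<close> lead there too. Simulated addresses are
  register contents below \<open>2 ^ w\<close>, so cells beyond are never touched.\<close>

definition embed :: "state \<Rightarrow> state" where
  "embed s =
     \<lparr>pc = b + 3 * min (pc s) (length P),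
      reg = (\<lambda>r. if r \<in> range \<rho> then reg s (inv \<rho> r) else R0 r),
      mem = (\<lambda>a. if off \<le> a \<and> a < off + 2 ^ w then mem s (a - off) else M0 a)\<rparr>"

lemma rho_neq [simp]: "\<rho> r \<noteq> 6" "\<rho> r \<noteq> 7" "6 \<noteq> \<rho> r" "7 \<noteq> \<rho> r"
  using avoid by auto

lemma rho_eq [simp]: "\<rho> r = \<rho> r' \<longleftrightarrow> r = r'"
  using inj by (simp add: inj_eq)

lemma inv_rho [simp]: "inv \<rho> (\<rho> r) = r"
  using inj by simp

lemma embed_reg [simp]: "reg (embed s) (\<rho> r) = reg s r" "reg (embed s) 6 = 0" "reg (embed s) 7 = off"
  using avoid R0 by (auto simp: embed_def)

lemma less_pow: "x < 2 ^ w \<Longrightarrow> (x :: nat) < 2 ^ W"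
  by (rule less_le_trans[OF _ power_increasing[OF fit(2)]]) simp_all

lemma embed_mem [simp]: "a < 2 ^ w \<Longrightarrow> mem (embed s) (off + a) = mem s a"
  by (simp add: embed_def)

lemma pc_embed: "\<not> halted P s \<Longrightarrow> pc (embed s) = b + 3 * pc s"
  by (simp add: embed_def halted_def)

lemma embed_write:
  assumes "\<not> halted P s"
  shows "embed (s\<lparr>pc := Suc (pc s), reg := (reg s)(r := x)\<rparr>) =
    (embed s)\<lparr>pc := pc (embed s) + 3, reg := (reg (embed s))(\<rho> r := x)\<rparr>"
  using assms by (auto simp: embed_def halted_def fun_eq_iff)

lemma embed_store:
  assumes "\<not> halted P s" "a < 2 ^ w"
  shows "embed (s\<lparr>pc := Suc (pc s), mem := (mem s)(a := x)\<rparr>) =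
    (embed s)\<lparr>pc := pc (embed s) + 3, mem := (mem (embed s))(off + a := x)\<rparr>"
  using assms by (auto simp: embed_def halted_def fun_eq_iff)

lemma code_instr:
  assumes "\<not> halted P s"
  shows "code_at Q (pc (embed s)) (sim_instr \<rho> b (length P) (P ! pc s))"
  unfolding pc_embed[OF assms]
  by (rule code_at_concat[OF code[unfolded sim_def]]) (use assms in \<open>simp_all add: halted_def\<close>)

lemma run_3: "run W Q 3 S = bind_pmf (step W Q S) (\<lambda>S1. bind_pmf (step W Q S1) (step W Q))"
proof -
  have "run W Q 0 = return_pmf" by (rule ext) simp
  moreover have "run W Q (Suc t) = (\<lambda>s. bind_pmf (step W Q s) (run W Q t))" for t by (rule ext) simp
  ultimately show ?thesis by (simp add: numeral_3_eq_3 bind_return_pmf')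
qed

text \<open>Hanging has to be excluded: a result too large for \<open>w\<close> bits may fit into
  \<open>W\<close> bits, and the simulation would go on where the original program hangs.\<close>

lemma embed_step:
  assumes nh: "\<not> halted P s" and lt: "\<And>r. reg s r < 2 ^ w" and ns: "step w P s \<noteq> return_pmf s"
  shows "run W Q 3 (embed s) = map_pmf embed (step w P s)"
proof -
  let ?S = "embed s"
  have st: "step w P s = exec w (P ! pc s) s" using nh by (simp add: step_def)
  have code': "code_at Q (pc ?S) (sim_instr \<rho> b (length P) (P ! pc s))" by (rule code_instr[OF nh])
  have nops: "bind_pmf (step W Q S1) (step W Q) = return_pmf (S1\<lparr>pc := pc ?S + 3\<rparr>)"
    if "pc S1 = Suc (pc ?S)" "reg S1 6 = 0" "code_at Q (Suc (pc ?S)) [nop, nop]" for S1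
  proof -
    have e: "(reg S1)(6 := 0) = reg S1" using that(2) by auto
    show ?thesis
      using that(1,3) by (simp add: step_def halted_def code_at_Cons write_reg_def bind_return_pmf e numeral_3_eq_3)
  qed
  have addr: "reg s p + off < 2 ^ W" for p using lt[of p] fit(1) by linarith
  show ?thesis
  proof (cases "P ! pc s")
    case (SetConst r k)
    have k: "k < 2 ^ w" using ns st SetConst by (auto simp: write_reg_def split: if_splits)
    have "step W Q ?S = return_pmf (?S\<lparr>pc := Suc (pc ?S), reg := (reg ?S)(\<rho> r := k)\<rparr>)"
      using code' SetConst less_pow[OF k] by (simp add: step_def halted_def code_at_Cons write_reg_def)
    thus ?thesis using code' SetConst k nh
      by (simp add: run_3 bind_return_pmf st write_reg_def embed_write code_at_Cons nops)
  next
    case (Op f r p q)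
    let ?k = "eval_op f (reg s p) (reg s q)"
    have k: "?k < 2 ^ w" using ns st Op by (auto simp: write_reg_def split: if_splits)
    have "step W Q ?S = return_pmf (?S\<lparr>pc := Suc (pc ?S), reg := (reg ?S)(\<rho> r := ?k)\<rparr>)"
      using code' Op less_pow[OF k] by (simp add: step_def halted_def code_at_Cons write_reg_def)
    thus ?thesis using code' Op k nh
      by (simp add: run_3 bind_return_pmf st write_reg_def embed_write code_at_Cons nops)
  next
    case (Load r p)
    let ?k = "mem s (reg s p)"
    have k: "?k < 2 ^ w" using ns st Load by (auto simp: write_reg_def split: if_splits)
    have m: "mem ?S (reg s p + off) = ?k" using embed_mem[OF lt, of s p] by (simp add: add.commute)
    have e: "(reg ?S)(\<rho> r := ?k, 6 := 0) = (reg ?S)(\<rho> r := ?k)"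
      by (auto simp: fun_eq_iff)
    have "step W Q ?S = return_pmf (?S\<lparr>pc := Suc (pc ?S), reg := (reg ?S)(6 := reg s p + off)\<rparr>)"
      using code' Load addr by (simp add: step_def halted_def code_at_Cons write_reg_def)
    thus ?thesis using code' Load k less_pow[OF k] nh
      by (simp add: run_3 bind_return_pmf st write_reg_def embed_write code_at_Cons step_def
          halted_def[of Q] m e numeral_3_eq_3)
  next
    case (Store p q)
    have e: "(reg ?S)(6 := 0) = reg ?S" by (auto simp: fun_eq_iff)
    have "step W Q ?S = return_pmf (?S\<lparr>pc := Suc (pc ?S), reg := (reg ?S)(6 := reg s p + off)\<rparr>)"
      using code' Store addr by (simp add: step_def halted_def code_at_Cons write_reg_def)
    moreover have "embed (s\<lparr>pc := Suc (pc s), mem := (mem s)(reg s p := reg s q)\<rparr>) =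
        ?S\<lparr>pc := pc ?S + 3, mem := (mem ?S)(off + reg s p := reg s q)\<rparr>"
      by (rule embed_store[OF nh lt])
    ultimately show ?thesis using code' Store nh
      by (simp add: run_3 bind_return_pmf st write_reg_def code_at_Cons step_def
          halted_def[of Q] e numeral_3_eq_3 add.commute)
  next
    case (RandBelow r p)
    have p0: "reg s p \<noteq> 0" using ns st RandBelow by (auto split: if_splits)
    have lt': "x < 2 ^ w" if "x < reg s p" for x using lt[of p] that by simp
    have fin: "set_pmf (pmf_of_set {0..<reg s p}) = {0..<reg s p}"
      using p0 by (intro set_pmf_of_set) auto
    have "step W Q ?S = map_pmf (\<lambda>x. write_reg W (\<rho> r) x ?S) (pmf_of_set {0..<reg s p})"
      using code' RandBelow p0 by (simp add: step_def halted_def code_at_Cons)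
    hence "run W Q 3 ?S = bind_pmf (pmf_of_set {0..<reg s p})
        (\<lambda>x. bind_pmf (step W Q (write_reg W (\<rho> r) x ?S)) (step W Q))"
      by (simp add: run_3 map_pmf_def bind_assoc_pmf bind_return_pmf)
    also have "\<dots> = bind_pmf (pmf_of_set {0..<reg s p}) (\<lambda>x. return_pmf (embed (write_reg w r x s)))"
    proof (rule bind_pmf_cong[OF refl])
      fix x assume "x \<in> set_pmf (pmf_of_set {0..<reg s p})"
      hence x: "x < 2 ^ w" using lt' by (simp add: fin)
      show "bind_pmf (step W Q (write_reg W (\<rho> r) x ?S)) (step W Q) =
          return_pmf (embed (write_reg w r x s))"
        using x less_pow[OF x] code' RandBelow nh
        by (subst nops) (simp_all add: write_reg_def embed_write code_at_Cons)
    qed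
    also have "\<dots> = map_pmf embed (step w P s)"
      using p0 RandBelow by (simp add: st map_pmf_def bind_assoc_pmf bind_return_pmf)
    finally show ?thesis .
  next
    case (JumpIfZero r l)
    have e: "(reg ?S)(6 := 0) = reg ?S" by (auto simp: fun_eq_iff)
    have "embed (s\<lparr>pc := (if reg s r = 0 then l else Suc (pc s))\<rparr>) =
        ?S\<lparr>pc := (if reg s r = 0 then b + 3 * min l (length P) else pc ?S + 3)\<rparr>"
      using nh by (auto simp: embed_def halted_def)
    thus ?thesis using code' JumpIfZero nh
      by (simp add: run_3 bind_return_pmf st write_reg_def code_at_Cons step_def
          halted_def[of Q] e numeral_3_eq_3)
  qed
qed

text \<open>\<open>G\<close> is an invariant set of states free of hanging. Truncated times are
  compared by induction, \<open>3 * N\<close> steps of \<open>Q\<close> with \<open>N\<close> steps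
  of \<open>P\<close>, where \<open>t\<close> pays for the code after the block.\<close>

lemma runs_to_embed:
  assumes G: "\<And>s s'. s \<in> G \<Longrightarrow> s' \<in> set_pmf (step w P s) \<Longrightarrow> s' \<in> G"
    and lt: "\<And>s r. s \<in> G \<Longrightarrow> reg s r < 2 ^ w"
    and ns: "\<And>s. s \<in> G \<Longrightarrow> \<not> halted P s \<Longrightarrow> step w P s \<noteq> return_pmf s"
    and fin: "\<And>s. s \<in> G \<Longrightarrow> halted P s \<Longrightarrow> runs_to W Q (embed s) t x"
    and s: "s \<in> G"
  shows "runs_to W Q (embed s) (t + 3 * expected_time w P s) x"
proof -
  have time: "time_upto W Q (3 * N) (embed s) \<le> t + 3 * time_upto w P N s" if "s \<in> G" for N s
    using that
  proof (induction N arbitrary: s)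
    case 0
    show ?case by (simp add: time_upto_def)
  next
    case (Suc N)
    show ?case
    proof (cases "halted P s")
      case True
      thus ?thesis using fin[OF Suc.prems True] time_upto_le[of W Q "3 * Suc N" "embed s"]
        unfolding runs_to_def by (auto simp: time_upto_halted intro: order_trans)
    next
      case False
      have "time_upto W Q (3 * Suc N) (embed s) \<le>
          of_nat 3 + (\<integral>\<^sup>+ S. time_upto W Q (3 * N) S \<partial>measure_pmf (run W Q 3 (embed s)))"
        using time_upto_split[of W Q 3 "3 * N"] by simp
      also have "\<dots> = 3 + (\<integral>\<^sup>+ s'. time_upto W Q (3 * N) (embed s') \<partial>measure_pmf (step w P s))"
        by (simp add: embed_step[OF False lt[OF Suc.prems] ns[OF Suc.prems False]])
      also have "\<dots> \<le> 3 + (\<integral>\<^sup>+ s'. t + 3 * time_upto w P N s' \<partial>measure_pmf (step w P s))"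
        by (intro add_left_mono nn_integral_mono_AE)
          (auto simp: AE_measure_pmf_iff intro!: Suc.IH G[OF Suc.prems])
      also have "\<dots> = t + 3 * (1 + (\<integral>\<^sup>+ s'. time_upto w P N s' \<partial>measure_pmf (step w P s)))"
        by (simp add: nn_integral_add nn_integral_cmult distrib_left add_ac)
      also have "\<dots> = t + 3 * time_upto w P (Suc N) s"
        using False by (simp add: time_upto_Suc)
      finally show ?thesis .
    qed
  qed
  have "expected_time W Q (embed s) \<le> t + 3 * expected_time w P s"
    unfolding expected_time_SUP[of W Q]
  proof (rule SUP_least)
    fix N
    have "time_upto W Q N (embed s) \<le> time_upto W Q (3 * N) (embed s)"
      by (rule time_upto_mono) simp
    also have "\<dots> \<le> t + 3 * time_upto w P N s" by (rule time[OF s])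
    also have "\<dots> \<le> t + 3 * expected_time w P s"
      by (intro add_left_mono mult_left_mono time_upto_le) simp
    finally show "time_upto W Q N (embed s) \<le> t + 3 * expected_time w P s" .
  qed
  moreover have res: "reg S 0 = x"
    if "s \<in> G" "S \<in> set_pmf (run W Q (3 * n) (embed s))" "halted Q S" for s S n
    using that
  proof (induction n arbitrary: s)
    case 0
    have "halted P s"
    proof (rule ccontr)
      assume nh: "\<not> halted P s"
      have "pc (embed s) < length Q"
        using code_instr[OF nh] unfolding code_at_def by (auto dest: spec[of _ 0])
      with 0 show False by (simp add: halted_def)
    qed
    from fin[OF 0(1) this] 0 show ?case unfolding runs_to_def by (auto dest: spec[of _ 0])
  next
    case (Suc n)
    show ?case
    proof (cases "halted P s")
      case True
      with fin[OF Suc.prems(1)] Suc.prems(2,3) show ?thesis unfolding runs_to_def by blast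
    next
      case False
      have "S \<in> set_pmf (bind_pmf (run W Q 3 (embed s)) (run W Q (3 * n)))"
        using Suc.prems(2) by (metis run_add mult_Suc_right)
      then obtain s' where "s' \<in> set_pmf (step w P s)" "S \<in> set_pmf (run W Q (3 * n) (embed s'))"
        by (auto simp: embed_step[OF False lt[OF Suc.prems(1)] ns[OF Suc.prems(1) False]])
      with Suc.IH[of s'] G[OF Suc.prems(1)] Suc.prems(3) show ?thesis by blast
    qed
  qed
  \<comment> \<open>A halted state persists, so \<open>n\<close> may be replaced by
    \<open>3 * n\<close>.\<close>
  have "reg S 0 = x" if "S \<in> set_pmf (run W Q n (embed s))" "halted Q S" for S n
    using set_pmf_run_halted[OF that(1) step_halted[OF that(2)], of "2 * n"] res[OF s, of S n] that(2)
    by simp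
  ultimately show ?thesis unfolding runs_to_def by blast
qed

end

lemma reg_step_bound:
  assumes "s' \<in> set_pmf (step w P s)" "\<forall>r. reg s r < 2 ^ w"
  shows "reg s' r < 2 ^ w"
proof (cases "halted P s")
  case True
  with assms show ?thesis by (simp add: step_def)
next
  case False
  with assms show ?thesis
    by (cases "P ! pc s") (auto simp: step_def write_reg_def split: if_splits)
qed

lemma reg_run_bound:
  assumes "s' \<in> set_pmf (run w P n s)" "\<forall>r. reg s r < 2 ^ w"
  shows "\<forall>r. reg s' r < 2 ^ w"
  using assms
proof (induction n arbitrary: s)
  case (Suc n)
  then obtain s1 where "s1 \<in> set_pmf (step w P s)" "s' \<in> set_pmf (run w P n s1)" by auto
  with Suc.IH[of s1] reg_step_bound[of s1 w P s] Suc.prems(2) show ?case by blast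
qed simp

lemma triple_sim:
  assumes out: "outputs w P s0 y" and pc: "pc s0 = 0" and lt: "\<And>r. reg s0 r < 2 ^ w"
    and fit: "off + 2 ^ w \<le> 2 ^ W" "w \<le> W"
    and \<rho>: "inj \<rho>" "6 \<notin> range \<rho>" "7 \<notin> range \<rho>"
    and R0: "R0 6 = 0" "R0 7 = off" and bank: "\<And>r. R0 (\<rho> r) = reg s0 r"
    and M0: "\<And>a. a < 2 ^ w \<Longrightarrow> M0 (off + a) = mem s0 a"
  shows "triple W (\<lambda>R M. R = R0 \<and> M = M0) (sim \<rho> P) (3 * expected_time w P s0)
    (\<lambda>R M. R (\<rho> 0) = y \<and> (\<forall>r. r \<notin> range \<rho> \<longrightarrow> R r = R0 r) \<and>
      (\<forall>a. a < off \<or> off + 2 ^ w \<le> a \<longrightarrow> M a = M0 a))"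
  (is "triple _ _ _ _ ?Post")
  unfolding triple_def
proof (intro allI impI)
  fix Q b R M t x
  assume code: "code_at Q b (sim \<rho> P b)" and RM: "R = R0 \<and> M = M0"
    and post: "\<forall>R' M'. ?Post R' M' \<longrightarrow>
      runs_to W Q \<lparr>pc = b + length (sim \<rho> P b), reg = R', mem = M'\<rparr> t x"
  interpret simulation w W P Q \<rho> b off R0 M0
    by unfold_locales (use code \<rho> R0(1,2) fit in auto)
  let ?G = "{s. \<exists>n. s \<in> set_pmf (run w P n s0)}"
  have "runs_to W Q (embed s0) (t + 3 * expected_time w P s0) x"
  proof (rule runs_to_embed[where G = ?G])
    fix s s' assume "s \<in> ?G" and s': "s' \<in> set_pmf (step w P s)"
    then obtain n where "s \<in> set_pmf (run w P n s0)" by blast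
    with s' have "s' \<in> set_pmf (run w P (n + Suc 0) s0)"
      unfolding run_add set_bind_pmf run_1 by blast
    thus "s' \<in> ?G" by blast
  next
    fix s r assume "s \<in> ?G"
    thus "reg s r < 2 ^ w" using reg_run_bound[of s w P _ s0] lt by blast
  next
    fix s assume "s \<in> ?G" "\<not> halted P s"
    thus "step w P s \<noteq> return_pmf s" using outputs_fixed[OF out] by blast
  next
    fix s assume s: "s \<in> ?G" "halted P s"
    hence "reg s 0 = y" using outputs_fixed[OF out] step_halted by blast
    moreover have "embed s = \<lparr>pc = b + length (sim \<rho> P b), reg = reg (embed s), mem = mem (embed s)\<rparr>"
      using s(2) by (simp add: embed_def halted_def)
    moreover have "?Post (reg (embed s)) (mem (embed s))"
      using \<open>reg s 0 = y\<close> by (simp add: embed_def)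
    ultimately show "runs_to W Q (embed s) t x" using post by metis
  next
    show "s0 \<in> ?G" by (auto intro: exI[of _ 0])
  qed
  moreover have "embed s0 = \<lparr>pc = b, reg = R, mem = M\<rparr>"
  proof -
    have "reg (embed s0) = R0"
      by (rule ext) (auto simp: embed_def bank)
    moreover have "mem (embed s0) = M0"
    proof
      fix a
      show "mem (embed s0) a = M0 a"
        using M0[of "a - off"] by (auto simp: embed_def)
    qed
    ultimately show ?thesis using RM pc by (simp add: embed_def)
  qed
  ultimately show "runs_to W Q \<lparr>pc = b, reg = R, mem = M\<rparr> (t + 3 * expected_time w P s0) x"
    by simp
qed

section \<open>Generating the gadget graph\<close>

text \<open>Cells \<open>2 * i\<close> and \<open>2 * i + 1\<close> hold the ends of the
  \<open>i\<close>-th edge. So a position \<open>p\<close> is a directed edge, and flipping its last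
  bit gives the position of its head, that is, the reversed edge.\<close>

lemma mate_less: "p < 2 * m \<Longrightarrow> Bit_Operations.xor p (Suc 0) < 2 * (m :: nat)"
  by (simp add: xor_Suc_0_eq) presburger

lemma mate_even: "even p \<Longrightarrow> Bit_Operations.xor p (Suc 0) = Suc p"
  by (simp add: xor_Suc_0_eq)

lemma mate_odd: "odd p \<Longrightarrow> Bit_Operations.xor p (Suc 0) = p - 1"
  by (simp add: xor_Suc_0_eq)

definition flat :: "(nat \<times> nat) list \<Rightarrow> nat list" where
  "flat es = concat (map (\<lambda>(u, v). [u, v]) es)"

lemma flat_simps [simp]: "flat [] = []" "flat ((u, v) # es) = u # v # flat es"
  "flat (es @ es') = flat es @ flat es'"
  by (simp_all add: flat_def)

lemma length_flat [simp]: "length (flat es) = 2 * length es"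
  by (induction es) auto

lemma flat_nth: "i < length es \<Longrightarrow> flat es ! (2 * i) = fst (es ! i) \<and> flat es ! Suc (2 * i) = snd (es ! i)"
proof (induction es arbitrary: i)
  case (Cons e es)
  thus ?case by (cases i; cases e) auto
qed simp

lemma init_mem: "mem (init_state n es) a = (if a < 2 * length es then flat es ! a else 0)"
proof (cases "a < 2 * length es")
  case True
  hence "a div 2 < length es" by simp
  from flat_nth[OF this] True show ?thesis
    by (cases "even a") (auto simp: init_state_def odd_two_times_div_two_succ elim!: evenE oddE)
qed (simp add: init_state_def)

text \<open>Registers: 2 and 3 hold 0 and 1, 4 the number \<open>N = 2 m\<close> of directed edges, 5 the class size
  \<open>N + 1\<close>, 7 the start of the memory region of the current simulation, 8 the next address to be
  written, 9 the loop counter, 12 and 13 the sums over even and odd edge sets, 14 the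
  distance of the memory regions, 15 the number of vertices of the gadget. The register \<open>r\<close> of
  the \<open>j\<close>-th simulated machine is \<open>bank J j r\<close>.\<close>

fun idx_code :: "code \<Rightarrow> program" where
  "idx_code Zero = []"
| "idx_code Pos = [Op Add 10 10 9]"
| "idx_code Lab = [Load 11 9, Op Add 11 11 4, Load 11 11, Op Add 10 10 11]"
| "idx_code Mate = [Op Xor 11 9 3, Load 11 11, Op Add 11 11 4, Load 11 11, Op Add 10 10 11]"

definition emit :: "nat \<Rightarrow> nat \<Rightarrow> code \<Rightarrow> program" where
  "emit u v \<beta> =
     [SetConst 10 u, Op Mul 10 10 5, Op Add 10 10 9, Store 8 10, Op Add 8 8 3,
      SetConst 10 v, Op Mul 10 10 5] @ idx_code \<beta> @ [Store 8 10, Op Add 8 8 3]"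

lemma length_emit: "length (emit u v \<beta>) \<le> 14"
  by (cases \<beta>) (simp_all add: emit_def)

text \<open>Interleaving gives each of the \<open>J\<close> machines infinitely many registers of
  its own, without a bound on the registers that the given program uses; the first 16 belong to the
  host.\<close>

definition bank :: "nat \<Rightarrow> nat \<Rightarrow> nat \<Rightarrow> nat" where
  "bank J j r = 16 + r * J + j"

lemma bank_neq [simp]:
  "i < 16 \<Longrightarrow> bank J j r \<noteq> i" "i < 16 \<Longrightarrow> i \<noteq> bank J j r"
  by (auto simp: bank_def)

lemma bank_eq: "j < J \<Longrightarrow> j' < J \<Longrightarrow> bank J j r = bank J j' r' \<longleftrightarrow> r = r' \<and> j = j'"
proof
  assume j: "j < J" "j' < J" and "bank J j r = bank J j' r'"
  hence e: "r * J + j = r' * J + j'" by (simp add: bank_def)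
  have "(r * J + j) div J = r" "(r' * J + j') div J = r'" using j by simp_all
  with e have "r = r'" by simp
  with e show "r = r' \<and> j = j'" by simp
qed simp

definition memw :: "(nat \<Rightarrow> nat) \<Rightarrow> nat \<Rightarrow> nat list \<Rightarrow> nat \<Rightarrow> nat" where
  "memw M b xs a = (if b \<le> a \<and> a < b + length xs then xs ! (a - b) else M a)"

lemma memw_Nil [simp]: "memw M b [] = M"
  by (auto simp: memw_def)

lemma memw_snoc: "(memw M b xs)(b + length xs := x) = memw M b (xs @ [x])"
  by (auto simp: memw_def nth_append fun_eq_iff)

lemma memw_snoc2:
  "(memw M b xs)(b + length xs := x, Suc (b + length xs) := y) = memw M b (xs @ [x, y])"
  using memw_snoc[of M b "xs @ [x]" y] by (simp add: memw_snoc)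

context gadget begin

lemma wp_emit:
  assumes R: "R 3 = 1" "R 4 = N" "R 5 = Suc N" "R 9 = p" "p < N" "N + n \<le> R 8"
    and M: "\<And>a. a < N \<Longrightarrow> M a < n" "lab p = M (N + M p)"
      "lab' p = M (N + M (Bit_Operations.xor p (Suc 0)))" "Bit_Operations.xor p (Suc 0) < N"
    and fit: "num u * Suc N + N < 2 ^ W" "num v * Suc N + N < 2 ^ W" "R 8 + 2 < 2 ^ W"
    and post: "\<And>R'. R' 8 = R 8 + 2 \<Longrightarrow> (\<And>r. r \<noteq> 8 \<Longrightarrow> r \<noteq> 10 \<Longrightarrow> r \<noteq> 11 \<Longrightarrow> R' r = R r) \<Longrightarrow>
      Post R' (M(R 8 := enc u p, Suc (R 8) := enc v (idx \<beta> p)))"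
  shows "wp W (emit (num u) (num v) \<beta>) Post R M"
proof -
  let ?q = "Bit_Operations.xor p (Suc 0)"
  have L: "lab p < N" "lab' p < N" using lab R by auto
  have M': "M p < n" "M ?q < n" using M R by auto
  \<comment> \<open>The first word is stored before the labels are read; it must not overwrite the
    edge list or the table of labels.\<close>
  have ne: "p \<noteq> R 8" "?q \<noteq> R 8" "N + M p \<noteq> R 8" "N + M ?q \<noteq> R 8"
    using M(4) M' R(5,6) by linarith+
  have f: "num u < 2 ^ W" "num v < 2 ^ W" "num u * Suc N < 2 ^ W" "num v * Suc N < 2 ^ W"
    "num u * Suc N + p < 2 ^ W" "num v * Suc N + p < 2 ^ W"
    "num v * Suc N + lab p < 2 ^ W" "num v * Suc N + lab' p < 2 ^ W"
    "M p < 2 ^ W" "M ?q < 2 ^ W" "N + M p < 2 ^ W" "N + M ?q < 2 ^ W" "lab p < 2 ^ W" "lab' p < 2 ^ W"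
    "R 8 + 1 < 2 ^ W" "?q < 2 ^ W" "Suc (Suc (R 8)) < 2 ^ W"
    using fit L M' M(4) R(5,6) by (simp_all del: mult_Suc_right) (use fit L M' M(4) R(5,6) in auto)
  have post': "Post R' M'" if "R' 8 = R 8 + 2" "\<And>r. r \<noteq> 8 \<Longrightarrow> r \<noteq> 10 \<Longrightarrow> r \<noteq> 11 \<Longrightarrow> R' r = R r"
    "M' = M(R 8 := enc u p, Suc (R 8) := enc v (idx \<beta> p))" for R' M'
    using post that by simp
  show ?thesis
    by (cases \<beta>) (use f[simplified] ne in \<open>auto simp: emit_def wp_append R M(2,3)[symmetric] enc_def
      add.commute[of _ N] intro!: post'\<close>)
qed

definition edge_code :: "'a set \<Rightarrow> program" where
  "edge_code e = (case tr e of (a, b, \<beta>) \<Rightarrow> emit (num a) (num b) \<beta>)"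

lemma wp_edges:
  assumes R: "R 3 = 1" "R 4 = N" "R 5 = Suc N" "R 9 = p" "p < N" "R 8 = off + length xs" "N + n \<le> off"
    and M: "M = memw Mb off xs" "\<And>a. a < N \<Longrightarrow> Mb a < n" "lab p = Mb (N + Mb p)"
      "lab' p = Mb (N + Mb (Bit_Operations.xor p (Suc 0)))" "Bit_Operations.xor p (Suc 0) < N"
    and fit: "card (verts H) * Suc N < 2 ^ W" "off + length xs + 2 * length Fs < 2 ^ W"
    and Fs: "set Fs \<subseteq> edges H"
    and post: "\<And>R'. R' 8 = off + length xs + 2 * length Fs \<Longrightarrow>
      (\<And>r. r \<noteq> 8 \<Longrightarrow> r \<noteq> 10 \<Longrightarrow> r \<noteq> 11 \<Longrightarrow> R' r = R r) \<Longrightarrow>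
      Post R' (memw Mb off (xs @ flat (map (\<lambda>e. gedge e p) Fs)))"
  shows "wp W (concat (map edge_code Fs)) Post R M"
  using R M(1) fit(2) Fs post
proof (induction Fs arbitrary: R M xs)
  case Nil
  from Nil.prems(8,11) show ?case by (simp add: Nil.prems(6))
next
  case (Cons e Fs)
  have e: "e \<in> edges H" using Cons.prems by simp
  obtain a b \<beta> where t: "tr e = (a, b, \<beta>)" "a \<in> verts H" "b \<in> verts H"
    "gedge e p = (enc a p, enc b (idx \<beta> p))" by (rule gedge_obtain[OF e Cons.prems(5)]) blast
  have below: "M x = Mb x" if "x < N + n" for x
    using that Cons.prems(7,8) by (simp add: memw_def)
  have lt: "Mb p < n" "Mb (Bit_Operations.xor p (Suc 0)) < n" using M Cons.prems(5) by auto
  have vert: "num u * Suc N + N < 2 ^ W" if "u \<in> verts H" for u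
    using enc_less[OF that, of N] fit(1) by (simp add: enc_def)
  show ?case
    unfolding list.map concat.simps wp_append edge_code_def[of e] t(1) prod.case
  proof (rule wp_emit[OF Cons.prems(1-5), where n = n])
    fix R' assume R': "R' 8 = R 8 + 2" "\<And>r. r \<noteq> 8 \<Longrightarrow> r \<noteq> 10 \<Longrightarrow> r \<noteq> 11 \<Longrightarrow> R' r = R r"
    let ?xs = "xs @ [enc a p, enc b (idx \<beta> p)]"
    have m: "M(R 8 := enc a p, Suc (R 8) := enc b (idx \<beta> p)) = memw Mb off ?xs"
      unfolding Cons.prems(6,8) by (rule memw_snoc2)
    show "wp W (concat (map edge_code Fs)) Post R'
        (M(R 8 := enc a p, Suc (R 8) := enc b (idx \<beta> p)))"
    proof (rule Cons.IH[OF _ _ _ _ _ _ _ m])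
      fix R'' assume R'': "R'' 8 = off + length ?xs + 2 * length Fs"
        "\<And>r. r \<noteq> 8 \<Longrightarrow> r \<noteq> 10 \<Longrightarrow> r \<noteq> 11 \<Longrightarrow> R'' r = R' r"
      have "Post R'' (memw Mb off (xs @ flat (map (\<lambda>e. gedge e p) (e # Fs))))"
        by (rule Cons.prems(11)) (use R'' R' in simp_all)
      thus "Post R'' (memw Mb off (?xs @ flat (map (\<lambda>e. gedge e p) Fs)))" by (simp add: t(4))
    qed (use R' Cons.prems in simp_all)
  qed (use Cons.prems(5,6,7,9) M lt t vert in \<open>simp_all add: below\<close>)
qed

lemma triple_generate:
  assumes R0: "R0 2 = 0" "R0 3 = 1" "R0 4 = N" "R0 5 = Suc N" "R0 7 = off" "N + n \<le> off"
    and Mb: "\<And>a. a < N \<Longrightarrow> Mb a < n" "\<And>p. p < N \<Longrightarrow> lab p = Mb (N + Mb p)"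
      "\<And>p. p < N \<Longrightarrow> lab' p = Mb (N + Mb (Bit_Operations.xor p (Suc 0)))"
      "\<And>p. p < N \<Longrightarrow> Bit_Operations.xor p (Suc 0) < N"
    and fit: "card (verts H) * Suc N < 2 ^ W" "off + 2 * length Fs * N < 2 ^ W"
    and Fs: "set Fs \<subseteq> edges H"
  defines "body \<equiv> Op Sub 9 9 3 # concat (map edge_code Fs)"
  shows "triple W (\<lambda>R M. R = R0 \<and> M = Mb)
    ((\<lambda>_. [Op Add 8 7 2, Op Add 9 4 2]) ;; while 2 9 (\<lambda>_. body))
    (2 + (of_nat N * (of_nat (length body) + 2) + 1))
    (\<lambda>R M. (\<forall>r. r \<notin> {8, 9, 10, 11} \<longrightarrow> R r = R0 r) \<and>
      M = memw Mb off (flat (concat (map (\<lambda>p. map (\<lambda>e. gedge e p) Fs) (rev [0..<N])))))"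
proof -
  \<comment> \<open>The counter runs downwards, so the positions appear in decreasing order;
    \<open>ws i\<close> is written once all positions from \<open>i\<close> on are done.\<close>
  define ws where "ws i = flat (concat (map (\<lambda>p. map (\<lambda>e. gedge e p) Fs) (rev [i..<N])))" for i
  define Inv where "Inv i R M \<longleftrightarrow> (\<forall>r. r \<notin> {8, 9, 10, 11} \<longrightarrow> R r = R0 r) \<and> i \<le> N \<and> R 9 = i \<and>
    R 8 = off + length (ws i) \<and> M = memw Mb off (ws i)" for i R M
  have len_ws: "length (ws i) = 2 * length Fs * (N - i)" if "i \<le> N" for i
    unfolding ws_def length_flat by (subst length_concat_const[of _ "length Fs"]) auto
  have ws_Suc: "ws i = ws (Suc i) @ flat (map (\<lambda>e. gedge e i) Fs)" if "i < N" for i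
    using that by (simp add: ws_def upt_conv_Cons)
  have N_fit: "N < 2 ^ W" "off < 2 ^ W" using fit R0 by auto
  have 1: "triple W (\<lambda>R M. R = R0 \<and> M = Mb) (\<lambda>_. [Op Add 8 7 2, Op Add 9 4 2]) 2 (Inv N)"
  proof -
    have "ws N = []" by (simp add: ws_def)
    have "triple W (\<lambda>R M. R = R0 \<and> M = Mb) (\<lambda>_. [Op Add 8 7 2, Op Add 9 4 2])
       (of_nat (length [Op Add 8 7 2, Op Add 9 4 2])) (Inv N)"
      by (rule triple_straight) (use R0 N_fit \<open>ws N = []\<close> in \<open>auto simp: Inv_def\<close>)
    thus ?thesis by simp
  qed
  have 2: "triple W (Inv (Suc i)) (\<lambda>_. body) (of_nat (length body)) (Inv i)" if i: "i < N" for i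
  proof (rule triple_straight)
    fix R M assume I: "Inv (Suc i) R M"
    have off: "off + length (ws (Suc i)) + 2 * length Fs < 2 ^ W"
    proof -
      have "length (ws (Suc i)) + 2 * length Fs = 2 * length Fs * (N - i)"
        using i by (simp add: len_ws Suc_diff_Suc[symmetric, of i N])
      also have "\<dots> \<le> 2 * length Fs * N" by simp
      finally show ?thesis using fit(2) by simp
    qed
    have "wp W (concat (map edge_code Fs)) (Inv i) (R(9 := i)) M"
    proof (rule wp_edges[where p = i and xs = "ws (Suc i)" and off = off and n = n and Mb = Mb])
      fix R' assume R': "R' 8 = off + length (ws (Suc i)) + 2 * length Fs"
        "\<And>r. r \<noteq> 8 \<Longrightarrow> r \<noteq> 10 \<Longrightarrow> r \<noteq> 11 \<Longrightarrow> R' r = (R(9 := i)) r"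
      thus "Inv i R' (memw Mb off (ws (Suc i) @ flat (map (\<lambda>e. gedge e i) Fs)))"
        using I i by (simp add: Inv_def ws_Suc)
    qed (use I i R0 Mb fit off Fs in \<open>simp_all add: Inv_def\<close>)
    thus "wp W body (Inv i) R M" using I i R0 N_fit by (simp add: body_def Inv_def)
  qed
  have "triple W (Inv N) (while 2 9 (\<lambda>_. body)) (of_nat N * (of_nat (length body) + 2) + 1) (Inv 0)"
  proof (rule triple_while)
    fix i assume "i < N"
    thus "triple W (Inv (Suc i)) (\<lambda>_. body) (of_nat (length body)) (Inv i)" by (rule 2)
  qed (use R0 in \<open>auto simp: Inv_def\<close>)
  from triple_seq[OF 1 this] show ?thesis
    by (rule triple_conseq) (auto simp: Inv_def ws_def)
qed

end

section \<open>Polynomial bounds and word lengths\<close>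

lemma two_powr_ceiling_log:
  fixes x :: nat
  assumes "2 \<le> x"
  shows "x \<le> 2 ^ nat \<lceil>log 2 (real x)\<rceil>" "2 ^ nat \<lceil>log 2 (real x)\<rceil> \<le> 2 * x"
proof -
  let ?L = "nat \<lceil>log 2 (real x)\<rceil>"
  have pos: "0 \<le> log 2 (real x)" using assms by simp
  hence "0 \<le> \<lceil>log 2 (real x)\<rceil>" by linarith
  hence L: "real ?L = of_int \<lceil>log 2 (real x)\<rceil>" by simp
  have x: "2 powr (log 2 (real x)) = real x" using assms by simp
  have eq: "real (2 ^ ?L) = 2 powr real ?L" by (simp add: powr_realpow)
  have "log 2 (real x) \<le> real ?L" unfolding L by linarith
  hence "2 powr (log 2 (real x)) \<le> 2 powr real ?L" by simp
  hence "real x \<le> real (2 ^ ?L)" unfolding x eq .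
  thus "x \<le> 2 ^ ?L" by linarith
  have "real ?L \<le> log 2 (real x) + 1" unfolding L by linarith
  hence "2 powr real ?L \<le> 2 powr (log 2 (real x) + 1)" by simp
  also have "\<dots> = 2 * real x" by (simp add: powr_add x)
  finally have "real (2 ^ ?L) \<le> real (2 * x)" unfolding eq by simp
  thus "2 ^ ?L \<le> 2 * x" by linarith
qed

lemma word_length_bounds:
  "(n + 2) ^ c \<le> 2 ^ word_length c n" "2 ^ word_length c n \<le> (2 * n + 4) ^ c"
proof -
  have r: "real n + 2 = real (n + 2)" by simp
  have eq: "(2 :: nat) ^ word_length c n = (2 ^ nat \<lceil>log 2 (real n + 2)\<rceil>) ^ c"
    unfolding word_length_def mult.commute[of c] power_mult ..
  show "(n + 2) ^ c \<le> 2 ^ word_length c n"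
    unfolding eq r by (intro power_mono two_powr_ceiling_log) auto
  have "(2 ^ nat \<lceil>log 2 (real (n + 2))\<rceil>) ^ c \<le> (2 * (n + 2)) ^ c"
    by (intro power_mono two_powr_ceiling_log) auto
  also have "2 * (n + 2) = 2 * n + 4" by simp
  finally show "2 ^ word_length c n \<le> (2 * n + 4) ^ c" unfolding eq r .
qed

text \<open>A result sits in a register and is therefore a word. This bounds the homomorphism counts
  without any counting.\<close>

lemma outputs_bound:
  assumes "outputs w P s y" "\<And>r. reg s r < 2 ^ w"
  shows "y < 2 ^ w"
proof -
  have "\<forall>\<^sub>F t in sequentially. measure_pmf.prob (run w P t s) {s'. halted P s' \<and> reg s' 0 = y} > 0"
    using assms(1) unfolding outputs_def by (intro order_tendstoD) auto
  then obtain t where "\<And>i. i \<ge> t \<Longrightarrow> measure_pmf.prob (run w P i s) {s'. halted P s' \<and> reg s' 0 = y} > 0"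
    by (auto simp: eventually_sequentially)
  from this[of t] have "measure_pmf.prob (run w P t s) {s'. halted P s' \<and> reg s' 0 = y} \<noteq> 0" by simp
  hence "set_pmf (run w P t s) \<inter> {s'. halted P s' \<and> reg s' 0 = y} \<noteq> {}"
    by (auto simp: measure_pmf_zero_iff)
  with reg_run_bound[of _ w P t s] assms(2) show ?thesis by blast
qed

lemma card_edges_le:
  assumes "simple_graph H"
  shows "card (edges H) \<le> card (verts H) * card (verts H)"
proof -
  have fin: "finite (verts H)" using assms by (simp add: simple_graph_def)
  have "edges H \<subseteq> (\<lambda>(u, v). {u, v}) ` (verts H \<times> verts H)"
  proof
    fix e assume "e \<in> edges H"
    hence e: "e \<subseteq> verts H" "card e = 2" using assms by (auto simp: simple_graph_def)
    then obtain u v where "e = {u, v}" by (auto simp: card_2_iff)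
    with e show "e \<in> (\<lambda>(u, v). {u, v}) ` (verts H \<times> verts H)" by auto
  qed
  hence "card (edges H) \<le> card (verts H \<times> verts H)"
    by (rule surj_card_le[rotated]) (use fin in auto)
  thus ?thesis by (simp add: card_cartesian_product)
qed

text \<open>All quantities of the reduction are polynomial in \<open>n\<close>, hence fit into
  \<open>O(log n)\<close> bits.\<close>

lemma ex_word_length:
  fixes h J c :: nat
  shows "\<exists>c' \<ge> 2. \<forall>n m. 1 \<le> n \<longrightarrow> m \<le> n * n \<longrightarrow>
    n + 2 * m + (J + 2) * (2 * (h * Suc (2 * m)) + 4) ^ c + 4 < 2 ^ word_length c' n"
proof -
  define b where "b = 2 * h + 4"
  \<comment> \<open>Constants go into exponents: \<open>b \<le> 2 ^ b \<le> x ^ b\<close> for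
    \<open>x = n + 2\<close>. Two of the \<open>c'\<close> factors are kept in reserve, one for
    adding two bounds and one for strictness.\<close>
  define c' where "c' = (J + 3) + (b + 4) * c + 5"
  have "n + 2 * m + (J + 2) * (2 * (h * Suc (2 * m)) + 4) ^ c + 4 < 2 ^ word_length c' n"
    if n: "1 \<le> n" and m: "m \<le> n * n" for n m
  proof -
    let ?x = "n + 2"
    have two: "(2 :: nat) ^ i \<le> ?x ^ i" for i by (intro power_mono) auto
    have "Suc (2 * m) \<le> ?x ^ 3"
    proof -
      have "Suc (2 * m) \<le> 2 * (?x * ?x)" using m n by (simp add: algebra_simps)
      also have "\<dots> \<le> ?x * (?x * ?x)" by (intro mult_right_mono) auto
      finally show ?thesis unfolding power3_eq_cube mult.assoc .
    qed
    hence "2 * (h * Suc (2 * m)) + 4 \<le> 2 * (h * ?x ^ 3) + 4 * ?x ^ 3"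
      by (intro add_mono mult_left_mono) auto
    also have "\<dots> = b * ?x ^ 3" by (simp add: b_def algebra_simps)
    also have "\<dots> \<le> ?x ^ b * ?x ^ 3"
      using order_trans[OF less_imp_le[OF less_exp] two] by (intro mult_right_mono) auto
    also have "\<dots> \<le> ?x ^ (b + 4)" unfolding power_add[symmetric] by (intro power_increasing) auto
    finally have "(2 * (h * Suc (2 * m)) + 4) ^ c \<le> (?x ^ (b + 4)) ^ c" by (intro power_mono) auto
    also have "\<dots> = ?x ^ ((b + 4) * c)" by (simp add: power_mult)
    finally have 1: "(2 * (h * Suc (2 * m)) + 4) ^ c \<le> ?x ^ ((b + 4) * c)" .
    have "J + 2 \<le> ?x ^ (J + 2)"
      using order_trans[OF less_imp_le[OF less_exp] two] .
    hence "(J + 2) * (2 * (h * Suc (2 * m)) + 4) ^ c \<le> ?x ^ (J + 2) * ?x ^ ((b + 4) * c)"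
      using 1 by (rule mult_mono) auto
    also have "\<dots> = ?x ^ (J + 2 + (b + 4) * c)" by (simp only: power_add)
    also have "\<dots> \<le> ?x ^ (c' - 2)" by (intro power_increasing) (auto simp: c'_def)
    finally have 2: "(J + 2) * (2 * (h * Suc (2 * m)) + 4) ^ c \<le> ?x ^ (c' - 2)" .
    have "n + 2 * m + 4 \<le> 2 * ?x ^ 2"
      using m n by (simp add: power2_eq_square algebra_simps)
    also have "\<dots> \<le> ?x * ?x ^ 2" by (intro mult_right_mono) auto
    also have "\<dots> = ?x ^ 3" by (simp add: eval_nat_numeral)
    also have "\<dots> \<le> ?x ^ (c' - 2)" by (intro power_increasing) (auto simp: c'_def)
    finally have "n + 2 * m + (J + 2) * (2 * (h * Suc (2 * m)) + 4) ^ c + 4 \<le> 2 * ?x ^ (c' - 2)"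
      using 2 by linarith
    also have "\<dots> \<le> ?x * ?x ^ (c' - 2)" by (intro mult_right_mono) auto
    also have "\<dots> < ?x * (?x * ?x ^ (c' - 2))" using n by simp
    also have "\<dots> = ?x ^ c'"
    proof -
      have "?x ^ c' = ?x ^ Suc (Suc (c' - 2))" by (rule arg_cong[where f = "\<lambda>i. ?x ^ i"]) (simp add: c'_def)
      thus ?thesis by simp
    qed
    also have "\<dots> \<le> 2 ^ word_length c' n" by (rule word_length_bounds)
    finally show ?thesis .
  qed
  moreover have "2 \<le> c'" by (simp add: c'_def)
  ultimately show ?thesis by blast
qed

section \<open>The reduction\<close>

locale reduction =
  fixes H :: "'a graph" and k :: nat and f :: "nat \<Rightarrow> 'a" and num :: "'a \<Rightarrow> nat"
    and P :: program and c :: nat and FL :: "'a set list list"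
    and W n :: nat and G :: "nat graph" and es :: "(nat \<times> nat) list"
  assumes H: "simple_graph H" and k: "6 \<le> k" and cycle: "induced_cycle H k f"
    and num: "inj_on num (verts H)" "\<And>u. u \<in> verts H \<Longrightarrow> num u < card (verts H)"
    and c: "2 \<le> c" and solves: "solves P c (\<lambda>G. hom_count H G)"
    and FL: "distinct (map set FL)" "set ` set FL = Pow (edges H)" "\<And>Fs. Fs \<in> set FL \<Longrightarrow> distinct Fs"
    and pres: "presents es n G"
    and fit: "n + 2 * length es + (length FL + 2) *
      (2 * (card (verts H) * Suc (2 * length es)) + 4) ^ c + 4 < 2 ^ W"
begin

definition "N = 2 * length es"
definition "J = length FL"
definition "n' = card (verts H) * Suc N"
text \<open>The distance of the memory regions: an upper bound of \<open>2 ^ w\<close> that takes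
  \<open>c\<close> multiplications to compute and no logarithm.\<close>

definition "sp = (2 * n' + 4) ^ c"
definition "w = word_length c n'"
definition "M0 = mem (init_state n es)"

text \<open>The memory once the labelling loop has treated the positions from \<open>i\<close> on.
  As it counts down, cell \<open>N + v\<close> ends up with the least position of \<open>v\<close>,
  the label of \<open>v\<close>. Cells of isolated vertices are never visited, so this takes time
  \<open>O(m)\<close>.\<close>

definition labmem :: "nat \<Rightarrow> nat \<Rightarrow> nat" where
  "labmem i a = (if a < N then M0 a
     else if \<exists>p. i \<le> p \<and> p < N \<and> a = N + M0 p then (LEAST p. i \<le> p \<and> p < N \<and> a = N + M0 p) else 0)"

definition "lab p = labmem 0 (N + M0 p)"
definition "lab' p = lab (Bit_Operations.xor p (Suc 0))"

lemma labmem_Suc: "i < N \<Longrightarrow> (labmem (Suc i))(N + M0 i := i) = labmem i"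
proof
  fix a assume i: "i < N"
  show "((labmem (Suc i))(N + M0 i := i)) a = labmem i a"
  proof (cases "a = N + M0 i")
    case True
    hence "(LEAST p. i \<le> p \<and> p < N \<and> a = N + M0 p) = i" using i by (intro Least_equality) auto
    thus ?thesis using True i by (auto simp: labmem_def)
  next
    case False
    hence "(i \<le> p \<and> p < N \<and> a = N + M0 p) = (Suc i \<le> p \<and> p < N \<and> a = N + M0 p)" for p
      by (auto simp: Suc_le_eq le_less)
    hence "labmem i a = labmem (Suc i) a" by (simp only: labmem_def)
    with False show ?thesis by simp
  qed
qed

lemma labmem_N: "labmem N = M0"
  by (auto simp: labmem_def fun_eq_iff M0_def init_mem N_def)

lemma lab_props: "p < N \<Longrightarrow> lab p < N \<and> M0 (lab p) = M0 p"
proof -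
  assume p: "p < N"
  define q where "q = (LEAST q. q < N \<and> N + M0 p = N + M0 q)"
  have "q < N \<and> N + M0 p = N + M0 q" unfolding q_def by (rule LeastI[of _ p]) (use p in simp)
  moreover have "lab p = q" using p by (auto simp: lab_def labmem_def q_def)
  ultimately show ?thesis by simp
qed

lemma lab_eq_iff: "p < N \<Longrightarrow> q < N \<Longrightarrow> lab p = lab q \<longleftrightarrow> M0 p = M0 q"
  using lab_props[of p] lab_props[of q] by (metis lab_def)

lemma mate_N: "p < N \<Longrightarrow> Bit_Operations.xor p (Suc 0) < N"
  unfolding N_def by (rule mate_less)

sublocale gadget H k f num N lab lab'
  by unfold_locales (use H k cycle num lab_props mate_N in \<open>auto simp: lab'_def\<close>)

lemma simple_G: "simple_graph G" "verts G = {0..<n}" and n: "1 \<le> n"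
  using pres by (auto simp: presents_def)

lemma edges_G: "edges G = (\<lambda>(u, v). {u, v}) ` set es"
  using pres by (simp add: presents_def)

lemma M0_edge: "i < length es \<Longrightarrow> M0 (2 * i) = fst (es ! i) \<and> M0 (Suc (2 * i)) = snd (es ! i)"
  using flat_nth[of i es] by (simp add: M0_def init_mem)

lemma adj_iff: "{u, v} \<in> edges G \<longleftrightarrow> (\<exists>p<N. M0 p = u \<and> M0 (Bit_Operations.xor p (Suc 0)) = v)"
proof
  assume "{u, v} \<in> edges G"
  then obtain i where i: "i < length es" "{fst (es ! i), snd (es ! i)} = {u, v}"
    unfolding edges_G by (auto simp: in_set_conv_nth split_beta)
  hence "fst (es ! i) = u \<and> snd (es ! i) = v \<or> fst (es ! i) = v \<and> snd (es ! i) = u"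
    by (auto simp: doubleton_eq_iff)
  thus "\<exists>p<N. M0 p = u \<and> M0 (Bit_Operations.xor p (Suc 0)) = v"
  proof
    assume "fst (es ! i) = u \<and> snd (es ! i) = v"
    thus ?thesis using i(1) M0_edge[OF i(1)] mate_even[of "2 * i"]
      by (intro exI[of _ "2 * i"]) (simp add: N_def)
  next
    assume "fst (es ! i) = v \<and> snd (es ! i) = u"
    thus ?thesis using i(1) M0_edge[OF i(1)] mate_odd[of "Suc (2 * i)"]
      by (intro exI[of _ "Suc (2 * i)"]) (simp add: N_def)
  qed
next
  assume "\<exists>p<N. M0 p = u \<and> M0 (Bit_Operations.xor p (Suc 0)) = v"
  then obtain p where p: "p < N" "M0 p = u" "M0 (Bit_Operations.xor p (Suc 0)) = v" by blast
  obtain i where i: "p = 2 * i \<or> p = Suc (2 * i)" by (metis evenE oddE Suc_eq_plus1)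
  with p(1) have il: "i < length es" by (auto simp: N_def)
  hence "{fst (es ! i), snd (es ! i)} \<in> edges G"
    unfolding edges_G by (intro image_eqI[of _ _ "es ! i"]) (auto simp: split_beta)
  thus "{u, v} \<in> edges G"
    using i p M0_edge[OF il] mate_even[of "2 * i"] mate_odd[of "Suc (2 * i)"]
    by (auto simp: insert_commute)
qed

lemma M0_less: "p < N \<Longrightarrow> M0 p < n"
proof -
  assume "p < N"
  hence "{M0 p, M0 (Bit_Operations.xor p (Suc 0))} \<in> edges G" using adj_iff by blast
  thus ?thesis using simple_G by (auto simp: simple_graph_def)
qed

text \<open>A triangle is a ring of three directed edges, each starting where the previous one ends;
  labels may replace vertices by \<open>lab_eq_iff\<close>.\<close>

lemma triangle_free_iff:
  "triangle_free G \<longleftrightarrow> \<not> (\<exists>p < N. \<exists>q < N. \<exists>r < N. lab' p = lab q \<and> lab' q = lab r \<and> lab' r = lab p)"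
proof -
  have eq: "lab' p = lab q \<longleftrightarrow> M0 (Bit_Operations.xor p (Suc 0)) = M0 q" if "p < N" "q < N" for p q
    unfolding lab'_def using lab_eq_iff[OF mate_N[OF that(1)] that(2)] .
  have "(\<exists>u v x. {u, v} \<in> edges G \<and> {v, x} \<in> edges G \<and> {u, x} \<in> edges G) \<longleftrightarrow>
    (\<exists>p < N. \<exists>q < N. \<exists>r < N. lab' p = lab q \<and> lab' q = lab r \<and> lab' r = lab p)"
  proof
    assume "\<exists>u v x. {u, v} \<in> edges G \<and> {v, x} \<in> edges G \<and> {u, x} \<in> edges G"
    then obtain u v x where "{u, v} \<in> edges G" "{v, x} \<in> edges G" "{x, u} \<in> edges G"
      by (auto simp: insert_commute)
    then obtain p q r where "p < N" "M0 p = u" "M0 (Bit_Operations.xor p (Suc 0)) = v"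
      "q < N" "M0 q = v" "M0 (Bit_Operations.xor q (Suc 0)) = x"
      "r < N" "M0 r = x" "M0 (Bit_Operations.xor r (Suc 0)) = u"
      unfolding adj_iff by blast
    hence "p < N" "q < N" "r < N" "lab' p = lab q" "lab' q = lab r" "lab' r = lab p"
      by (simp_all add: eq)
    thus "\<exists>p < N. \<exists>q < N. \<exists>r < N. lab' p = lab q \<and> lab' q = lab r \<and> lab' r = lab p"
      by blast
  next
    assume "\<exists>p < N. \<exists>q < N. \<exists>r < N. lab' p = lab q \<and> lab' q = lab r \<and> lab' r = lab p"
    then obtain p q r where pqr: "p < N" "q < N" "r < N" and
      e: "M0 (Bit_Operations.xor p (Suc 0)) = M0 q" "M0 (Bit_Operations.xor q (Suc 0)) = M0 r"
      "M0 (Bit_Operations.xor r (Suc 0)) = M0 p"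
      by (auto simp: eq)
    hence "{M0 p, M0 q} \<in> edges G" "{M0 q, M0 r} \<in> edges G" "{M0 r, M0 p} \<in> edges G"
      unfolding adj_iff by blast+
    moreover from this(3) have "{M0 p, M0 r} \<in> edges G" by (simp add: insert_commute)
    ultimately show "\<exists>u v x. {u, v} \<in> edges G \<and> {v, x} \<in> edges G \<and> {u, x} \<in> edges G"
      by blast
  qed
  thus ?thesis unfolding triangle_free_def by simp
qed

lemma fit': "n + N + (J + 2) * sp + 4 < 2 ^ W"
  using fit by (simp only: N_def J_def sp_def n'_def)

lemma sp_fit: "n + N + J * sp + 2 * sp + 4 < 2 ^ W"
  using fit' by (simp add: algebra_simps)

lemma verts_ne: "verts H \<noteq> {}"
proof -
  have "{f 0, f 1} \<in> edges H" using f_edge[of 0 1] k by simp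
  thus ?thesis using edge_verts by blast
qed

lemma card_E_N: "card (edges H) * N \<le> n' * n'"
proof -
  have "card (edges H) * N \<le> (card (verts H) * card (verts H)) * (Suc N * Suc N)"
    by (intro mult_mono card_edges_le[OF H]) auto
  thus ?thesis by (simp add: n'_def mult_ac del: mult_Suc mult_Suc_right)
qed

lemma sq_le_sp: "(2 * n' + 4) * (2 * n' + 4) \<le> sp"
proof -
  have "(2 * n' + 4) ^ 2 \<le> sp" unfolding sp_def using c by (intro power_increasing) auto
  thus ?thesis by (simp add: power2_eq_square)
qed

text \<open>A region has room for the edge list of a gadget and for all addresses of the simulated
  machine. The edge list fits because \<open>2 \<le> c\<close> makes \<open>sp\<close> at least
  quadratic in \<open>n'\<close>.\<close>

lemma sp_bounds: "2 * n' + 4 \<le> sp" "2 * card (edges H) * N \<le> sp" "2 ^ w \<le> sp"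
proof -
  show "2 * n' + 4 \<le> sp" by (rule order_trans[OF le_square sq_le_sp])
  have "2 * card (edges H) * N \<le> 2 * (n' * n')" using card_E_N by simp
  also have "\<dots> \<le> (2 * n' + 4) * (2 * n' + 4)" by (simp add: algebra_simps)
  finally show "2 * card (edges H) * N \<le> sp" using sq_le_sp by (rule order_trans)
  show "2 ^ w \<le> sp" unfolding w_def sp_def by (rule word_length_bounds)
qed

lemma w_bounds: "n' < 2 ^ w" "card (edges H) * N < 2 ^ w" "w \<le> W"
proof -
  have "(n' + 2) ^ 2 \<le> (n' + 2) ^ c" using c by (intro power_increasing) auto
  also have "\<dots> \<le> 2 ^ w" unfolding w_def by (rule word_length_bounds)
  finally have *: "(n' + 2) * (n' + 2) \<le> 2 ^ w" by (simp add: power2_eq_square)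
  thus "n' < 2 ^ w" "card (edges H) * N < 2 ^ w" using card_E_N by (auto simp: algebra_simps)
  have "(2 :: nat) ^ w \<le> 2 ^ W" using sp_bounds(3) sp_fit by linarith
  thus "w \<le> W" by (rule power_le_imp_le_exp[rotated]) simp
qed

lemma FL_edges: "Fs \<in> set FL \<Longrightarrow> set Fs \<subseteq> edges H"
  using FL(2) by blast

lemma length_Fs: "Fs \<in> set FL \<Longrightarrow> length Fs \<le> card (edges H)"
  using distinct_card[OF FL(3)] card_mono[OF finite_edges FL_edges] by metis

definition "gadget_edges Fs = concat (map (\<lambda>p. map (\<lambda>e. gedge e p) Fs) (rev [0..<N]))"

lemma length_gadget_edges: "length (gadget_edges Fs) = length Fs * N"
  unfolding gadget_edges_def by (subst length_concat_const[of _ "length Fs"]) auto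

lemma presents_gadget_edges:
  "Fs \<in> set FL \<Longrightarrow> presents (gadget_edges Fs) n' (gadget_graph (set Fs))"
  unfolding gadget_edges_def n'_def
  by (rule presents_gadget) (use FL(3) FL_edges verts_ne in auto)

definition "hcount j = hom_count H (gadget_graph (set (FL ! j)))"

definition "sim_init j = init_state n' (gadget_edges (FL ! j))"

lemma sim_outputs: "j < J \<Longrightarrow> outputs w P (sim_init j) (hcount j)"
  using solves presents_gadget_edges[of "FL ! j"]
  unfolding solves_def sim_init_def hcount_def w_def J_def by simp

lemma sim_reg: "j < J \<Longrightarrow> reg (sim_init j) r < 2 ^ w"
proof -
  assume "j < J"
  hence "length (FL ! j) * N \<le> card (edges H) * N"
    by (intro mult_right_mono length_Fs) (auto simp: J_def)
  hence "length (FL ! j) * N < 2 ^ w" using w_bounds(2) by linarith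
  thus ?thesis using w_bounds(1) by (simp add: sim_init_def init_state_def length_gadget_edges)
qed

lemma hcount_less: "j < J \<Longrightarrow> hcount j < 2 ^ w"
  by (rule outputs_bound[OF sim_outputs]) (auto intro: sim_reg)

definition partial_sum :: "bool \<Rightarrow> nat \<Rightarrow> nat" where
  "partial_sum b j = (\<Sum>i<j. if even (length (FL ! i)) = b then hcount i else 0)"

lemma partial_sum_le: "j \<le> J \<Longrightarrow> partial_sum b j \<le> j * sp"
proof -
  assume j: "j \<le> J"
  have "partial_sum b j \<le> of_nat (card {..<j}) * sp"
    unfolding partial_sum_def
  proof (rule sum_bounded_above)
    fix i assume "i \<in> {..<j}"
    hence "hcount i < 2 ^ w" using j by (intro hcount_less) auto
    thus "(if even (length (FL ! i)) = b then hcount i else 0) \<le> sp" using sp_bounds(3) by auto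
  qed
  thus ?thesis by simp
qed

text \<open>The banks of later rounds and all memory from the next region on are still 0, as
  \<open>init_state\<close> requires; no round has to clean up. The \<open>n\<close> in register 7
  affects addresses only, not the running time.\<close>

definition invar :: "nat \<Rightarrow> asrt" where
  "invar j R M \<longleftrightarrow> R 2 = 0 \<and> R 3 = 1 \<and> R 4 = N \<and> R 5 = Suc N \<and> R 7 = N + n + j * sp \<and>
     R 12 = partial_sum True j \<and> R 13 = partial_sum False j \<and> R 14 = sp \<and> R 15 = n' \<and>
     (\<forall>i r. j \<le> i \<longrightarrow> i < J \<longrightarrow> R (bank J i r) = 0) \<and>
     (\<forall>a < N + n. M a = labmem 0 a) \<and> (\<forall>a \<ge> R 7. M a = 0)"

definition generate :: "'a set list \<Rightarrow> nat \<Rightarrow> program" where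
  "generate Fs = ((\<lambda>_. [Op Add 8 7 2, Op Add 9 4 2]) ;;
     while 2 9 (\<lambda>_. Op Sub 9 9 3 # concat (map edge_code Fs)))"

definition sum_reg :: "'a set list \<Rightarrow> nat" where
  "sum_reg Fs = (if even (length Fs) then 12 else 13)"

definition round_code :: "nat \<Rightarrow> nat \<Rightarrow> program" where
  "round_code j = (let Fs = FL ! j in
     generate Fs ;;
     (\<lambda>_. [Op Add (bank (length FL) j 0) 15 2, SetConst 10 (length Fs), Op Mul (bank (length FL) j 1) 10 4, SetConst 6 0]) ;;
     sim (bank (length FL) j) P ;;
     (\<lambda>_. [Op Add (sum_reg Fs) (sum_reg Fs) (bank (length FL) j 0), Op Add 7 7 14]))"

definition round_time :: "nat \<Rightarrow> ennreal" where
  "round_time j = (2 + (of_nat N * (of_nat (length (Op Sub 9 9 3 # concat (map edge_code (FL ! j)))) + 2) + 1))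
     + (4 + (3 * expected_time w P (sim_init j) + 2))"

lemma triple_round:
  assumes j: "j < J"
  shows "triple W (invar j) (round_code j) (round_time j) (invar (Suc j))"
proof (rule triple_fix)
  fix R0 M1 assume I: "invar j R0 M1"
  let ?Fs = "FL ! j"
  let ?b = "bank J j"
  let ?off = "N + n + j * sp"
  let ?xs = "flat (gadget_edges ?Fs)"
  have Fs: "?Fs \<in> set FL" using j by (simp add: J_def)
  have jsp: "j * sp + sp \<le> J * sp" using j mult_right_mono[of "Suc j" J sp] by simp
  have off_fit: "?off + sp + sp < 2 ^ W" using sp_fit jsp by linarith
  have lenF: "2 * length ?Fs * N \<le> sp"
  proof -
    have "2 * length ?Fs * N \<le> 2 * card (edges H) * N"
      using length_Fs[OF Fs] by (intro mult_right_mono mult_left_mono) auto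
    thus ?thesis using sp_bounds(2) by linarith
  qed
  have J0: "J \<noteq> 0" using j by simp
  note I' = I[unfolded invar_def]
  define Q1 where "Q1 R M \<longleftrightarrow> (\<forall>r. r \<notin> {8, 9, 10, 11} \<longrightarrow> R r = R0 r) \<and> M = memw M1 ?off ?xs" for R M
  define Q2 where "Q2 R M \<longleftrightarrow> (\<forall>r. r \<notin> {6, 8, 9, 10, 11, ?b 0, ?b 1} \<longrightarrow> R r = R0 r) \<and> R 6 = 0 \<and>
    R (?b 0) = n' \<and> R (?b 1) = length ?Fs * N \<and> M = memw M1 ?off ?xs" for R M
  \<comment> \<open>The simulation may leave anything in its region and in the rest of its bank;
    \<open>Q3\<close> keeps what later rounds rely on.\<close>
  define Q3 where "Q3 R M \<longleftrightarrow> R (?b 0) = hcount j \<and>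
    (\<forall>r. r \<notin> {6, 8, 9, 10, 11} \<longrightarrow> r \<notin> range ?b \<longrightarrow> R r = R0 r) \<and>
    (\<forall>a < ?off. M a = M1 a) \<and> (\<forall>a \<ge> ?off + sp. M a = 0)" for R M
  have T1: "triple W (\<lambda>R M. R = R0 \<and> M = M1) (generate ?Fs)
    (2 + (of_nat N * (of_nat (length (Op Sub 9 9 3 # concat (map edge_code ?Fs))) + 2) + 1)) Q1"
    unfolding generate_def Q1_def gadget_edges_def
  proof (rule triple_generate[where n = n])
    show "card (verts H) * Suc N < 2 ^ W"
      using off_fit sp_bounds(1) unfolding n'_def by linarith
    show "?off + 2 * length ?Fs * N < 2 ^ W" using off_fit lenF by linarith
    show "lab' p = M1 (N + M1 (Bit_Operations.xor p (Suc 0)))" if "p < N" for p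
      using I' that mate_N[OF that] M0_less[OF mate_N[OF that]] by (simp add: lab'_def lab_def labmem_def[of 0 "Bit_Operations.xor p (Suc 0)"])
    show "lab p = M1 (N + M1 p)" if "p < N" for p
      using I' that M0_less[OF that] by (simp add: lab_def labmem_def[of 0 p])
    show "M1 a < n" if "a < N" for a
      using I' that M0_less[OF that] by (simp add: labmem_def)
  qed (use I' mate_N FL_edges[OF Fs] in auto)
  have T2: "triple W Q1 (\<lambda>_. [Op Add (?b 0) 15 2, SetConst 10 (length ?Fs), Op Mul (?b 1) 10 4, SetConst 6 0])
    (of_nat (length [Op Add (?b 0) 15 2, SetConst 10 (length ?Fs), Op Mul (?b 1) 10 4, SetConst 6 0])) Q2"
  proof (rule triple_straight)
    fix R M assume Q: "Q1 R M"
    have "n' < 2 ^ W" "length ?Fs * N < 2 ^ W" "length ?Fs < 2 ^ W"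
    proof -
      show "n' < 2 ^ W" "length ?Fs * N < 2 ^ W" using off_fit sp_bounds(1) lenF by linarith+
      have "card (edges H) \<le> card (verts H) * card (verts H)" by (rule card_edges_le[OF H])
      also have "\<dots> \<le> n' * n'" unfolding n'_def by (intro mult_mono) auto
      finally have "length ?Fs \<le> n' * n'" using length_Fs[OF Fs] by linarith
      moreover have "n' * n' \<le> (2 * n' + 4) * (2 * n' + 4)" by (intro mult_mono) auto
      ultimately show "length ?Fs < 2 ^ W" using sq_le_sp off_fit by linarith
    qed
    thus "wp W [Op Add (?b 0) 15 2, SetConst 10 (length ?Fs), Op Mul (?b 1) 10 4, SetConst 6 0] Q2 R M"
      using Q I' J0 unfolding Q1_def Q2_def by (simp add: bank_eq[OF j j])
  qed
  have T3: "triple W Q2 (sim ?b P) (3 * expected_time w P (sim_init j)) Q3"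
  proof (rule triple_fix)
    fix R2 M2 assume Q: "Q2 R2 M2"
    have reg: "R2 (?b r) = reg (sim_init j) r" for r
    proof -
      consider "r = 0" | "r = 1" | "r > 1" by linarith
      thus ?thesis
      proof cases
        case 3
        hence "R2 (?b r) = R0 (?b r)" using Q unfolding Q2_def by (simp add: bank_eq[OF j j])
        also have "\<dots> = 0" using I' j by simp
        finally show ?thesis using 3 by (simp add: sim_init_def init_state_def)
      qed (use Q in \<open>auto simp: Q2_def sim_init_def init_state_def length_gadget_edges\<close>)
    qed
    \<comment> \<open>Behind the edge list, the region still holds the zeros granted by the
      invariant.\<close>
    have mem: "M2 (?off + a) = mem (sim_init j) a" for a
      using Q I' by (simp add: Q2_def sim_init_def init_mem memw_def)
    have T: "triple W (\<lambda>R M. R = R2 \<and> M = M2) (sim ?b P) (3 * expected_time w P (sim_init j))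
      (\<lambda>R M. R (?b 0) = hcount j \<and> (\<forall>r. r \<notin> range ?b \<longrightarrow> R r = R2 r) \<and>
        (\<forall>a. a < ?off \<or> ?off + 2 ^ w \<le> a \<longrightarrow> M a = M2 a))"
    proof (rule triple_sim)
      show "outputs w P (sim_init j) (hcount j)" by (rule sim_outputs[OF j])
      show "?off + 2 ^ w \<le> 2 ^ W" using off_fit sp_bounds(3) by linarith
      show "inj ?b" by (rule injI) (simp add: bank_eq[OF j j])
      show "6 \<notin> range ?b" "7 \<notin> range ?b" by auto
      show "R2 7 = ?off" using Q I' by (simp add: Q2_def)
    qed (use Q reg mem w_bounds sim_reg[OF j] in \<open>auto simp: Q2_def sim_init_def init_state_def\<close>)
    have Q: "Q3 R M" if post: "R (?b 0) = hcount j \<and> (\<forall>r. r \<notin> range ?b \<longrightarrow> R r = R2 r) \<and>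
        (\<forall>a. a < ?off \<or> ?off + 2 ^ w \<le> a \<longrightarrow> M a = M2 a)" for R M
    proof -
      have "M a = 0" if "a \<ge> ?off + sp" for a
      proof -
        have "M a = M2 a" using post that sp_bounds(3) by auto
        also have "\<dots> = M1 a" using Q that lenF by (simp add: Q2_def memw_def length_gadget_edges)
        also have "\<dots> = 0" using I' that by simp
        finally show ?thesis .
      qed
      moreover have "M a = M1 a" if "a < ?off" for a
        using post that Q by (simp add: Q2_def memw_def)
      moreover have "R r = R0 r" if "r \<notin> {6, 8, 9, 10, 11}" "r \<notin> range ?b" for r
      proof -
        have "r \<noteq> ?b 0" "r \<noteq> ?b 1" using that(2) by auto
        hence "R2 r = R0 r" using Q that(1) unfolding Q2_def by blast
        thus ?thesis using post that(2) by simp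
      qed
      ultimately show ?thesis using post unfolding Q3_def by blast
    qed
    show "triple W (\<lambda>R M. R = R2 \<and> M = M2) (sim ?b P) (3 * expected_time w P (sim_init j)) Q3"
      by (rule triple_conseq[OF T _ Q]) auto
  qed
  have T4: "triple W Q3 (\<lambda>_. [Op Add (sum_reg ?Fs) (sum_reg ?Fs) (?b 0), Op Add 7 7 14])
    (of_nat (length [Op Add (sum_reg ?Fs) (sum_reg ?Fs) (?b 0), Op Add 7 7 14])) (invar (Suc j))"
  proof (rule triple_straight)
    fix R M assume Q: "Q3 R M"
    have out: "i \<notin> range ?b" if "i < 16" for i using that by (auto simp: bank_def)
    have other: "bank J i r \<notin> range ?b" if "j < i" "i < J" for i r
      using that j by (auto simp: bank_eq)
    have R: "R i = R0 i" if "i < 16" "i \<notin> {6, 8, 9, 10, 11}" for i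
      using Q out[OF that(1)] that(2) unfolding Q3_def by blast
    have banks: "R (bank J i r) = 0" if "Suc j \<le> i" "i < J" for i r
      using Q I' other[of i r] that by (simp add: Q3_def)
    have cnt: "hcount j \<le> sp" using hcount_less[OF j] sp_bounds(3) by linarith
    have accs: "partial_sum b j + hcount j < 2 ^ W" for b
      using partial_sum_le[of j b] j cnt jsp sp_fit by linarith
    show "wp W [Op Add (sum_reg ?Fs) (sum_reg ?Fs) (?b 0), Op Add 7 7 14] (invar (Suc j)) R M"
      using Q I' R accs[of True] accs[of False] banks off_fit unfolding Q3_def invar_def
      by (auto simp: sum_reg_def partial_sum_def)
  qed
  from triple_seq[OF T1 triple_seq[OF T2 triple_seq[OF T3 T4]]]
  show "triple W (\<lambda>R M. R = R0 \<and> M = M1) (round_code j) (round_time j) (invar (Suc j))"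
    unfolding round_code_def Let_def J_def[symmetric] round_time_def
    by (rule triple_conseq) (simp_all add: add_ac)
qed

end

lemma wp_replicate_Mul:
  assumes "\<And>i. i \<le> c \<Longrightarrow> R 14 * R 10 ^ i < 2 ^ W" "Post (R(14 := R 14 * R 10 ^ c)) M"
  shows "wp W (replicate c (Op Mul 14 14 10)) Post R M"
  using assms
proof (induction c arbitrary: R)
  case 0
  thus ?case by simp
next
  case (Suc c)
  have "wp W (replicate c (Op Mul 14 14 10)) Post (R(14 := R 14 * R 10)) M"
  proof (rule Suc.IH)
    show "(R(14 := R 14 * R 10)) 14 * (R(14 := R 14 * R 10)) 10 ^ i < 2 ^ W" if "i \<le> c" for i
      using Suc.prems(1)[of "Suc i"] that by (simp add: mult.assoc)
    have "(R(14 := R 14 * R 10))(14 := (R(14 := R 14 * R 10)) 14 * (R(14 := R 14 * R 10)) 10 ^ c) =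
        R(14 := R 14 * R 10 ^ Suc c)"
      by (rule ext) (simp add: mult.assoc)
    with Suc.prems(2) show "Post ((R(14 := R 14 * R 10))(14 := (R(14 := R 14 * R 10)) 14 *
        (R(14 := R 14 * R 10)) 10 ^ c)) M" by (simp only:)
  qed
  thus ?case using Suc.prems(1)[of 1] by simp
qed

section \<open>The whole program and its running time\<close>

context reduction begin

definition init_code :: "nat \<Rightarrow> program" where
  "init_code =
     ((\<lambda>_. [SetConst 2 0, SetConst 3 1, Op Add 4 1 1, Op Add 5 4 3, Op Add 9 4 2]) ;;
      while 2 9 (\<lambda>_. [Op Sub 9 9 3, Load 10 9, Op Add 10 10 4, Store 10 9]) ;;
      (\<lambda>_. [SetConst 10 (card (verts H)), Op Mul 15 10 5, SetConst 10 4, Op Add 10 10 15,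
        Op Add 10 10 15, SetConst 14 1] @ replicate c (Op Mul 14 14 10) @ [Op Add 7 4 0]))"

text \<open>Subtraction is truncated, so the two differences add up to the distance between the
  sums. Subtracting it from 1 leaves 1 if the sums agree and 0 otherwise.\<close>

definition program_code :: "nat \<Rightarrow> program" where
  "program_code =
     (init_code ;;
      seqs (map round_code [0..<length FL]) ;;
      (\<lambda>_. [Op Sub 10 12 13, Op Sub 11 13 12, Op Add 10 10 11, Op Sub 0 3 10]))"

lemma small_fit: "n < 2 ^ W" "N < 2 ^ W" "Suc N < 2 ^ W" "N + n < 2 ^ W" "(4 :: nat) < 2 ^ W" "(1 :: nat) < 2 ^ W"
  "2 * n' + 4 < 2 ^ W" "sp < 2 ^ W"
  using sp_fit sp_bounds(1) by linarith+

text \<open>The bound involves \<open>N\<close> but not \<open>n\<close>, although the label table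
  is spread over \<open>n\<close> cells.\<close>

lemma triple_init:
  "triple W (\<lambda>R M. R = reg (init_state n es) \<and> M = M0) init_code
    (of_nat (13 + 6 * N + c)) (invar 0)"
proof -
  define Inv :: "nat \<Rightarrow> asrt" where "Inv i R M \<longleftrightarrow> R 0 = n \<and> R 2 = 0 \<and> R 3 = 1 \<and> R 4 = N \<and> R 5 = Suc N \<and>
    (\<forall>r\<ge>12. R r = 0) \<and> i \<le> N \<and> R 9 = i \<and> M = labmem i" for i R M
  let ?c1 = "[SetConst 2 0, SetConst 3 1, Op Add 4 1 1, Op Add 5 4 3, Op Add 9 4 2]"
  let ?c2 = "[Op Sub 9 9 3, Load 10 9, Op Add 10 10 4, Store 10 9]"
  let ?c3 = "[SetConst 10 (card (verts H)), Op Mul 15 10 5, SetConst 10 4, Op Add 10 10 15,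
    Op Add 10 10 15, SetConst 14 1] @ replicate c (Op Mul 14 14 10) @ [Op Add 7 4 0]"
  have 1: "triple W (\<lambda>R M. R = reg (init_state n es) \<and> M = M0) (\<lambda>_. ?c1) (of_nat (length ?c1)) (Inv N)"
    by (rule triple_straight)
      (use small_fit in \<open>auto simp: Inv_def init_state_def labmem_N[unfolded N_def] N_def\<close>)
  have body: "triple W (Inv (Suc i)) (\<lambda>_. ?c2) (of_nat (length ?c2)) (Inv i)" if i: "i < N" for i
  proof (rule triple_straight)
    fix R M assume I: "Inv (Suc i) R M"
    have m: "labmem (Suc i) i = M0 i" using i by (simp add: labmem_def)
    have "M0 i < n" by (rule M0_less[OF i])
    hence "M0 i < 2 ^ W" "M0 i + N < 2 ^ W" using small_fit by linarith+
    thus "wp W ?c2 (Inv i) R M"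
      using I i small_fit m labmem_Suc[OF i] by (simp add: Inv_def add.commute)
  qed
  have 2: "triple W (Inv N) (while 2 9 (\<lambda>_. ?c2)) (of_nat N * (of_nat (length ?c2) + 2) + 1) (Inv 0)"
  proof (rule triple_while)
    fix i assume "i < N"
    thus "triple W (Inv (Suc i)) (\<lambda>_. ?c2) (of_nat (length ?c2)) (Inv i)" by (rule body)
  qed (auto simp: Inv_def)
  have 3: "triple W (Inv 0) (\<lambda>_. ?c3) (of_nat (length ?c3)) (invar 0)"
  proof (rule triple_straight)
    fix R M assume I: "Inv 0 R M"
    have h: "card (verts H) \<le> n'" by (simp add: n'_def)
    have labmem_0: "labmem 0 a = 0" if "N + n \<le> a" for a
      using that M0_less by (force simp: labmem_def)
    let ?R = "R(10 := 2 * n' + 4, 15 := n', 14 := 1)"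
    have wp_R: "wp W (replicate c (Op Mul 14 14 10) @ [Op Add 7 4 0]) (invar 0) ?R M"
      unfolding wp_append
    proof (rule wp_replicate_Mul)
      fix i assume i: "i \<le> c"
      have "(2 * n' + 4) ^ i \<le> sp" unfolding sp_def by (rule power_increasing[OF i]) simp
      thus "?R 14 * ?R 10 ^ i < 2 ^ W" using small_fit(8) by simp
    next
      show "wp W [Op Add 7 4 0] (invar 0) (?R(14 := ?R 14 * ?R 10 ^ c)) M"
        using I small_fit labmem_0 by (auto simp: Inv_def invar_def sp_def partial_sum_def bank_def)
    qed
    have post: "wp W (replicate c (Op Mul 14 14 10) @ [Op Add 7 4 0]) (invar 0) R' M"
      if "\<And>r. R' r = ?R r" for R'
    proof -
      have "R' = ?R" by (rule ext) (rule that)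
      with wp_R show ?thesis by (simp only:)
    qed
    have R5: "R 5 = Suc N" using I by (simp add: Inv_def)
    have hN: "card (verts H) * Suc N = n'" by (simp add: n'_def)
    show "wp W ?c3 (invar 0) R M"
      unfolding wp_append[of W "[SetConst 10 (card (verts H)), Op Mul 15 10 5, SetConst 10 4, Op Add 10 10 15,
        Op Add 10 10 15, SetConst 14 1]"]
      using R5 small_fit h by (auto simp: hN simp del: mult_Suc_right intro!: post)
  qed
  have time: "5 + (x * 6 + 8) = 13 + 6 * x" for x :: ennreal
  proof -
    have "5 + (x * 6 + 8) = (5 + 8) + 6 * x" by (simp only: add_ac mult_ac)
    thus ?thesis by simp
  qed
  from triple_seq[OF 1 triple_seq[OF 2 3]] show ?thesis
    unfolding init_code_def
    by (rule triple_conseq) (auto simp: distrib_left time)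
qed

lemma partial_sum_eq:
  "partial_sum True J = (\<Sum>F | F \<subseteq> edges H \<and> even (card F). hom_count H (gadget_graph F))"
  "partial_sum False J = (\<Sum>F | F \<subseteq> edges H \<and> odd (card F). hom_count H (gadget_graph F))"
proof -
  have bij: "bij_betw (\<lambda>i. set (FL ! i)) {..<J} (Pow (edges H))"
    using FL(2) bij_betw_nth[OF FL(1), of "{..<J}" "Pow (edges H)"]
    by (subst bij_betw_cong[of _ _ "(!) (map set FL)"]) (simp_all add: J_def)
  have *: "partial_sum b J = (\<Sum>F\<in>Pow (edges H). if even (card F) = b then hom_count H (gadget_graph F) else 0)" for b
    unfolding partial_sum_def sum.reindex_bij_betw[OF bij, symmetric]
    by (intro sum.cong) (auto simp: hcount_def J_def distinct_card FL(3))
  have fin: "finite (Pow (edges H))" using finite_edges by simp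
  show "partial_sum True J = (\<Sum>F | F \<subseteq> edges H \<and> even (card F). hom_count H (gadget_graph F))"
    unfolding * using sum.inter_filter[OF fin, of "\<lambda>F. hom_count H (gadget_graph F)" "\<lambda>F. even (card F)"]
    by (simp add: Pow_def)
  show "partial_sum False J = (\<Sum>F | F \<subseteq> edges H \<and> odd (card F). hom_count H (gadget_graph F))"
    unfolding * using sum.inter_filter[OF fin, of "\<lambda>F. hom_count H (gadget_graph F)" "\<lambda>F. odd (card F)"]
    by (simp add: Pow_def)
qed

lemma runs_to_program:
  "runs_to W (program_code 0) (init_state n es)
    (of_nat (17 + 6 * N + c) + (\<Sum>j<J. round_time j)) (if triangle_free G then 1 else 0)"
proof -
  have r: "triple W (invar 0) (seqs (map round_code [0..<length FL])) (\<Sum>j<J. round_time j) (invar J)"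
    using triple_seqs[of "map round_code [0..<length FL]" W invar round_time] triple_round
    by (simp add: J_def)
  let ?c = "[Op Sub 10 12 13, Op Sub 11 13 12, Op Add 10 10 11, Op Sub 0 3 10]"
  have e: "triple W (invar J) (\<lambda>_. ?c) (of_nat (length ?c)) (\<lambda>R M. R 0 = (if triangle_free G then 1 else 0))"
  proof (rule triple_straight)
    fix R M assume I: "invar J R M"
    have tf: "triangle_free G \<longleftrightarrow> partial_sum True J = partial_sum False J"
      unfolding triangle_free_iff partial_sum_eq inclusion_exclusion_homs homs_iff_triangle ..
    have b: "partial_sum b J < 2 ^ W" for b
      using partial_sum_le[of J b] sp_fit by linarith
    show "wp W ?c (\<lambda>R M. R 0 = (if triangle_free G then 1 else 0)) R M"
      using I b[of True] b[of False] small_fit unfolding invar_def tf by (auto intro: le_less_trans)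
  qed
  have "triple W (\<lambda>R M. R = reg (init_state n es) \<and> M = M0) program_code
    (of_nat (17 + 6 * N + c) + (\<Sum>j<J. round_time j)) (\<lambda>R M. R 0 = (if triangle_free G then 1 else 0))"
    unfolding program_code_def
    by (rule triple_conseq[OF triple_seq[OF triple_init triple_seq[OF r e]]])
      (simp_all add: add_ac)
  from triple_runs_to[OF this, of "reg (init_state n es)" M0]
  show ?thesis by (simp add: M0_def init_state_def)
qed

text \<open>Initialisation and final test take \<open>17 + 12 m + c\<close> steps, where
  \<open>29 = 17 + 12\<close>. A round has 9 steps of overhead, \<open>2 m\<close> passes of at most
  \<open>14 |E| + 3\<close> steps, and 3 steps per simulated step on a gadget with at most
  \<open>2 |V| (m + 1)\<close> vertices.\<close>

definition time_const :: "real \<Rightarrow> real" where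
  "time_const K = 29 + real c +
     real J * (9 + 2 * (14 * real (card (edges H)) + 3) + 6 * K * real (card (verts H)))"

lemma expected_time_program:
  assumes fd: "\<And>n G es. presents es n G \<Longrightarrow>
      expected_time (word_length c n) P (init_state n es) \<le> ennreal (fd (degeneracy G) * real n)"
    and K: "\<And>d. d \<le> 2 * card (edges H) \<Longrightarrow> fd d \<le> K" "0 \<le> K"
  shows "expected_time W (program_code 0) (init_state n es) \<le> ennreal (time_const K * (real (length es) + 1))"
proof -
  let ?m = "real (length es)" and ?h = "real (card (verts H))"
  let ?L = "14 * real (card (edges H)) + 3"
  have NL: "real N = 2 * ?m" by (simp add: N_def)
  have n': "real n' = ?h * (2 * ?m + 1)" by (simp add: n'_def N_def algebra_simps)
  have round: "round_time j \<le> ennreal (9 + 2 * ?m * ?L + 3 * (K * real n'))" if j: "j < J" for j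
  proof -
    have Fs: "FL ! j \<in> set FL" using j by (simp add: J_def)
    have "expected_time w P (sim_init j) \<le> ennreal (fd (degeneracy (gadget_graph (set (FL ! j)))) * real n')"
      unfolding w_def sim_init_def by (rule fd[OF presents_gadget_edges[OF Fs]])
    also have "\<dots> \<le> ennreal (K * real n')"
      by (intro ennreal_leI mult_right_mono K degeneracy_gadget FL_edges[OF Fs]) simp
    finally have e: "expected_time w P (sim_init j) \<le> ennreal (K * real n')" .
    let ?len = "length (Op Sub 9 9 3 # concat (map edge_code (FL ! j)))"
    have "length (concat (map edge_code Fs)) \<le> 14 * length Fs" for Fs
    proof (induction Fs)
      case (Cons e Fs)
      obtain a b \<beta> where "tr e = (a, b, \<beta>)" by (metis prod_cases3)
      hence "length (edge_code e) \<le> 14" using length_emit by (simp add: edge_code_def)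
      with Cons show ?case by simp
    qed simp
    from this[of "FL ! j"] have "?len + 2 \<le> 14 * card (edges H) + 3"
      using length_Fs[OF Fs] by simp
    hence "N * (?len + 2) \<le> N * (14 * card (edges H) + 3)" by (rule mult_left_mono) simp
    hence "real (N * (?len + 2)) \<le> real (N * (14 * card (edges H) + 3))" by (simp only: of_nat_le_iff)
    hence len: "real (N * (?len + 2)) \<le> 2 * ?m * ?L" by (simp add: NL)
    have sum: "(2 + (x + 1)) + (4 + (y + 2)) = 9 + x + y" for x y :: ennreal by (simp add: add_ac)
    have "round_time j = (2 + (of_nat (N * (?len + 2)) + 1)) + (4 + (3 * expected_time w P (sim_init j) + 2))"
      unfolding round_time_def by (simp only: of_nat_mult of_nat_add of_nat_numeral)
    also have "\<dots> = of_nat (9 + N * (?len + 2)) + 3 * expected_time w P (sim_init j)"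
      unfolding sum by (simp only: of_nat_add of_nat_numeral)
    also have "\<dots> \<le> ennreal (9 + 2 * ?m * ?L) + 3 * ennreal (K * real n')"
    proof (intro add_mono mult_left_mono e)
      have "real (9 + N * (?len + 2)) \<le> 9 + 2 * ?m * ?L" using len by (simp only: of_nat_add of_nat_numeral)
      thus "of_nat (9 + N * (?len + 2)) \<le> ennreal (9 + 2 * ?m * ?L)"
        unfolding ennreal_of_nat_eq_real_of_nat by (rule ennreal_leI)
    qed simp
    also have "\<dots> = ennreal (9 + 2 * ?m * ?L) + ennreal (3 * (K * real n'))"
      using K(2) by (simp add: ennreal_mult'[of 3])
    also have "\<dots> = ennreal (9 + 2 * ?m * ?L + 3 * (K * real n'))"
      using K(2) by (intro ennreal_plus[symmetric]) auto
    finally show ?thesis .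
  qed
  have "expected_time W (program_code 0) (init_state n es) \<le> of_nat (17 + 6 * N + c) + (\<Sum>j<J. round_time j)"
    using runs_to_program unfolding runs_to_def by blast
  also have "\<dots> \<le> of_nat (17 + 6 * N + c) + (\<Sum>j<J. ennreal (9 + 2 * ?m * ?L + 3 * (K * real n')))"
    by (intro add_left_mono sum_mono round) auto
  also have "\<dots> = ennreal (17 + 12 * ?m + c) + ennreal (real J * (9 + 2 * ?m * ?L + 3 * (K * real n')))"
    by (simp add: ennreal_of_nat_eq_real_of_nat NL ennreal_mult'[symmetric])
  also have "\<dots> = ennreal (17 + 12 * ?m + c + real J * (9 + 2 * ?m * ?L + 3 * (K * real n')))"
    using K(2) by (intro ennreal_plus[symmetric]) auto
  also have "\<dots> \<le> ennreal (time_const K * (?m + 1))"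
  proof (rule ennreal_leI)
    have "9 + 2 * ?m * ?L + 3 * (K * real n') \<le> (9 + 2 * ?L + 6 * K * ?h) * (?m + 1)"
      using K(2) by (simp add: n' algebra_simps)
    hence "real J * (9 + 2 * ?m * ?L + 3 * (K * real n')) \<le> real J * ((9 + 2 * ?L + 6 * K * ?h) * (?m + 1))"
      by (rule mult_left_mono) simp
    moreover have "17 + 12 * ?m + c \<le> (29 + real c) * (?m + 1)" by (simp add: algebra_simps)
    ultimately show "17 + 12 * ?m + c + real J * (9 + 2 * ?m * ?L + 3 * (K * real n')) \<le> time_const K * (?m + 1)"
      unfolding time_const_def by (simp only: distrib_right mult.assoc)
  qed
  finally show ?thesis .
qed

end

section \<open>Contradiction to the conjectured lower bound\<close>

lemma not_superlinear:
  fixes C D \<gamma> :: real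
  assumes "0 < \<gamma>" "0 < C" "\<forall>\<^sub>F m in sequentially. C * real m powr (1 + \<gamma>) \<le> D * (real m + 1)"
  shows False
proof -
  \<comment> \<open>The factor 2 absorbs \<open>m + 1 \<le> 2 * m\<close> for
    \<open>m \<ge> 1\<close>.\<close>
  define x where "x = 2 * \<bar>D\<bar> / C"
  have "0 \<le> x" using assms(2) by (simp add: x_def)
  have "\<forall>\<^sub>F m in sequentially. (x + 1) powr (1 / \<gamma>) < real m"
    using filterlim_real_sequentially unfolding filterlim_at_top_dense by blast
  hence "\<forall>\<^sub>F m in sequentially. 2 * \<bar>D\<bar> / C < real m powr \<gamma>"
  proof eventually_elim
    case (elim m)
    hence "((x + 1) powr (1 / \<gamma>)) powr \<gamma> < real m powr \<gamma>"
      using assms(1) by (intro powr_less_mono2) auto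
    moreover have "((x + 1) powr (1 / \<gamma>)) powr \<gamma> = x + 1"
      using assms(1) \<open>0 \<le> x\<close> by (simp add: powr_powr)
    ultimately show ?case unfolding x_def by linarith
  qed
  with assms(3) have "\<forall>\<^sub>F m :: nat in sequentially. False"
    using eventually_gt_at_top[of 0]
  proof eventually_elim
    case (elim m)
    have m: "1 \<le> real m" using elim(3) by simp
    have "2 * \<bar>D\<bar> * real m < C * real m powr \<gamma> * real m"
      using elim(2) m assms(2) by (simp add: pos_divide_less_eq mult.commute)
    also have "\<dots> = C * real m powr (1 + \<gamma>)" using m by (simp add: powr_add)
    also have "\<dots> \<le> D * (real m + 1)" by (rule elim(1))
    also have "\<dots> \<le> \<bar>D\<bar> * (real m + 1)" by (intro mult_right_mono) auto
    also have "\<dots> \<le> \<bar>D\<bar> * (2 * real m)" using m by (intro mult_left_mono) auto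
    finally show False by simp
  qed
  thus False by simp
qed

theorem theorem1p5:
  fixes H :: "'a graph"
  assumes "triangle_detection_conjecture"
    and "simple_graph H"
    and "\<not> alpha_acyclic H"
  shows "hom_cnt_hard H"
  unfolding hom_cnt_hard_def
proof
  assume "hom_cnt_easy H"
  then obtain P c and fd :: "nat \<Rightarrow> real" where c: "2 \<le> c" and solves: "solves P c (\<lambda>G. hom_count H G)"
    and fd: "\<And>n G es. presents es n G \<Longrightarrow>
      expected_time (word_length c n) P (init_state n es) \<le> ennreal (fd (degeneracy G) * real n)"
    unfolding hom_cnt_easy_def by blast
  obtain k f where kf: "6 \<le> k" "induced_cycle H k f"
    using induced_cycle_if_not_alpha_acyclic[OF assms(2,3)] by blast
  have finV: "finite (verts H)" using assms(2) by (simp add: simple_graph_def)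
  then obtain num where "bij_betw num (verts H) {0..<card (verts H)}"
    using ex_bij_betw_finite_nat by blast
  hence num: "inj_on num (verts H)" "\<And>u. u \<in> verts H \<Longrightarrow> num u < card (verts H)"
    by (auto simp: bij_betw_def)
  have "edges H \<subseteq> Pow (verts H)" using assms(2) by (auto simp: simple_graph_def)
  hence finE: "finite (edges H)" using finV finite_subset by blast
  obtain Es where Es: "set Es = Pow (edges H)" "distinct Es"
    using finite_distinct_list[of "Pow (edges H)"] finE by auto
  define FL where "FL = map (\<lambda>F. SOME l. set l = F \<and> distinct l) Es"
  have some: "set (SOME l. set l = F \<and> distinct l) = F \<and> distinct (SOME l. set l = F \<and> distinct l)"
    if "F \<in> set Es" for F
  proof (rule someI_ex)
    show "\<exists>l. set l = F \<and> distinct l"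
      using that Es(1) finE by (intro finite_distinct_list) (auto intro: finite_subset)
  qed
  have "map set FL = Es"
    unfolding FL_def map_map by (rule map_idI) (use some in simp)
  moreover have "set ` set FL = set (map set FL)" by simp
  moreover have "distinct Fs" if "Fs \<in> set FL" for Fs using that some by (auto simp: FL_def)
  ultimately have FL: "distinct (map set FL)" "set ` set FL = Pow (edges H)"
    "\<And>Fs. Fs \<in> set FL \<Longrightarrow> distinct Fs"
    using Es by simp_all
  obtain c' where c': "2 \<le> c'" and fit: "\<And>n m. 1 \<le> n \<Longrightarrow> m \<le> n * n \<Longrightarrow>
      n + 2 * m + (length FL + 2) * (2 * (card (verts H) * Suc (2 * m)) + 4) ^ c + 4 < 2 ^ word_length c' n"
    using ex_word_length by blast
  have red: "reduction H k f num P c FL (word_length c' n) n G es" if "presents es n G" for n G es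
  proof
    have p: "1 \<le> n" "simple_graph G" "verts G = {0..<n}" "distinct (map (\<lambda>(u, v). {u, v}) es)"
      "set (map (\<lambda>(u, v). {u, v}) es) = edges G" using that by (simp_all add: presents_def)
    have "length es = card (edges G)" using distinct_card[OF p(4)] p(5) by simp
    also have "\<dots> \<le> n * n" using card_edges_le[OF p(2)] p(3) by simp
    finally show "n + 2 * length es + (length FL + 2) *
        (2 * (card (verts H) * Suc (2 * length es)) + 4) ^ c + 4 < 2 ^ word_length c' n"
      by (intro fit p(1))
  qed (use assms(2) kf num c solves FL that in auto)
  \<comment> \<open>The code depends on \<open>H\<close>, \<open>P\<close> and the choices made for
    them, but not on \<open>G\<close> or the word length, so one program serves all inputs.\<close>
  define Q where "Q = reduction.program_code H k f num P c FL 0"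
  \<comment> \<open>\<open>fd\<close> is an arbitrary function; \<open>K\<close> bounds it on the
    finitely many degeneracies that gadgets can have.\<close>
  define K where "K = (\<Sum>d \<le> 2 * card (edges H). \<bar>fd d\<bar>)"
  define C where "C = \<bar>reduction.time_const H c FL K\<bar>"
  have K: "fd d \<le> K" if "d \<le> 2 * card (edges H)" for d
  proof -
    have "\<bar>fd d\<bar> \<le> K" unfolding K_def using that by (intro member_le_sum) auto
    thus ?thesis by simp
  qed
  have "0 \<le> K" unfolding K_def by (intro sum_nonneg) auto
  have time: "expected_time (word_length c' n) Q (init_state n es) \<le> ennreal (C * (real (length es) + 1))"
    if "presents es n G" for n G es
  proof -
    have "expected_time (word_length c' n) Q (init_state n es) \<le>
        ennreal (reduction.time_const H c FL K * (real (length es) + 1))"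
      unfolding Q_def
      by (rule reduction.expected_time_program[OF red[OF that], where fd = fd]) (use fd K \<open>0 \<le> K\<close> in auto)
    also have "\<dots> \<le> ennreal (C * (real (length es) + 1))"
      unfolding C_def by (intro ennreal_leI mult_right_mono) auto
    finally show ?thesis .
  qed
  have "solves Q c' (\<lambda>G. if triangle_free G then 1 else 0)"
    unfolding solves_def
  proof (intro allI impI)
    fix n G es assume p: "presents es n G"
    let ?x = "if triangle_free G then 1 else 0"
    obtain t where "runs_to (word_length c' n) Q (init_state n es) t ?x"
      using reduction.runs_to_program[OF red[OF p]] unfolding Q_def by blast
    hence "runs_to (word_length c' n) Q (init_state n es)
        (expected_time (word_length c' n) Q (init_state n es)) ?x"
      unfolding runs_to_def by simp
    moreover have "expected_time (word_length c' n) Q (init_state n es) < \<infinity>"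
      using time[OF p] by (rule le_less_trans) simp
    ultimately show "outputs (word_length c' n) Q (init_state n es) ?x" by (rule runs_to_outputs)
  qed
  then obtain \<gamma> B where \<gamma>: "0 < \<gamma>" "0 < B" "\<forall>\<^sub>F m in sequentially. ennreal (B * real m powr (1 + \<gamma>)) \<le> worst_time Q c' m"
    using assms(1) c' unfolding triangle_detection_conjecture_def by blast
  have worst: "worst_time Q c' m \<le> ennreal (C * (real m + 1))" for m
    unfolding worst_time_def
  proof (rule SUP_least, clarify)
    fix n G es assume p: "presents es n G"
    hence "length es = card (edges G)"
      using distinct_card[of "map (\<lambda>(u, v). {u, v}) es"] by (simp add: presents_def)
    thus "expected_time (word_length c' n) Q (init_state n es) \<le> ennreal (C * (real (card (edges G)) + 1))"
      using time[OF p] by simp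
  qed
  have "0 \<le> C" by (simp add: C_def)
  have "\<forall>\<^sub>F m in sequentially. B * real m powr (1 + \<gamma>) \<le> C * (real m + 1)"
    using \<gamma>(3)
  proof eventually_elim
    case (elim m)
    hence "ennreal (B * real m powr (1 + \<gamma>)) \<le> ennreal (C * (real m + 1))"
      using worst[of m] by (rule order_trans)
    thus ?case using \<open>0 \<le> C\<close> by (subst (asm) ennreal_le_iff) auto
  qed
  with \<gamma>(1,2) show False by (rule not_superlinear)
qed

end
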